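(* Let $P$ be a submonoid of a group $G$. The restriction of the canonical map $\lambda^+\colon\mathcal T_u(P)\to\mathcal T_\lambda(P)$ to the full diagonal $D_u$ gives a canonical isomorphism $D_u\cong D_r$. A representation of $\mathcal T_\lambda(P)$ is faithful on $D_r$ if and only if it is jointly proper.
   Context: $e$ is the identity of $G$. A word is a finite sequence $\alpha=(p_1,p_2,\ldots,p_{2k-1},p_{2k})$ of even length $2k\ge 0$ with entries in $P$ (the empty word is allowed). Put $\dot\alpha:=p_1^{-1}p_2\cdots p_{2k-1}^{-1}p_{2k}\in G$ (equal to $e$ for the empty word); $\alpha$ is neutral if $\dot\alpha=e$. Put $K(\alpha):=P\cap p_{2k}^{-1}p_{2k-1}P\cap p_{2k}^{-1}p_{2k-1}p_{2k-2}^{-1}p_{2k-3}P\cap\cdots\cap p_{2k}^{-1}p_{2k-1}\cdots p_2^{-1}p_1P\subseteq P$ (equal to $P$ for the empty word); sets of this form are the constructible right ideals of $P$. For a map $w\colon P\to B$ into a unital $\mathrm C^*$-algebra, $\dot w_\alpha:=w_{p_1}^*w_{p_2}\cdots w_{p_{2k-1}}^*w_{p_{2k}}$ ($=1$ for the empty word). $\mathcal T_u(P)$ is the universal $\mathrm C^*$-algebra with generators $\{t_p:p\in P\}$ subject to: (T1) $t_e=1$; (T2) $\dot t_\alpha=0$ if $\alpha$ is neutral and $K(\alpha)=\emptyset$; (T3) $\dot t_\alpha=\dot t_\beta$ if $\alpha,\beta$ are neutral and $K(\alpha)=K(\beta)$; (T4) $\prod_{\beta\in F}(\dot t_\alpha-\dot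 t_\beta)=0$ if $\alpha$ is a neutral word and $F$ is a finite set of neutral words with $K(\alpha)=\bigcup_{\beta\in F}K(\beta)$. $D_u:=\overline{\mathrm{span}}\{\dot t_\alpha:\dot\alpha=e\}\subseteq\mathcal T_u(P)$. $\mathcal T_\lambda(P)$ is the $\mathrm C^*$-algebra generated by the isometries $L_p\delta_q=\delta_{pq}$ on $\ell^2(P)$. For neutral $\alpha$, $\dot L_\alpha$ is multiplication by $\mathbb 1_{K(\alpha)}$, and $D_r:=\overline{\mathrm{span}}\{\mathbb 1_{K(\alpha)}:\dot\alpha=e\}\subseteq\mathcal T_\lambda(P)$. $\lambda^+\colon\mathcal T_u(P)\to\mathcal T_\lambda(P)$ is the canonical surjective $*$-homomorphism with $\lambda^+(t_p)=L_p$. A representation here is a unital $*$-homomorphism $\pi$ into a $\mathrm C^*$-algebra; a representation $\pi$ of $\mathcal T_\lambda(P)$ is jointly proper if $\prod_{\alpha\in F}(1-\pi(\dot L_\alpha))\neq0$ for every finite collection $F$ of neutral words such that $K(\alpha)\neq P$ for each $\alpha\in F$.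
   Formalization: In relation (T4) the finite set F is required to be nonempty; with F empty and K(α) empty the relation would read 1 = 0 and collapse the universal algebra, and for empty K(α) relation (T2) already applies. *)

theory Defs
  imports
    "HOL-Analysis.Infinite_Sum"
    "HOL-Library.Poly_Mapping"
    "HOL-Algebra.Coset"
    "HOL-Algebra.Module"
begin

section \<open>Unital C*-algebras with explicit carriers\<close>

record 'a star_alg = "(complex, 'a) module" +
  star :: "'a \<Rightarrow> 'a"

record 'a cstar_alg = "'a star_alg" +
  nrm :: "'a \<Rightarrow> real"

definition complex_ring :: "complex ring" where
  "complex_ring = \<lparr>carrier = UNIV, mult = (*), one = 1, zero = 0, add = (+)\<rparr>"

locale star_algebra = ring A + Module.module complex_ring A
  for A :: "('a, 'm) star_alg_scheme" (structure) +
  assumes smult_mult_left: "\<lbrakk>x \<in> carrier A; y \<in> carrier A\<rbrakk> \<Longrightarrow> (c \<odot> x) \<otimes> y = c \<odot> (x \<otimes> y)"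
    and smult_mult_right: "\<lbrakk>x \<in> carrier A; y \<in> carrier A\<rbrakk> \<Longrightarrow> x \<otimes> (c \<odot> y) = c \<odot> (x \<otimes> y)"
    and star_closed: "x \<in> carrier A \<Longrightarrow> star A x \<in> carrier A"
    and star_star: "x \<in> carrier A \<Longrightarrow> star A (star A x) = x"
    and star_add: "\<lbrakk>x \<in> carrier A; y \<in> carrier A\<rbrakk> \<Longrightarrow> star A (x \<oplus> y) = star A x \<oplus> star A y"
    and star_smult: "x \<in> carrier A \<Longrightarrow> star A (c \<odot> x) = cnj c \<odot> star A x"
    and star_mult: "\<lbrakk>x \<in> carrier A; y \<in> carrier A\<rbrakk> \<Longrightarrow> star A (x \<otimes> y) = star A y \<otimes> star A x"

definition cstar_seminorm :: "('a, 'm) star_alg_scheme \<Rightarrow> ('a \<Rightarrow> real) \<Rightarrow> bool" where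
  "cstar_seminorm A p \<longleftrightarrow>
     (\<forall>x\<in>carrier A. 0 \<le> p x) \<and>
     (\<forall>x\<in>carrier A. \<forall>y\<in>carrier A. p (x \<oplus>\<^bsub>A\<^esub> y) \<le> p x + p y) \<and>
     (\<forall>c. \<forall>x\<in>carrier A. p (c \<odot>\<^bsub>A\<^esub> x) = cmod c * p x) \<and>
     (\<forall>x\<in>carrier A. \<forall>y\<in>carrier A. p (x \<otimes>\<^bsub>A\<^esub> y) \<le> p x * p y) \<and>
     (\<forall>x\<in>carrier A. p (star A x \<otimes>\<^bsub>A\<^esub> x) = (p x)\<^sup>2)"

definition cauchy_seqs :: "('a, 'm) star_alg_scheme \<Rightarrow> ('a \<Rightarrow> real) \<Rightarrow> (nat \<Rightarrow> 'a) set" where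
  "cauchy_seqs A p =
     {x. (\<forall>n. x n \<in> carrier A) \<and> (\<forall>e>0. \<exists>N. \<forall>m\<ge>N. \<forall>n\<ge>N. p (x m \<ominus>\<^bsub>A\<^esub> x n) < e)}"

text \<open>The zero algebra, in which \<open>\<one> = \<zero>\<close>, is allowed.\<close>

locale cstar_algebra = star_algebra A for A :: "('a, 'm) cstar_alg_scheme" (structure) +
  assumes cstar_seminorm_nrm: "cstar_seminorm A (nrm A)"
    and nrm_eq_zero: "\<lbrakk>x \<in> carrier A; nrm A x = 0\<rbrakk> \<Longrightarrow> x = \<zero>"
    and complete: "X \<in> cauchy_seqs A (nrm A) \<Longrightarrow>
      \<exists>l\<in>carrier A. (\<lambda>n. nrm A (X n \<ominus> l)) \<longlonglongrightarrow> 0"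

definition unital_star_hom ::
    "('a, 'm) star_alg_scheme \<Rightarrow> ('b, 'n) star_alg_scheme \<Rightarrow> ('a \<Rightarrow> 'b) \<Rightarrow> bool" where
  "unital_star_hom A B f \<longleftrightarrow>
     f \<in> ring_hom A B \<and>
     (\<forall>c. \<forall>x\<in>carrier A. f (c \<odot>\<^bsub>A\<^esub> x) = c \<odot>\<^bsub>B\<^esub> f x) \<and>
     (\<forall>x\<in>carrier A. f (star A x) = star B (f x))"

definition cstar_iso ::
    "('a, 'm) cstar_alg_scheme \<Rightarrow> ('b, 'n) cstar_alg_scheme \<Rightarrow> ('a \<Rightarrow> 'b) \<Rightarrow> bool" where
  "cstar_iso A B f \<longleftrightarrow>
     cstar_algebra A \<and> cstar_algebra B \<and> unital_star_hom A B f \<and>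
     bij_betw f (carrier A) (carrier B)"

definition subspace_of :: "('a, 'm) star_alg_scheme \<Rightarrow> 'a set \<Rightarrow> bool" where
  "subspace_of A V \<longleftrightarrow> V \<subseteq> carrier A \<and> \<zero>\<^bsub>A\<^esub> \<in> V \<and>
     (\<forall>x\<in>V. \<forall>y\<in>V. x \<oplus>\<^bsub>A\<^esub> y \<in> V) \<and> (\<forall>c. \<forall>x\<in>V. c \<odot>\<^bsub>A\<^esub> x \<in> V)"

definition norm_closure :: "('a, 'm) cstar_alg_scheme \<Rightarrow> 'a set \<Rightarrow> 'a set" where
  "norm_closure A S =
     {l \<in> carrier A. \<exists>x. (\<forall>n. x n \<in> S) \<and> (\<lambda>n. nrm A (x n \<ominus>\<^bsub>A\<^esub> l)) \<longlonglongrightarrow> 0}"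

definition closed_span :: "('a, 'm) cstar_alg_scheme \<Rightarrow> 'a set \<Rightarrow> 'a set" where
  "closed_span A S = norm_closure A (subspace_of A hull S)"

definition cstar_subset :: "('a, 'm) cstar_alg_scheme \<Rightarrow> 'a set \<Rightarrow> bool" where
  "cstar_subset A V \<longleftrightarrow> subspace_of A V \<and>
     (\<forall>x\<in>V. \<forall>y\<in>V. x \<otimes>\<^bsub>A\<^esub> y \<in> V) \<and> (\<forall>x\<in>V. star A x \<in> V) \<and> norm_closure A V \<subseteq> V"

definition cstar_generated :: "('a, 'm) cstar_alg_scheme \<Rightarrow> 'a set \<Rightarrow> ('a, 'm) cstar_alg_scheme" where
  "cstar_generated A S = A\<lparr>carrier := cstar_subset A hull S\<rparr>"

definition list_product :: "('a, 'm) star_alg_scheme \<Rightarrow> 'a list \<Rightarrow> 'a" where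
  "list_product A xs = foldr (mult A) xs \<one>\<^bsub>A\<^esub>"


section \<open>The universal C*-algebra with given generators and relations\<close>

text \<open>Words in the letters \<open>x\<close> and \<open>x*\<close>; the flag \<open>True\<close> marks a starred letter. The free
  unital *-algebra is the complex monoid algebra of these words, whose product is the
  convolution product of \<open>Poly_Mapping\<close>.\<close>

datatype 'x star_word = Star_Word (letters: "('x \<times> bool) list")

instantiation star_word :: (type) monoid_add
begin

definition zero_star_word :: "'a star_word" where
  "0 = Star_Word []"

definition plus_star_word :: "'a star_word \<Rightarrow> 'a star_word \<Rightarrow> 'a star_word" where
  "u + v = Star_Word (letters u @ letters v)"

instance
  by standard (simp_all add: zero_star_word_def plus_star_word_def)

end

definition reverse_star :: "'x star_word \<Rightarrow> 'x star_word" where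
  "reverse_star u = Star_Word (rev (map (\<lambda>(x, b). (x, \<not> b)) (letters u)))"

lemma reverse_star_reverse_star [simp]: "reverse_star (reverse_star u) = u"
  by (cases u) (simp add: reverse_star_def rev_map case_prod_beta comp_def)

text \<open>\<open>map_key\<close> is meaningful here because \<open>reverse_star\<close> is injective: the coefficient of
  \<open>star a\<close> at \<open>u\<close> is the conjugate of that of \<open>a\<close> at \<open>reverse_star u\<close>.\<close>

definition free_star_algebra :: "'x set \<Rightarrow> ('x star_word \<Rightarrow>\<^sub>0 complex) star_alg" where
  "free_star_algebra X =
     \<lparr>carrier = {a. \<forall>u\<in>Poly_Mapping.keys a. fst ` set (letters u) \<subseteq> X},
      mult = (*), one = 1, zero = 0, add = (+),
      smult = (\<lambda>c a. Poly_Mapping.single 0 c * a),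
      star = (\<lambda>a. Poly_Mapping.map cnj (Poly_Mapping.map_key reverse_star a))\<rparr>"

definition free_gen :: "'x \<Rightarrow> ('x star_word \<Rightarrow>\<^sub>0 complex)" where
  "free_gen x = Poly_Mapping.single (Star_Word [(x, False)]) 1"

definition null_difference :: "('a, 'm) star_alg_scheme \<Rightarrow> ('a \<Rightarrow> real) \<Rightarrow> (nat \<Rightarrow> 'a) rel" where
  "null_difference A p =
     {(x, y). x \<in> cauchy_seqs A p \<and> y \<in> cauchy_seqs A p \<and> (\<lambda>n. p (x n \<ominus>\<^bsub>A\<^esub> y n)) \<longlonglongrightarrow> 0}"

text \<open>The Hausdorff completion of a *-algebra in a C*-seminorm: Cauchy sequences modulo null
  sequences, with operations defined through representatives.\<close>

definition cstar_completion ::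
    "('a, 'm) star_alg_scheme \<Rightarrow> ('a \<Rightarrow> real) \<Rightarrow> (nat \<Rightarrow> 'a) set cstar_alg" where
  "cstar_completion A p = (let r = null_difference A p in
     \<lparr>carrier = cauchy_seqs A p // r,
      mult = (\<lambda>X Y. \<Union>x\<in>X. \<Union>y\<in>Y. r `` {\<lambda>n. x n \<otimes>\<^bsub>A\<^esub> y n}),
      one = r `` {\<lambda>n. \<one>\<^bsub>A\<^esub>},
      zero = r `` {\<lambda>n. \<zero>\<^bsub>A\<^esub>},
      add = (\<lambda>X Y. \<Union>x\<in>X. \<Union>y\<in>Y. r `` {\<lambda>n. x n \<oplus>\<^bsub>A\<^esub> y n}),
      smult = (\<lambda>c X. \<Union>x\<in>X. r `` {\<lambda>n. c \<odot>\<^bsub>A\<^esub> x n}),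
      star = (\<lambda>X. \<Union>x\<in>X. r `` {\<lambda>n. star A (x n)}),
      nrm = (\<lambda>X. THE l. \<forall>x\<in>X. (\<lambda>n. p (x n)) \<longlonglongrightarrow> l)\<rparr>)"

text \<open>A relation is an element \<open>a\<close> of the free *-algebra, read as \<open>a = 0\<close>. Up to the choice of
  the target, C*-seminorms vanishing on \<open>R\<close> are the same as the families satisfying \<open>R\<close> in unital
  C*-algebras, so the supremum below is the usual universal seminorm. It is a real number only if
  the relations bound the generators; for the relations used here every generator becomes an
  isometry.\<close>

definition universal_seminorm ::
    "'x set \<Rightarrow> ('x star_word \<Rightarrow>\<^sub>0 complex) set \<Rightarrow> ('x star_word \<Rightarrow>\<^sub>0 complex) \<Rightarrow> real" where
  "universal_seminorm X R a =
     (SUP p\<in>{p. cstar_seminorm (free_star_algebra X) p \<and> (\<forall>r\<in>R. p r = 0)}. p a)"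

definition universal_cstar ::
    "'x set \<Rightarrow> ('x star_word \<Rightarrow>\<^sub>0 complex) set \<Rightarrow> (nat \<Rightarrow> ('x star_word \<Rightarrow>\<^sub>0 complex)) set cstar_alg" where
  "universal_cstar X R = cstar_completion (free_star_algebra X) (universal_seminorm X R)"

definition universal_gen ::
    "'x set \<Rightarrow> ('x star_word \<Rightarrow>\<^sub>0 complex) set \<Rightarrow> 'x \<Rightarrow> (nat \<Rightarrow> ('x star_word \<Rightarrow>\<^sub>0 complex)) set" where
  "universal_gen X R x =
     null_difference (free_star_algebra X) (universal_seminorm X R) `` {\<lambda>n. free_gen x}"


section \<open>Words and constructible right ideals\<close>

text \<open>The word \<open>(p\<^sub>1, p\<^sub>2, \<dots>, p\<^sub>2\<^sub>k\<^sub>-\<^sub>1, p\<^sub>2\<^sub>k)\<close> is encoded as the list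
  \<open>[(p\<^sub>1, p\<^sub>2), \<dots>, (p\<^sub>2\<^sub>k\<^sub>-\<^sub>1, p\<^sub>2\<^sub>k)]\<close> of \<open>k\<close> pairs.\<close>

primrec word_dot :: "('g, 'm) monoid_scheme \<Rightarrow> ('g \<times> 'g) list \<Rightarrow> 'g" where
  "word_dot G [] = \<one>\<^bsub>G\<^esub>"
| "word_dot G (pq # \<alpha>) = (inv\<^bsub>G\<^esub> (fst pq) \<otimes>\<^bsub>G\<^esub> snd pq) \<otimes>\<^bsub>G\<^esub> word_dot G \<alpha>"

text \<open>\<open>p\<^sub>2\<^sub>k\<inverse> p\<^sub>2\<^sub>k\<^sub>-\<^sub>1 \<cdots> p\<^sub>2\<inverse> p\<^sub>1\<close>\<close>

primrec word_back :: "('g, 'm) monoid_scheme \<Rightarrow> ('g \<times> 'g) list \<Rightarrow> 'g" where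
  "word_back G [] = \<one>\<^bsub>G\<^esub>"
| "word_back G (pq # \<alpha>) = word_back G \<alpha> \<otimes>\<^bsub>G\<^esub> (inv\<^bsub>G\<^esub> (snd pq) \<otimes>\<^bsub>G\<^esub> fst pq)"

primrec word_ideal :: "('g, 'm) monoid_scheme \<Rightarrow> 'g set \<Rightarrow> ('g \<times> 'g) list \<Rightarrow> 'g set" where
  "word_ideal G P [] = P"
| "word_ideal G P (pq # \<alpha>) = word_ideal G P \<alpha> \<inter> (word_back G (pq # \<alpha>) <#\<^bsub>G\<^esub> P)"

definition neutral_words :: "('g, 'm) monoid_scheme \<Rightarrow> 'g set \<Rightarrow> ('g \<times> 'g) list set" where
  "neutral_words G P = {\<alpha> \<in> lists (P \<times> P). word_dot G \<alpha> = \<one>\<^bsub>G\<^esub>}"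

primrec word_op :: "('a, 'm) star_alg_scheme \<Rightarrow> ('g \<Rightarrow> 'a) \<Rightarrow> ('g \<times> 'g) list \<Rightarrow> 'a" where
  "word_op A w [] = \<one>\<^bsub>A\<^esub>"
| "word_op A w (pq # \<alpha>) = (star A (w (fst pq)) \<otimes>\<^bsub>A\<^esub> w (snd pq)) \<otimes>\<^bsub>A\<^esub> word_op A w \<alpha>"


section \<open>The universal Toeplitz algebra\<close>

text \<open>In the last set, a finite set \<open>F\<close> of words enters through all its enumerations \<open>\<beta>s\<close>, so that
  the products need no commutativity. \<open>F\<close> has to be nonempty:
  otherwise a neutral word with empty ideal and \<open>F = {}\<close> would give the relation \<open>1 = 0\<close>, while
  for a neutral word with nonempty ideal \<open>F\<close> is nonempty anyway.\<close>

definition toeplitz_relations ::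
    "('g, 'm) monoid_scheme \<Rightarrow> 'g set \<Rightarrow> ('g star_word \<Rightarrow>\<^sub>0 complex) set" where
  "toeplitz_relations G P = (let A = free_star_algebra P; t = word_op A free_gen in
     {free_gen \<one>\<^bsub>G\<^esub> \<ominus>\<^bsub>A\<^esub> \<one>\<^bsub>A\<^esub>} \<union>
     {t \<alpha> |\<alpha>. \<alpha> \<in> neutral_words G P \<and> word_ideal G P \<alpha> = {}} \<union>
     {t \<alpha> \<ominus>\<^bsub>A\<^esub> t \<beta> |\<alpha> \<beta>. \<alpha> \<in> neutral_words G P \<and> \<beta> \<in> neutral_words G P \<and>
        word_ideal G P \<alpha> = word_ideal G P \<beta>} \<union>
     {list_product A (map (\<lambda>\<beta>. t \<alpha> \<ominus>\<^bsub>A\<^esub> t \<beta>) \<beta>s) |\<alpha> \<beta>s.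
        \<alpha> \<in> neutral_words G P \<and> \<beta>s \<in> lists (neutral_words G P) \<and> distinct \<beta>s \<and> \<beta>s \<noteq> [] \<and>
        word_ideal G P \<alpha> = (\<Union>\<beta>\<in>set \<beta>s. word_ideal G P \<beta>)})"

definition toeplitz_universal ::
    "('g, 'm) monoid_scheme \<Rightarrow> 'g set \<Rightarrow> (nat \<Rightarrow> ('g star_word \<Rightarrow>\<^sub>0 complex)) set cstar_alg" where
  "toeplitz_universal G P = universal_cstar P (toeplitz_relations G P)"

definition toeplitz_gen ::
    "('g, 'm) monoid_scheme \<Rightarrow> 'g set \<Rightarrow> 'g \<Rightarrow> (nat \<Rightarrow> ('g star_word \<Rightarrow>\<^sub>0 complex)) set" where
  "toeplitz_gen G P = universal_gen P (toeplitz_relations G P)"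

definition diagonal_universal ::
    "('g, 'm) monoid_scheme \<Rightarrow> 'g set \<Rightarrow> (nat \<Rightarrow> ('g star_word \<Rightarrow>\<^sub>0 complex)) set set" where
  "diagonal_universal G P =
     closed_span (toeplitz_universal G P)
       (word_op (toeplitz_universal G P) (toeplitz_gen G P) ` neutral_words G P)"


section \<open>The reduced Toeplitz algebra\<close>

text \<open>The Hilbert space \<open>\<ell>\<^sup>2(S)\<close> consists of functions vanishing off \<open>S\<close>.\<close>

definition ell2 :: "'g set \<Rightarrow> ('g \<Rightarrow> complex) set" where
  "ell2 S = {x. (\<forall>g. g \<notin> S \<longrightarrow> x g = 0) \<and> (\<lambda>g. (cmod (x g))\<^sup>2) summable_on S}"

definition ell2_inner :: "'g set \<Rightarrow> ('g \<Rightarrow> complex) \<Rightarrow> ('g \<Rightarrow> complex) \<Rightarrow> complex" where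
  "ell2_inner S x y = (\<Sum>\<^sub>\<infinity>g\<in>S. cnj (x g) * y g)"

definition ell2_norm :: "'g set \<Rightarrow> ('g \<Rightarrow> complex) \<Rightarrow> real" where
  "ell2_norm S x = sqrt (\<Sum>\<^sub>\<infinity>g\<in>S. (cmod (x g))\<^sup>2)"

definition delta :: "'g \<Rightarrow> 'g \<Rightarrow> complex" where
  "delta q = (\<lambda>g. if g = q then 1 else 0)"

definition bounded_ops :: "'g set \<Rightarrow> (('g \<Rightarrow> complex) \<Rightarrow> 'g \<Rightarrow> complex) set" where
  "bounded_ops S =
     {T \<in> extensional (ell2 S) \<inter> (ell2 S \<rightarrow> ell2 S).
        (\<forall>x\<in>ell2 S. \<forall>y\<in>ell2 S. T (\<lambda>g. x g + y g) = (\<lambda>g. T x g + T y g)) \<and>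
        (\<forall>c. \<forall>x\<in>ell2 S. T (\<lambda>g. c * x g) = (\<lambda>g. c * T x g)) \<and>
        (\<exists>C. \<forall>x\<in>ell2 S. ell2_norm S (T x) \<le> C * ell2_norm S x)}"

definition ell2_ops :: "'g set \<Rightarrow> (('g \<Rightarrow> complex) \<Rightarrow> 'g \<Rightarrow> complex) cstar_alg" where
  "ell2_ops S =
     \<lparr>carrier = bounded_ops S,
      mult = (\<lambda>T U. compose (ell2 S) T U),
      one = (\<lambda>x\<in>ell2 S. x),
      zero = (\<lambda>x\<in>ell2 S. (\<lambda>g. 0)),
      add = (\<lambda>T U. \<lambda>x\<in>ell2 S. (\<lambda>g. T x g + U x g)),
      smult = (\<lambda>c T. \<lambda>x\<in>ell2 S. (\<lambda>g. c * T x g)),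
      star = (\<lambda>T. THE U. U \<in> bounded_ops S \<and>
        (\<forall>x\<in>ell2 S. \<forall>y\<in>ell2 S. ell2_inner S (U x) y = ell2_inner S x (T y))),
      nrm = (\<lambda>T. SUP x\<in>{x \<in> ell2 S. ell2_norm S x \<le> 1}. ell2_norm S (T x))\<rparr>"

definition left_shift ::
    "('g, 'm) monoid_scheme \<Rightarrow> 'g set \<Rightarrow> 'g \<Rightarrow> ('g \<Rightarrow> complex) \<Rightarrow> 'g \<Rightarrow> complex" where
  "left_shift G P p =
     (\<lambda>x\<in>ell2 P. (\<lambda>g. if g \<in> p <#\<^bsub>G\<^esub> P then x (inv\<^bsub>G\<^esub> p \<otimes>\<^bsub>G\<^esub> g) else 0))"

lemma delta_in_ell2: "q \<in> S \<Longrightarrow> delta q \<in> ell2 S"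
proof -
  assume q: "q \<in> S"
  have "(\<lambda>g. (cmod (delta q g))\<^sup>2) summable_on {q}"
    by simp
  then have "(\<lambda>g. (cmod (delta q g))\<^sup>2) summable_on S"
    by (rule summable_on_cong_neutral[THEN iffD1, rotated -1])
      (use q in \<open>auto simp: delta_def\<close>)
  then show ?thesis
    using q by (auto simp: ell2_def delta_def)
qed

lemma left_shift_delta:
  assumes "group G" "submonoid P G" "p \<in> P" "q \<in> P"
  shows "left_shift G P p (delta q) = delta (p \<otimes>\<^bsub>G\<^esub> q)"
proof -
  interpret group G by fact
  have P: "P \<subseteq> carrier G"
    using assms(2) by (rule submonoid.subset)
  have "(if g \<in> p <#\<^bsub>G\<^esub> P then delta q (inv\<^bsub>G\<^esub> p \<otimes>\<^bsub>G\<^esub> g) else 0) = delta (p \<otimes>\<^bsub>G\<^esub> q) g" for g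
    using P assms(3,4) by (auto simp: delta_def l_coset_def m_assoc[symmetric] subset_iff)
  then show ?thesis
    using assms(4) by (simp add: left_shift_def delta_in_ell2)
qed

definition toeplitz_reduced ::
    "('g, 'm) monoid_scheme \<Rightarrow> 'g set \<Rightarrow> (('g \<Rightarrow> complex) \<Rightarrow> 'g \<Rightarrow> complex) cstar_alg" where
  "toeplitz_reduced G P = cstar_generated (ell2_ops P) (left_shift G P ` P)"

definition indicator_op :: "'g set \<Rightarrow> 'g set \<Rightarrow> ('g \<Rightarrow> complex) \<Rightarrow> 'g \<Rightarrow> complex" where
  "indicator_op S K = (\<lambda>x\<in>ell2 S. (\<lambda>g. if g \<in> K then x g else 0))"

definition diagonal_reduced ::
    "('g, 'm) monoid_scheme \<Rightarrow> 'g set \<Rightarrow> (('g \<Rightarrow> complex) \<Rightarrow> 'g \<Rightarrow> complex) set" where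
  "diagonal_reduced G P =
     closed_span (toeplitz_reduced G P)
       ((\<lambda>\<alpha>. indicator_op P (word_ideal G P \<alpha>)) ` neutral_words G P)"


section \<open>The canonical map and jointly proper representations\<close>

definition is_canonical_map ::
    "('g, 'm) monoid_scheme \<Rightarrow> 'g set \<Rightarrow>
     ((nat \<Rightarrow> ('g star_word \<Rightarrow>\<^sub>0 complex)) set \<Rightarrow> ('g \<Rightarrow> complex) \<Rightarrow> 'g \<Rightarrow> complex) \<Rightarrow> bool" where
  "is_canonical_map G P f \<longleftrightarrow>
     unital_star_hom (toeplitz_universal G P) (toeplitz_reduced G P) f \<and>
     (\<forall>p\<in>P. f (toeplitz_gen G P p) = left_shift G P p)"

definition lambda_plus ::
    "('g, 'm) monoid_scheme \<Rightarrow> 'g set \<Rightarrow>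
     (nat \<Rightarrow> ('g star_word \<Rightarrow>\<^sub>0 complex)) set \<Rightarrow> ('g \<Rightarrow> complex) \<Rightarrow> 'g \<Rightarrow> complex" where
  "lambda_plus G P =
     (THE f. f \<in> extensional (carrier (toeplitz_universal G P)) \<and> is_canonical_map G P f)"

definition jointly_proper ::
    "('g, 'm) monoid_scheme \<Rightarrow> 'g set \<Rightarrow> ('b, 'n) cstar_alg_scheme \<Rightarrow>
     ((('g \<Rightarrow> complex) \<Rightarrow> 'g \<Rightarrow> complex) \<Rightarrow> 'b) \<Rightarrow> bool" where
  "jointly_proper G P B \<pi> \<longleftrightarrow>
     (\<forall>\<alpha>s \<in> lists (neutral_words G P).
        distinct \<alpha>s \<and> (\<forall>\<alpha>\<in>set \<alpha>s. word_ideal G P \<alpha> \<noteq> P) \<longrightarrow>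
        list_product B
          (map (\<lambda>\<alpha>. \<one>\<^bsub>B\<^esub> \<ominus>\<^bsub>B\<^esub> \<pi> (word_op (toeplitz_reduced G P) (left_shift G P) \<alpha>)) \<alpha>s) \<noteq> \<zero>\<^bsub>B\<^esub>)"

end

theory Submission
  imports Defs "HOL-Analysis.Elementary_Normed_Spaces"
begin

text \<open>In a \<open>C\<^sup>*\<close>-algebra satisfying (T1)--(T4) the neutral words become commuting projections
  \<open>e\<^sub>\<alpha>\<close> depending only on \<open>K(\<alpha>)\<close>, and a product \<open>e\<^sub>\<alpha> \<Prod>(1 - e\<^sub>\<beta>)\<close> vanishes as soon as
  \<open>K(\<alpha>) \<subseteq> \<Union>K(\<beta>)\<close>. Splitting along such products bounds the norm of a combination
  \<open>\<Sum> c\<^sub>\<alpha> e\<^sub>\<alpha>\<close> by the supremum over \<open>P\<close> of the function \<open>\<Sum> c\<^sub>\<alpha> 1\<^bsub>K(\<alpha>)\<^esub>\<close>. In the reduced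
  algebra this supremum is a lower bound as well, so the canonical map is isometric on the span of
  the \<open>e\<^sub>\<alpha>\<close>, hence on the closed diagonal.

  If a representation kills some \<open>a \<noteq> 0\<close> in the reduced diagonal, approximate \<open>a\<close> by a combination
  that is large at a point \<open>g\<close>. On the atom of \<open>g\<close> with respect to this combination \<open>a\<close> is a scalar
  up to a small error, so a Neumann series puts the atom projection into the kernel. Conjugating it
  by \<open>L\<^sub>g\<close> yields a product \<open>\<Prod>(1 - e\<^sub>\<beta>)\<close> with all \<open>K(\<beta>) \<noteq> P\<close>, which joint properness
  forbids.\<close>

section \<open>Star algebras and C*-seminorms\<close>

text \<open>Two obstacles shape the development. The supremum in \<open>universal_seminorm\<close>
  has to be finite: the words \<open>[(p, p)]\<close> and \<open>[]\<close> have the same ideal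
  \<open>P\<close>, so (T3) makes each generator an isometry, of seminorm at most 1. And norm
  estimates have to come out of the C*-identity and Neumann series. Hence the sharp bound for a
  combination of projections is reached by taking powers, and contractivity is proved for
  homomorphisms into operators on \<open>ell2\<close>, where norms can be tested on vectors; the
  canonical map is of this kind. The representation \<open>\<pi>\<close> enters algebraically: the
  inverse from the Neumann series is formed in the reduced algebra and then mapped. That a product
  over a cover vanishes follows from (T4) once every K(\<beta>) is cut down to K(\<alpha>) by
  concatenating words, since the union is then exactly K(\<alpha>). Joint properness mentions only
  ideals different from \<open>P\<close>, yet controls all points: these are right ideals, so being
  different from \<open>P\<close> means missing the unit, and left translation brings any point g to
  the unit.\<close>

lemma complex_ring_simps [simp]:
  "carrier complex_ring = UNIV" "mult complex_ring = (*)" "one complex_ring = 1"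
  "zero complex_ring = 0" "add complex_ring = (+)"
  by (simp_all add: complex_ring_def)

lemma cring_complex_ring: "cring complex_ring"
proof (rule cringI)
  show "abelian_group complex_ring"
    by (rule abelian_groupI) (auto intro: exI[of _ "- x" for x :: complex] add.left_inverse)
  show "Group.comm_monoid complex_ring"
    by unfold_locales auto
qed (auto simp: algebra_simps)

text \<open>Scaling by -1 supplies the additive inverses, so an algebra is checked by its sums,
  products, scalar multiples and star alone. The rule serves for subalgebras, completions, the
  operators on \<open>ell2\<close> and the free algebra.\<close>

lemma star_algebraI:
  fixes A :: "('a, 'm) star_alg_scheme" (structure)
  assumes add_closed: "\<And>x y. \<lbrakk>x \<in> carrier A; y \<in> carrier A\<rbrakk> \<Longrightarrow> x \<oplus> y \<in> carrier A"
    and zero_closed: "\<zero> \<in> carrier A"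
    and add_assoc: "\<And>x y z. \<lbrakk>x \<in> carrier A; y \<in> carrier A; z \<in> carrier A\<rbrakk>
      \<Longrightarrow> (x \<oplus> y) \<oplus> z = x \<oplus> (y \<oplus> z)"
    and add_comm: "\<And>x y. \<lbrakk>x \<in> carrier A; y \<in> carrier A\<rbrakk> \<Longrightarrow> x \<oplus> y = y \<oplus> x"
    and zero_add: "\<And>x. x \<in> carrier A \<Longrightarrow> \<zero> \<oplus> x = x"
    and mult_closed: "\<And>x y. \<lbrakk>x \<in> carrier A; y \<in> carrier A\<rbrakk> \<Longrightarrow> x \<otimes> y \<in> carrier A"
    and one_closed: "\<one> \<in> carrier A"
    and mult_assoc: "\<And>x y z. \<lbrakk>x \<in> carrier A; y \<in> carrier A; z \<in> carrier A\<rbrakk>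
      \<Longrightarrow> (x \<otimes> y) \<otimes> z = x \<otimes> (y \<otimes> z)"
    and one_mult: "\<And>x. x \<in> carrier A \<Longrightarrow> \<one> \<otimes> x = x"
    and mult_one: "\<And>x. x \<in> carrier A \<Longrightarrow> x \<otimes> \<one> = x"
    and distr_l: "\<And>x y z. \<lbrakk>x \<in> carrier A; y \<in> carrier A; z \<in> carrier A\<rbrakk>
      \<Longrightarrow> (x \<oplus> y) \<otimes> z = x \<otimes> z \<oplus> y \<otimes> z"
    and distr_r: "\<And>x y z. \<lbrakk>x \<in> carrier A; y \<in> carrier A; z \<in> carrier A\<rbrakk>
      \<Longrightarrow> z \<otimes> (x \<oplus> y) = z \<otimes> x \<oplus> z \<otimes> y"
    and smult_closed: "\<And>c x. x \<in> carrier A \<Longrightarrow> c \<odot> x \<in> carrier A"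
    and smult_l_distr: "\<And>c d x. x \<in> carrier A \<Longrightarrow> (c + d) \<odot> x = c \<odot> x \<oplus> d \<odot> x"
    and smult_r_distr: "\<And>c x y. \<lbrakk>x \<in> carrier A; y \<in> carrier A\<rbrakk>
      \<Longrightarrow> c \<odot> (x \<oplus> y) = c \<odot> x \<oplus> c \<odot> y"
    and smult_assoc: "\<And>c d x. x \<in> carrier A \<Longrightarrow> (c * d) \<odot> x = c \<odot> (d \<odot> x)"
    and smult_one: "\<And>x. x \<in> carrier A \<Longrightarrow> 1 \<odot> x = x"
    and smult_zero: "\<And>x. x \<in> carrier A \<Longrightarrow> 0 \<odot> x = \<zero>"
    and smult_mult_left: "\<And>c x y. \<lbrakk>x \<in> carrier A; y \<in> carrier A\<rbrakk> \<Longrightarrow> (c \<odot> x) \<otimes> y = c \<odot> (x \<otimes> y)"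
    and smult_mult_right: "\<And>c x y. \<lbrakk>x \<in> carrier A; y \<in> carrier A\<rbrakk> \<Longrightarrow> x \<otimes> (c \<odot> y) = c \<odot> (x \<otimes> y)"
    and star_closed: "\<And>x. x \<in> carrier A \<Longrightarrow> star A x \<in> carrier A"
    and star_star: "\<And>x. x \<in> carrier A \<Longrightarrow> star A (star A x) = x"
    and star_add: "\<And>x y. \<lbrakk>x \<in> carrier A; y \<in> carrier A\<rbrakk>
      \<Longrightarrow> star A (x \<oplus> y) = star A x \<oplus> star A y"
    and star_smult: "\<And>c x. x \<in> carrier A \<Longrightarrow> star A (c \<odot> x) = cnj c \<odot> star A x"
    and star_mult: "\<And>x y. \<lbrakk>x \<in> carrier A; y \<in> carrier A\<rbrakk>
      \<Longrightarrow> star A (x \<otimes> y) = star A y \<otimes> star A x"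
  shows "star_algebra A"
proof -
  have neg: "\<exists>y\<in>carrier A. y \<oplus> x = \<zero>" if x: "x \<in> carrier A" for x
    using smult_l_distr[of x "-1" 1] smult_one[OF x] smult_zero[OF x] smult_closed[OF x] x
    by (intro bexI[of _ "(-1) \<odot> x"]) simp_all
  have ag: "abelian_group A"
    by (rule abelian_groupI) (use assms(1-5) neg in auto)
  have "ring A"
    by (rule ringI[OF ag]) (use assms in \<open>auto intro!: Group.monoidI\<close>)
  moreover have "module complex_ring A"
    by (rule moduleI[OF cring_complex_ring ag]) (use assms in simp_all)
  ultimately show ?thesis
    by (intro star_algebra.intro star_algebra_axioms.intro) (use assms in auto)
qed

context star_algebra
begin

text \<open>The unqualified names of the ring laws refer to the scalars, so they are restated for \<open>A\<close>.\<close>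

lemma ring_A: "ring A"
  using star_algebra_axioms by (rule star_algebra.axioms)

lemma abelian_group_A: "abelian_group A"
  using ring_A by (rule ring.axioms)

lemma abelian_monoid_A: "abelian_monoid A"
  using abelian_group_A by (rule abelian_group.axioms)

lemma monoid_A: "Group.monoid A"
  using ring_A by (rule ring.axioms)

lemma semiring_A: "semiring A"
  by unfold_locales

lemmas a_assoc = abelian_monoid.a_assoc[OF abelian_monoid_A]
  and a_comm = abelian_monoid.a_comm[OF abelian_monoid_A]
  and a_lcomm = abelian_monoid.a_lcomm[OF abelian_monoid_A]
  and l_zero = abelian_monoid.l_zero[OF abelian_monoid_A]
  and r_zero = abelian_monoid.r_zero[OF abelian_monoid_A]
  and l_neg = abelian_group.l_neg[OF abelian_group_A]
  and r_neg = abelian_group.r_neg[OF abelian_group_A]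
  and r_neg1 = abelian_group.r_neg1[OF abelian_group_A]
  and minus_equality = abelian_group.minus_equality[OF abelian_group_A]
  and m_assoc = monoid.m_assoc[OF monoid_A]
  and m_closed = monoid.m_closed[OF monoid_A]
  and l_one = monoid.l_one[OF monoid_A]
  and r_one = monoid.r_one[OF monoid_A]
  and l_distr = semiring.l_distr[OF semiring_A]
  and r_distr = semiring.r_distr[OF semiring_A]
  and l_null = semiring.l_null[OF semiring_A]
  and r_null = semiring.r_null[OF semiring_A]

lemmas a_ac = a_assoc a_comm a_lcomm

lemma csmult_closed [simp, intro]: "x \<in> carrier A \<Longrightarrow> c \<odot> x \<in> carrier A"
  using smult_closed[of c x] by simp

lemma csmult_l_distr: "x \<in> carrier A \<Longrightarrow> (c + d) \<odot> x = c \<odot> x \<oplus> d \<odot> x"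
  using smult_l_distr[of c d x] by simp

lemma csmult_r_distr: "\<lbrakk>x \<in> carrier A; y \<in> carrier A\<rbrakk> \<Longrightarrow> c \<odot> (x \<oplus> y) = c \<odot> x \<oplus> c \<odot> y"
  using smult_r_distr[of c x y] by simp

lemma csmult_assoc: "x \<in> carrier A \<Longrightarrow> c \<odot> (d \<odot> x) = (c * d) \<odot> x"
  using smult_assoc1[of c d x] by simp

lemma csmult_one [simp]: "x \<in> carrier A \<Longrightarrow> 1 \<odot> x = x"
  using smult_one[of x] by simp

lemma csmult_zero [simp]: "x \<in> carrier A \<Longrightarrow> 0 \<odot> x = \<zero>"
  using smult_l_null[of x] by simp

lemma csmult_zero_right [simp]: "c \<odot> \<zero> = \<zero>"
  using smult_r_null[of c] by simp

lemma csmult_neg_one: "x \<in> carrier A \<Longrightarrow> (-1) \<odot> x = \<ominus> x"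
  using csmult_l_distr[of x "-1" 1] by (intro minus_equality[symmetric]) simp_all

text \<open>In this form a difference is a sum with a scalar multiple, so the module laws settle
  most identities with differences by simplification.\<close>

lemma minus_eq_csmult: "\<lbrakk>x \<in> carrier A; y \<in> carrier A\<rbrakk> \<Longrightarrow> x \<ominus> y = x \<oplus> (-1) \<odot> y"
  by (simp add: a_minus_def csmult_neg_one)

lemma csmult_minus: "\<lbrakk>x \<in> carrier A; y \<in> carrier A\<rbrakk> \<Longrightarrow> c \<odot> (x \<ominus> y) = c \<odot> x \<ominus> c \<odot> y"
  by (simp add: minus_eq_csmult csmult_r_distr csmult_assoc mult.commute)

lemmas star_closed' [simp, intro] = star_closed
lemmas star_star' [simp] = star_star

lemma star_zero [simp]: "star A \<zero> = \<zero>"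
  using star_smult[of \<zero> 0] by simp

lemma star_one [simp]: "star A \<one> = \<one>"
proof -
  \<comment> \<open>The left side reduces to \<open>\<one>\<close>, the right side to
    \<open>star A \<one>\<close>.\<close>
  have "star A (star A \<one> \<otimes> \<one>) = star A \<one> \<otimes> star A (star A \<one>)"
    by (rule star_mult) simp_all
  then show ?thesis
    by simp
qed

lemma star_minus: "\<lbrakk>x \<in> carrier A; y \<in> carrier A\<rbrakk> \<Longrightarrow> star A (x \<ominus> y) = star A x \<ominus> star A y"
  by (simp add: minus_eq_csmult star_add star_smult)

lemma minus_self [simp]: "x \<in> carrier A \<Longrightarrow> x \<ominus> x = \<zero>"
  by (simp add: a_minus_def r_neg)

lemma minus_zero_right [simp]: "x \<in> carrier A \<Longrightarrow> x \<ominus> \<zero> = x"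
  by (simp add: minus_eq_csmult)

lemma minus_add_cancel: "\<lbrakk>x \<in> carrier A; y \<in> carrier A\<rbrakk> \<Longrightarrow> (x \<ominus> y) \<oplus> y = x"
  by (simp add: a_minus_def a_assoc l_neg)

lemma minus_eq_zero_iff: "\<lbrakk>x \<in> carrier A; y \<in> carrier A\<rbrakk> \<Longrightarrow> x \<ominus> y = \<zero> \<longleftrightarrow> x = y"
  by (metis a_minus_def minus_self minus_add_cancel l_zero)

lemma minus_in_carrier: "\<lbrakk>x \<in> carrier A; y \<in> carrier A\<rbrakk> \<Longrightarrow> x \<ominus> y \<in> carrier A"
  by (rule abelian_group.minus_closed[OF abelian_group_A])

lemma minus_minus_cancel:
  assumes "x \<in> carrier A" "z \<in> carrier A"
  shows "x \<ominus> (x \<ominus> z) = z"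
proof -
  have "x \<ominus> (x \<ominus> z) = x \<oplus> (\<ominus> x \<oplus> z)"
    using assms by (simp add: minus_eq_csmult csmult_r_distr csmult_assoc csmult_neg_one[symmetric])
  then show ?thesis
    using assms by (simp add: abelian_group.r_neg2[OF abelian_group_A])
qed

lemma list_product_closed [simp, intro]: "set xs \<subseteq> carrier A \<Longrightarrow> list_product A xs \<in> carrier A"
  by (induction xs) (auto simp: list_product_def)

end

lemma list_product_simps [simp]:
  "list_product A [] = \<one>\<^bsub>A\<^esub>" "list_product A (x # xs) = x \<otimes>\<^bsub>A\<^esub> list_product A xs"
  by (simp_all add: list_product_def)

section \<open>C*-seminorms, null sequences and Cauchy sequences\<close>

locale seminormed_star_algebra = star_algebra A for A :: "('a, 'm) star_alg_scheme" (structure) +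
  fixes p :: "'a \<Rightarrow> real"
  assumes cstar_seminorm: "cstar_seminorm A p"
begin

lemma p_nonneg [simp]: "x \<in> carrier A \<Longrightarrow> 0 \<le> p x"
  and p_triangle: "\<lbrakk>x \<in> carrier A; y \<in> carrier A\<rbrakk> \<Longrightarrow> p (x \<oplus> y) \<le> p x + p y"
  and p_smult: "x \<in> carrier A \<Longrightarrow> p (c \<odot> x) = cmod c * p x"
  and p_mult: "\<lbrakk>x \<in> carrier A; y \<in> carrier A\<rbrakk> \<Longrightarrow> p (x \<otimes> y) \<le> p x * p y"
  and p_cstar: "x \<in> carrier A \<Longrightarrow> p (star A x \<otimes> x) = (p x)\<^sup>2"
  using cstar_seminorm by (auto simp: cstar_seminorm_def)

lemma p_zero [simp]: "p \<zero> = 0"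
  using p_smult[of \<zero> 0] by simp

lemma p_minus_commute: "\<lbrakk>x \<in> carrier A; y \<in> carrier A\<rbrakk> \<Longrightarrow> p (x \<ominus> y) = p (y \<ominus> x)"
  using p_smult[of "x \<ominus> y" "-1"]
  by (simp add: minus_eq_csmult csmult_r_distr csmult_assoc a_comm)

lemma p_triangle_minus:
  "\<lbrakk>x \<in> carrier A; y \<in> carrier A; z \<in> carrier A\<rbrakk> \<Longrightarrow> p (x \<ominus> z) \<le> p (x \<ominus> y) + p (y \<ominus> z)"
proof -
  assume *: "x \<in> carrier A" "y \<in> carrier A" "z \<in> carrier A"
  then have "x \<ominus> z = (x \<ominus> y) \<oplus> (y \<ominus> z)"
    by (simp add: a_minus_def a_assoc r_neg1)
  then show ?thesis
    using * p_triangle[of "x \<ominus> y" "y \<ominus> z"] by simp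
qed

lemma p_diff_le: "\<lbrakk>x \<in> carrier A; y \<in> carrier A\<rbrakk> \<Longrightarrow> \<bar>p x - p y\<bar> \<le> p (x \<ominus> y)"
  using p_triangle_minus[of x y \<zero>] p_triangle_minus[of y x \<zero>] p_minus_commute[of x y] by simp

text \<open>The C*-identity gives p(y)^2 \<le> p(star y) p(y), hence p(y) \<le> p(star y). The
  reverse inequality is the same one for star y.\<close>

lemma p_star: assumes x: "x \<in> carrier A" shows "p (star A x) = p x"
proof -
  have le: "p y \<le> p (star A y)" if y: "y \<in> carrier A" for y
  proof (cases "p y = 0")
    case False
    have "p y * p y \<le> p (star A y) * p y"
      using p_cstar[OF y] p_mult[of "star A y" y] y by (simp add: power2_eq_square)
    then show ?thesis
      using False p_nonneg[OF y] by simp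
  qed (use y in simp)
  show ?thesis
    using le[of x] le[of "star A x"] x by simp
qed

text \<open>By the C*-identity p(\<one>) equals its own square, so it is 0 or 1; the value 0 occurs
  for the zero seminorm.\<close>

lemma p_one_le: "p \<one> \<le> 1"
proof -
  have "p \<one> = (p \<one>)\<^sup>2"
    using p_cstar[of \<one>] by simp
  then show ?thesis
    by (cases "p \<one> = 0") (auto simp: power2_eq_square)
qed

lemma p_add_diff_le:
  assumes "x \<in> carrier A" "y \<in> carrier A" "x' \<in> carrier A" "y' \<in> carrier A"
  shows "p ((x \<oplus> y) \<ominus> (x' \<oplus> y')) \<le> p (x \<ominus> x') + p (y \<ominus> y')"
proof -
  have "(x \<oplus> y) \<ominus> (x' \<oplus> y') = (x \<ominus> x') \<oplus> (y \<ominus> y')"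
    using assms by (simp add: minus_eq_csmult csmult_r_distr a_ac)
  then show ?thesis
    using assms p_triangle[of "x \<ominus> x'" "y \<ominus> y'"] by simp
qed

text \<open>Splitting the difference as x (y - y') + (x - x') y' leaves only the norms of x and y'
  as factors. This is why \<open>null_mult\<close> asks for bounds on the first unprimed and the
  second primed family.\<close>

lemma p_mult_diff_le:
  assumes "x \<in> carrier A" "y \<in> carrier A" "x' \<in> carrier A" "y' \<in> carrier A"
  shows "p ((x \<otimes> y) \<ominus> (x' \<otimes> y')) \<le> p x * p (y \<ominus> y') + p (x \<ominus> x') * p y'"
proof -
  have "(x \<otimes> y) \<ominus> (x' \<otimes> y') = x \<otimes> (y \<ominus> y') \<oplus> (x \<ominus> x') \<otimes> y'"
  proof -
    have "x \<otimes> (y \<ominus> y') \<oplus> (x \<ominus> x') \<otimes> y' =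
        x \<otimes> y \<oplus> ((-1) \<odot> (x \<otimes> y') \<oplus> x \<otimes> y') \<oplus> (-1) \<odot> (x' \<otimes> y')"
      using assms by (simp add: minus_eq_csmult l_distr r_distr smult_mult_right smult_mult_left a_assoc)
    also have "\<dots> = (x \<otimes> y) \<ominus> (x' \<otimes> y')"
      using assms by (simp add: csmult_neg_one l_neg a_minus_def)
    finally show ?thesis ..
  qed
  then show ?thesis
    using assms p_triangle[of "x \<otimes> (y \<ominus> y')" "(x \<ominus> x') \<otimes> y'"]
      p_mult[of x "y \<ominus> y'"] p_mult[of "x \<ominus> x'" y'] by simp
qed

lemma p_smult_diff: "\<lbrakk>x \<in> carrier A; x' \<in> carrier A\<rbrakk> \<Longrightarrow> p (c \<odot> x \<ominus> c \<odot> x') = cmod c * p (x \<ominus> x')"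
  using p_smult[of "x \<ominus> x'" c] by (simp add: csmult_minus)

lemma p_star_diff: "\<lbrakk>x \<in> carrier A; x' \<in> carrier A\<rbrakk> \<Longrightarrow> p (star A x \<ominus> star A x') = p (x \<ominus> x')"
  using p_star[of "x \<ominus> x'"] by (simp add: star_minus)

text \<open>The filter is arbitrary so that these null lemmas apply both to sequences and to the
  product filter that expresses the Cauchy condition.\<close>

lemma null_trans:
  assumes "((\<lambda>i. p (f i \<ominus> g i)) \<longlongrightarrow> 0) F" "((\<lambda>i. p (g i \<ominus> h i)) \<longlongrightarrow> 0) F"
    and "\<And>i. f i \<in> carrier A" "\<And>i. g i \<in> carrier A" "\<And>i. h i \<in> carrier A"
  shows "((\<lambda>i. p (f i \<ominus> h i)) \<longlongrightarrow> 0) F"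
  by (rule Lim_null_comparison[OF _ tendsto_add_zero[OF assms(1,2)]])
    (use p_triangle_minus assms(3-) in \<open>simp add: eventuallyI\<close>)

lemma null_add:
  assumes "((\<lambda>i. p (f i \<ominus> f' i)) \<longlongrightarrow> 0) F" "((\<lambda>i. p (g i \<ominus> g' i)) \<longlongrightarrow> 0) F"
    and "\<And>i. f i \<in> carrier A" "\<And>i. f' i \<in> carrier A" "\<And>i. g i \<in> carrier A" "\<And>i. g' i \<in> carrier A"
  shows "((\<lambda>i. p ((f i \<oplus> g i) \<ominus> (f' i \<oplus> g' i))) \<longlongrightarrow> 0) F"
  by (rule Lim_null_comparison[OF _ tendsto_add_zero[OF assms(1,2)]])
    (use p_add_diff_le assms(3-) in \<open>simp add: eventuallyI\<close>)

lemma null_mult: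
  assumes "((\<lambda>i. p (f i \<ominus> f' i)) \<longlongrightarrow> 0) F" "((\<lambda>i. p (g i \<ominus> g' i)) \<longlongrightarrow> 0) F"
    and "\<And>i. f i \<in> carrier A" "\<And>i. f' i \<in> carrier A" "\<And>i. g i \<in> carrier A" "\<And>i. g' i \<in> carrier A"
    and "\<And>i. p (f i) \<le> B" "\<And>i. p (g' i) \<le> B'"
  shows "((\<lambda>i. p ((f i \<otimes> g i) \<ominus> (f' i \<otimes> g' i))) \<longlongrightarrow> 0) F"
proof (rule Lim_null_comparison)
  show "((\<lambda>i. B * p (g i \<ominus> g' i) + p (f i \<ominus> f' i) * B') \<longlongrightarrow> 0) F"
    by (intro tendsto_add_zero tendsto_mult_left_zero tendsto_mult_right_zero assms)
  show "eventually (\<lambda>i. norm (p ((f i \<otimes> g i) \<ominus> (f' i \<otimes> g' i)))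
      \<le> B * p (g i \<ominus> g' i) + p (f i \<ominus> f' i) * B') F"
  proof (intro eventuallyI)
    fix i
    have "p (f i) * p (g i \<ominus> g' i) \<le> B * p (g i \<ominus> g' i)"
      and "p (f i \<ominus> f' i) * p (g' i) \<le> p (f i \<ominus> f' i) * B'"
      using assms by (auto intro!: mult_right_mono mult_left_mono)
    then show "norm (p ((f i \<otimes> g i) \<ominus> (f' i \<otimes> g' i)))
        \<le> B * p (g i \<ominus> g' i) + p (f i \<ominus> f' i) * B'"
      using p_mult_diff_le[of "f i" "g i" "f' i" "g' i"] assms by simp
  qed
qed

lemma null_smult:
  assumes "((\<lambda>i. p (f i \<ominus> f' i)) \<longlongrightarrow> 0) F"
    and "\<And>i. f i \<in> carrier A" "\<And>i. f' i \<in> carrier A"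
  shows "((\<lambda>i. p (c \<odot> f i \<ominus> c \<odot> f' i)) \<longlongrightarrow> 0) F"
  using assms by (simp add: p_smult_diff tendsto_mult_right_zero)

lemma null_star:
  assumes "((\<lambda>i. p (f i \<ominus> f' i)) \<longlongrightarrow> 0) F"
    and "\<And>i. f i \<in> carrier A" "\<And>i. f' i \<in> carrier A"
  shows "((\<lambda>i. p (star A (f i) \<ominus> star A (f' i))) \<longlongrightarrow> 0) F"
  using assms by (simp add: p_star_diff)

text \<open>As convergence along a product filter, the Cauchy condition is a null condition, and its
  stability under the operations becomes an instance of the null lemmas.\<close>

lemma cauchy_seqs_iff:
  "x \<in> cauchy_seqs A p \<longleftrightarrow>
     (\<forall>n. x n \<in> carrier A) \<and>
     ((\<lambda>i. p (x (fst i) \<ominus> x (snd i))) \<longlongrightarrow> 0) (sequentially \<times>\<^sub>F sequentially)"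
proof -
  have "(\<forall>e>0. \<exists>N. \<forall>m\<ge>N. \<forall>n\<ge>N. p (x m \<ominus> x n) < e) \<longleftrightarrow>
     ((\<lambda>i. p (x (fst i) \<ominus> x (snd i))) \<longlongrightarrow> 0) (sequentially \<times>\<^sub>F sequentially)"
    if "\<forall>n. x n \<in> carrier A"
  proof -
    have nn: "\<And>i j. \<bar>p (x i \<ominus> x j)\<bar> = p (x i \<ominus> x j)"
      using that by simp
    have swap: "(\<forall>m\<ge>N. \<forall>n\<ge>N. p (x m \<ominus> x n) < e) \<longleftrightarrow> (\<forall>m\<ge>N. \<forall>n\<ge>N. p (x n \<ominus> x m) < e)"
      for N :: nat and e
      by auto
    show ?thesis
      by (simp add: tendsto_iff eventually_prod_sequentially dist_real_def nn swap)
  qed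
  then show ?thesis
    by (auto simp: cauchy_seqs_def)
qed

lemma cauchy_seqs_closed: "x \<in> cauchy_seqs A p \<Longrightarrow> x n \<in> carrier A"
  by (simp add: cauchy_seqs_def)

lemma cauchy_seqsE:
  assumes "x \<in> cauchy_seqs A p" "e > 0"
  obtains N where "\<And>m n. \<lbrakk>m \<ge> N; n \<ge> N\<rbrakk> \<Longrightarrow> p (x m \<ominus> x n) < e"
  using assms unfolding cauchy_seqs_def by blast

lemma cauchy_seqs_bounded:
  assumes "x \<in> cauchy_seqs A p"
  obtains B where "\<And>n. p (x n) \<le> B"
proof -
  obtain N where N: "\<And>m n. m \<ge> N \<Longrightarrow> n \<ge> N \<Longrightarrow> p (x m \<ominus> x n) < 1"
    using assms by (force simp: cauchy_seqs_def dest: spec[of _ "1 :: real"])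
  have x: "x n \<in> carrier A" for n
    using assms by (rule cauchy_seqs_closed)
  have "p (x n) \<le> Max ((\<lambda>n. p (x n)) ` {..N}) + 1" for n
  proof (cases "n \<le> N")
    case True
    then have "p (x n) \<le> Max ((\<lambda>n. p (x n)) ` {..N})"
      by (intro Max_ge) auto
    then show ?thesis
      by simp
  next
    case False
    then have "p (x n) \<le> p (x N) + 1"
      using N[of n N] p_diff_le[of "x n" "x N"] x by simp
    also have "p (x N) \<le> Max ((\<lambda>n. p (x n)) ` {..N})"
      by (intro Max_ge) auto
    finally show ?thesis
      by simp
  qed
  then show ?thesis
    by (rule that)
qed

lemma cauchy_seqs_add:
  "\<lbrakk>x \<in> cauchy_seqs A p; y \<in> cauchy_seqs A p\<rbrakk> \<Longrightarrow> (\<lambda>n. x n \<oplus> y n) \<in> cauchy_seqs A p"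
  by (auto simp: cauchy_seqs_iff intro!: null_add)

lemma cauchy_seqs_mult:
  assumes "x \<in> cauchy_seqs A p" "y \<in> cauchy_seqs A p"
  shows "(\<lambda>n. x n \<otimes> y n) \<in> cauchy_seqs A p"
proof -
  obtain B B' where "\<And>n. p (x n) \<le> B" "\<And>n. p (y n) \<le> B'"
    using cauchy_seqs_bounded assms by metis
  then show ?thesis
    using assms by (auto simp: cauchy_seqs_iff intro!: null_mult)
qed

lemma cauchy_seqs_smult: "x \<in> cauchy_seqs A p \<Longrightarrow> (\<lambda>n. c \<odot> x n) \<in> cauchy_seqs A p"
  by (auto simp: cauchy_seqs_iff intro!: null_smult)

lemma cauchy_seqs_star: "x \<in> cauchy_seqs A p \<Longrightarrow> (\<lambda>n. star A (x n)) \<in> cauchy_seqs A p"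
  by (auto simp: cauchy_seqs_iff intro!: null_star)

lemma cauchy_seqs_const: "a \<in> carrier A \<Longrightarrow> (\<lambda>n. a) \<in> cauchy_seqs A p"
  by (auto simp: cauchy_seqs_def)

lemma convergent_imp_cauchy_seqs:
  assumes "\<And>n. x n \<in> carrier A" "l \<in> carrier A" "(\<lambda>n. p (x n \<ominus> l)) \<longlonglongrightarrow> 0"
  shows "x \<in> cauchy_seqs A p"
  unfolding cauchy_seqs_iff
proof (intro conjI allI)
  have "((\<lambda>i. p (x (fst i) \<ominus> l)) \<longlongrightarrow> 0) (sequentially \<times>\<^sub>F sequentially)"
    using filterlim_compose[OF assms(3) filterlim_fst] .
  moreover have "((\<lambda>i. p (l \<ominus> x (snd i))) \<longlongrightarrow> 0) (sequentially \<times>\<^sub>F sequentially)"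
    using filterlim_compose[OF assms(3) filterlim_snd] assms by (simp add: p_minus_commute)
  ultimately show "((\<lambda>i. p (x (fst i) \<ominus> x (snd i))) \<longlongrightarrow> 0) (sequentially \<times>\<^sub>F sequentially)"
    by (rule null_trans) (use assms in auto)
qed (use assms in simp)

text \<open>Telescoping bounds the distance of two entries by a segment of a convergent geometric
  series.\<close>

lemma cauchy_seqs_geometric:
  assumes x: "\<And>n. x n \<in> carrier A" and r: "0 \<le> r" "r < 1"
    and step: "\<And>n. p (x (Suc n) \<ominus> x n) \<le> C * r ^ n"
  shows "x \<in> cauchy_seqs A p"
proof -
  have summ: "summable (\<lambda>n. C * r ^ n)"
    using r by (intro summable_mult summable_geometric) simp
  have tele: "p (x (m + k) \<ominus> x m) \<le> (\<Sum>i=m..<m+k. C * r ^ i)" for m k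
  proof (induction k)
    case (Suc k)
    have "p (x (m + Suc k) \<ominus> x m) \<le> p (x (Suc (m + k)) \<ominus> x (m + k)) + p (x (m + k) \<ominus> x m)"
      using p_triangle_minus x by simp
    then show ?case
      using Suc step[of "m + k"] by simp
  qed (use x in simp)
  have *: "\<exists>N. \<forall>m\<ge>N. \<forall>n\<ge>N. p (x m \<ominus> x n) < e" if "e > 0" for e :: real
  proof -
    obtain N where N: "\<And>m n. m \<ge> N \<Longrightarrow> norm (\<Sum>i=m..<n. C * r ^ i) < e"
      using summ \<open>e > 0\<close> unfolding summable_Cauchy by meson
    have le: "p (x n \<ominus> x m) < e" if "N \<le> m" "m \<le> n" for m n
      using tele[of m "n - m"] N[of m n] that by auto
    have "p (x m \<ominus> x n) < e" if "N \<le> m" "N \<le> n" for m n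
      using le[of m n] le[of n m] that p_minus_commute[of "x m" "x n"] x
      by (cases "m \<le> n") auto
    then show ?thesis
      by blast
  qed
  then show ?thesis
    using x unfolding cauchy_seqs_def by blast
qed

end

sublocale cstar_algebra \<subseteq> seminormed_star_algebra A "nrm A"
  by (intro seminormed_star_algebra.intro seminormed_star_algebra_axioms.intro
      star_algebra_axioms cstar_seminorm_nrm)

section \<open>Limits and Neumann series in a C*-algebra\<close>

context cstar_algebra
begin

lemma limit_unique:
  assumes "(\<lambda>n. nrm A (x n \<ominus> l)) \<longlonglongrightarrow> 0" "(\<lambda>n. nrm A (x n \<ominus> l')) \<longlonglongrightarrow> 0"
    and "\<And>n. x n \<in> carrier A" "l \<in> carrier A" "l' \<in> carrier A"
  shows "l = l'"
proof -
  have "(\<lambda>n. nrm A (l \<ominus> x n)) \<longlonglongrightarrow> 0"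
    using assms(1,3,4) by (simp add: p_minus_commute)
  from null_trans[OF this assms(2)] have "(\<lambda>n::nat. nrm A (l \<ominus> l')) \<longlonglongrightarrow> 0"
    using assms by simp
  then have "nrm A (l \<ominus> l') = 0"
    by (simp add: LIMSEQ_const_iff)
  then show ?thesis
    using nrm_eq_zero[of "l \<ominus> l'"] assms minus_eq_zero_iff by simp
qed

lemma nrm_tendsto:
  assumes "((\<lambda>i. nrm A (x i \<ominus> l)) \<longlongrightarrow> 0) F" "\<And>i. x i \<in> carrier A" "l \<in> carrier A"
  shows "((\<lambda>i. nrm A (x i)) \<longlongrightarrow> nrm A l) F"
  by (rule LIM_zero_cancel, rule Lim_null_comparison[OF _ assms(1)])
    (use p_diff_le assms(2,3) in \<open>auto intro!: eventuallyI\<close>)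

text \<open>The map y \<mapsto> \<one> + d y contracts distances by the factor
  \<open>nrm A d\<close>, and its fixed point is a right inverse of \<one> - d. The iteration
  \<open>s\<close> converges to it. Where a left inverse is wanted, it is obtained by applying the
  star.\<close>

lemma neumann_inverse:
  assumes d: "d \<in> carrier A" "nrm A d < 1"
  obtains u where "u \<in> carrier A" "(\<one> \<ominus> d) \<otimes> u = \<one>"
proof -
  define s where "s = rec_nat \<one> (\<lambda>_ y. \<one> \<oplus> d \<otimes> y)"
  have s0: "s 0 = \<one>" and sS: "\<And>n. s (Suc n) = \<one> \<oplus> d \<otimes> s n"
    by (simp_all add: s_def)
  have s: "s n \<in> carrier A" for n
    by (induction n) (use d in \<open>simp_all add: s0 sS\<close>)
  have diff: "nrm A ((\<one> \<oplus> d \<otimes> y) \<ominus> (\<one> \<oplus> d \<otimes> z)) \<le> nrm A d * nrm A (y \<ominus> z)"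
    if "y \<in> carrier A" "z \<in> carrier A" for y z
    using p_add_diff_le[of \<one> "d \<otimes> y" \<one> "d \<otimes> z"] p_mult_diff_le[of d y d z] d that by simp
  have step: "nrm A (s (Suc n) \<ominus> s n) \<le> nrm A (s 1 \<ominus> s 0) * nrm A d ^ n" for n
  proof (induction n)
    case (Suc n)
    have "nrm A (s (Suc (Suc n)) \<ominus> s (Suc n)) \<le> nrm A d * nrm A (s (Suc n) \<ominus> s n)"
      using diff[OF s[of "Suc n"] s[of n]] by (simp only: sS[symmetric])
    also have "\<dots> \<le> nrm A d * (nrm A (s 1 \<ominus> s 0) * nrm A d ^ n)"
      using d Suc by (intro mult_left_mono) simp_all
    finally show ?case
      by (simp add: mult_ac)
  qed simp
  have "s \<in> cauchy_seqs A (nrm A)"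
    using s _ _ step by (rule cauchy_seqs_geometric) (use d in simp_all)
  then obtain u where u: "u \<in> carrier A" "(\<lambda>n. nrm A (s n \<ominus> u)) \<longlonglongrightarrow> 0"
    using complete by blast
  have "(\<lambda>n. nrm A (s (Suc n) \<ominus> (\<one> \<oplus> d \<otimes> u))) \<longlonglongrightarrow> 0"
    unfolding sS
    by (rule Lim_null_comparison[OF _ tendsto_mult_right_zero[OF u(2), of "nrm A d"]])
      (use diff s u d in \<open>auto intro!: eventuallyI\<close>)
  moreover have "(\<lambda>n. nrm A (s (Suc n) \<ominus> u)) \<longlonglongrightarrow> 0"
    using LIMSEQ_Suc[OF u(2)] .
  ultimately have "\<one> \<oplus> d \<otimes> u = u"
    by (rule limit_unique) (use s u d in simp_all)
  then have "u \<ominus> d \<otimes> u = (\<one> \<oplus> d \<otimes> u) \<ominus> d \<otimes> u"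
    by simp
  also have "\<dots> = \<one>"
    using u d by (simp add: a_minus_def a_assoc r_neg)
  finally have "u \<ominus> d \<otimes> u = \<one>" .
  then have "(\<one> \<ominus> d) \<otimes> u = \<one>"
    using u d by (simp add: minus_eq_csmult l_distr smult_mult_left)
  with u(1) show ?thesis
    by (rule that)
qed

end

section \<open>Homomorphisms, subalgebras and closed spans\<close>

locale star_hom = A: star_algebra A + B: star_algebra B
  for A :: "('a, 'm) star_alg_scheme" and B :: "('b, 'n) star_alg_scheme" +
  fixes f :: "'a \<Rightarrow> 'b"
  assumes hom: "unital_star_hom A B f"
begin

lemma hom_closed [simp, intro]: "x \<in> carrier A \<Longrightarrow> f x \<in> carrier B"
  and hom_mult: "\<lbrakk>x \<in> carrier A; y \<in> carrier A\<rbrakk> \<Longrightarrow> f (x \<otimes>\<^bsub>A\<^esub> y) = f x \<otimes>\<^bsub>B\<^esub> f y"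
  and hom_add: "\<lbrakk>x \<in> carrier A; y \<in> carrier A\<rbrakk> \<Longrightarrow> f (x \<oplus>\<^bsub>A\<^esub> y) = f x \<oplus>\<^bsub>B\<^esub> f y"
  and hom_one: "f \<one>\<^bsub>A\<^esub> = \<one>\<^bsub>B\<^esub>"
  and hom_smult: "x \<in> carrier A \<Longrightarrow> f (c \<odot>\<^bsub>A\<^esub> x) = c \<odot>\<^bsub>B\<^esub> f x"
  and hom_star: "x \<in> carrier A \<Longrightarrow> f (star A x) = star B (f x)"
  using hom by (auto simp: unital_star_hom_def ring_hom_def)

lemma hom_zero: "f \<zero>\<^bsub>A\<^esub> = \<zero>\<^bsub>B\<^esub>"
  using hom_smult[of "\<zero>\<^bsub>A\<^esub>" 0] by simp

lemma hom_minus: "\<lbrakk>x \<in> carrier A; y \<in> carrier A\<rbrakk> \<Longrightarrow> f (x \<ominus>\<^bsub>A\<^esub> y) = f x \<ominus>\<^bsub>B\<^esub> f y"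
  by (simp add: A.minus_eq_csmult B.minus_eq_csmult hom_add hom_smult)

lemma hom_list_product: "set xs \<subseteq> carrier A \<Longrightarrow> f (list_product A xs) = list_product B (map f xs)"
  by (induction xs) (simp_all add: hom_one hom_mult)

text \<open>Membership in the carrier is carried along in the induction because \<open>f\<close> is
  multiplicative only there.\<close>

lemma hom_word_op: "(\<And>x. x \<in> X \<Longrightarrow> w x \<in> carrier A) \<Longrightarrow> \<alpha> \<in> lists (X \<times> X) \<Longrightarrow>
    f (word_op A w \<alpha>) = word_op B (f \<circ> w) \<alpha> \<and> word_op A w \<alpha> \<in> carrier A"
  by (induction \<alpha>) (auto simp: hom_one hom_mult hom_star A.m_closed)

end

lemma unital_star_hom_comp:
  "\<lbrakk>unital_star_hom A B f; unital_star_hom B C g\<rbrakk> \<Longrightarrow> unital_star_hom A C (\<lambda>x. g (f x))"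
  by (auto simp: unital_star_hom_def ring_hom_def Pi_iff)

lemma star_homI:
  "\<lbrakk>star_algebra A; star_algebra B; unital_star_hom A B f\<rbrakk> \<Longrightarrow> star_hom A B f"
  by (simp add: star_hom_def star_hom_axioms_def)

context star_algebra
begin

lemma word_op_closed:
  "(\<And>x. x \<in> X \<Longrightarrow> w x \<in> carrier A) \<Longrightarrow> \<alpha> \<in> lists (X \<times> X) \<Longrightarrow> word_op A w \<alpha> \<in> carrier A"
  by (induction \<alpha>) (auto simp: m_closed)

lemma word_op_append:
  assumes "\<And>x. x \<in> X \<Longrightarrow> w x \<in> carrier A" "\<alpha> \<in> lists (X \<times> X)" "\<beta> \<in> lists (X \<times> X)"
  shows "word_op A w (\<alpha> @ \<beta>) = word_op A w \<alpha> \<otimes> word_op A w \<beta>"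
  using assms(2)
proof (induction \<alpha>)
  case Nil
  then show ?case
    using word_op_closed[OF assms(1,3)] by (simp add: l_one)
next
  case (Cons pq \<alpha>)
  then show ?case
    using assms(1) word_op_closed[where X = X and w = w and \<alpha> = \<alpha>] word_op_closed[OF assms(1,3)]
    by (auto simp: m_assoc m_closed)
qed

lemma subspace_of_carrier: "subspace_of A (carrier A)"
  by (simp add: subspace_of_def)

lemma subspace_span: "S \<subseteq> carrier A \<Longrightarrow> subspace_of A (subspace_of A hull S)"
proof -
  assume S: "S \<subseteq> carrier A"
  have "subspace_of A (\<Inter>{V. subspace_of A V \<and> S \<subseteq> V})"
    using subspace_of_carrier S unfolding subspace_of_def by blast
  then show ?thesis
    by (simp add: hull_def)
qed

lemma span_subset_carrier: "S \<subseteq> carrier A \<Longrightarrow> subspace_of A hull S \<subseteq> carrier A"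
  by (rule hull_minimal) (simp_all add: subspace_of_carrier)

text \<open>Bilinearity, used one factor at a time: with a generator on the left the right factor
  runs through the span, and afterwards the left factor does.\<close>

lemma span_mult_closed:
  assumes S: "S \<subseteq> carrier A" and mult: "\<And>x y. \<lbrakk>x \<in> S; y \<in> S\<rbrakk> \<Longrightarrow> x \<otimes> y \<in> S"
    and x: "x \<in> subspace_of A hull S" and y: "y \<in> subspace_of A hull S"
  shows "x \<otimes> y \<in> subspace_of A hull S"
proof -
  let ?V = "subspace_of A hull S"
  have V: "subspace_of A ?V"
    using S by (rule subspace_span)
  have *: "s \<in> carrier A \<and> s \<otimes> y \<in> ?V" if s: "s \<in> S" for s
    using y
  proof (rule hull_induct[where P = "\<lambda>y. y \<in> carrier A \<and> s \<otimes> y \<in> ?V", THEN conjunct2, THEN conjI[rotated]])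
    show "s \<in> carrier A"
      using s S by auto
    then show "subspace_of A {y. y \<in> carrier A \<and> s \<otimes> y \<in> ?V}"
      using V by (auto simp: subspace_of_def r_distr r_null smult_mult_right)
  qed (use s S mult hull_subset[of S "subspace_of A"] in blast)
  have yc: "y \<in> carrier A"
    using y span_subset_carrier[OF S] by auto
  show ?thesis
    using x
  proof (rule hull_induct[where P = "\<lambda>x. x \<in> carrier A \<and> x \<otimes> y \<in> ?V", THEN conjunct2])
    show "subspace_of A {x. x \<in> carrier A \<and> x \<otimes> y \<in> ?V}"
      using V yc by (auto simp: subspace_of_def l_distr l_null smult_mult_left)
  qed (use * in blast)
qed

lemma span_star_closed:
  assumes S: "S \<subseteq> carrier A" and star: "\<And>x. x \<in> S \<Longrightarrow> star A x \<in> S"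
    and x: "x \<in> subspace_of A hull S"
  shows "star A x \<in> subspace_of A hull S"
proof -
  let ?V = "subspace_of A hull S"
  have V: "subspace_of A ?V"
    using S by (rule subspace_span)
  show ?thesis
    using x
  proof (rule hull_induct[where P = "\<lambda>x. x \<in> carrier A \<and> star A x \<in> ?V", THEN conjunct2])
    show "subspace_of A {x. x \<in> carrier A \<and> star A x \<in> ?V}"
      using V by (auto simp: subspace_of_def star_add star_smult)
  qed (use S star hull_subset[of S "subspace_of A"] in blast)
qed

end

text \<open>Coefficients and indices are kept in a list, in which an index may recur. Sums of
  combinations are concatenations, and norm estimates can go by induction on the list.\<close>

definition lincomb :: "('a, 'm) star_alg_scheme \<Rightarrow> ('i \<Rightarrow> 'a) \<Rightarrow> (complex \<times> 'i) list \<Rightarrow> 'a" where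
  "lincomb A e cs = foldr (\<lambda>(c, i) y. (c \<odot>\<^bsub>A\<^esub> e i) \<oplus>\<^bsub>A\<^esub> y) cs \<zero>\<^bsub>A\<^esub>"

lemma lincomb_simps [simp]:
  "lincomb A e [] = \<zero>\<^bsub>A\<^esub>"
  "lincomb A e ((c, i) # cs) = (c \<odot>\<^bsub>A\<^esub> e i) \<oplus>\<^bsub>A\<^esub> lincomb A e cs"
  by (simp_all add: lincomb_def)

lemma lincomb_cong:
  "(\<And>i. i \<in> snd ` set cs \<Longrightarrow> e i = e' i) \<Longrightarrow> lincomb A e cs = lincomb A e' cs"
  by (induction cs) auto

context star_algebra
begin

lemma lincomb_closed:
  "\<lbrakk>\<And>i. i \<in> I \<Longrightarrow> e i \<in> carrier A; snd ` set cs \<subseteq> I\<rbrakk> \<Longrightarrow> lincomb A e cs \<in> carrier A"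
  by (induction cs) auto

lemma lincomb_append:
  assumes "\<And>i. i \<in> I \<Longrightarrow> e i \<in> carrier A" "snd ` set cs \<subseteq> I" "snd ` set ds \<subseteq> I"
  shows "lincomb A e (cs @ ds) = lincomb A e cs \<oplus> lincomb A e ds"
  using assms(2)
proof (induction cs)
  case Nil
  then show ?case
    using lincomb_closed[OF assms(1,3)] by (simp add: l_zero)
next
  case (Cons ci cs)
  then show ?case
    using assms(1) lincomb_closed[where I = I and e = e and cs = cs] lincomb_closed[OF assms(1,3)]
    by (cases ci) (auto simp: a_assoc)
qed

lemma lincomb_smult:
  assumes "\<And>i. i \<in> I \<Longrightarrow> e i \<in> carrier A" "snd ` set cs \<subseteq> I"
  shows "c \<odot> lincomb A e cs = lincomb A e (map (map_prod ((*) c) id) cs)"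
  using assms(2)
proof (induction cs)
  case (Cons ci cs)
  then show ?case
    using assms(1) lincomb_closed[where I = I and e = e and cs = cs]
    by (cases ci) (auto simp: csmult_r_distr csmult_assoc)
qed simp

lemma span_lincomb:
  assumes e: "\<And>i. i \<in> I \<Longrightarrow> e i \<in> carrier A" and x: "x \<in> subspace_of A hull (e ` I)"
  shows "\<exists>cs. snd ` set cs \<subseteq> I \<and> x = lincomb A e cs"
  using x
proof (rule hull_induct)
  show "\<exists>cs. snd ` set cs \<subseteq> I \<and> x = lincomb A e cs" if x: "x \<in> e ` I" for x
  proof -
    obtain i where i: "i \<in> I" "x = e i"
      using x by auto
    then show ?thesis
      using e by (intro exI[of _ "[(1, i)]"]) (simp add: r_zero)
  qed
  show "subspace_of A {x. \<exists>cs. snd ` set cs \<subseteq> I \<and> x = lincomb A e cs}"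
    unfolding subspace_of_def
  proof (intro conjI ballI allI subsetI)
    fix x y c
    assume "x \<in> {x. \<exists>cs. snd ` set cs \<subseteq> I \<and> x = lincomb A e cs}"
    then obtain cs where cs: "snd ` set cs \<subseteq> I" "x = lincomb A e cs"
      by auto
    then show "x \<in> carrier A"
      using e lincomb_closed by blast
    show "c \<odot> x \<in> {x. \<exists>cs. snd ` set cs \<subseteq> I \<and> x = lincomb A e cs}"
      using cs lincomb_smult[where I = I and e = e and cs = cs and c = c] e
      by (intro CollectI exI[of _ "map (map_prod ((*) c) id) cs"]) (force simp: image_subset_iff)
    assume "y \<in> {x. \<exists>cs. snd ` set cs \<subseteq> I \<and> x = lincomb A e cs}"
    then obtain ds where ds: "snd ` set ds \<subseteq> I" "y = lincomb A e ds"
      by auto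
    show "x \<oplus> y \<in> {x. \<exists>cs. snd ` set cs \<subseteq> I \<and> x = lincomb A e cs}"
      using cs ds lincomb_append[where I = I and e = e and cs = cs and ds = ds] e
      by (intro CollectI exI[of _ "cs @ ds"]) (simp add: image_Un)
  qed (auto intro: exI[of _ "[]"])
qed

lemma star_algebra_subset:
  assumes V: "subspace_of A V" and mult: "\<And>x y. \<lbrakk>x \<in> V; y \<in> V\<rbrakk> \<Longrightarrow> x \<otimes> y \<in> V"
    and star: "\<And>x. x \<in> V \<Longrightarrow> star A x \<in> V" and one: "\<one> \<in> V"
  shows "star_algebra (A\<lparr>carrier := V\<rparr>)"
proof -
  have c: "x \<in> carrier A" if "x \<in> V" for x
    using V that by (auto simp: subspace_of_def)
  show ?thesis
    by (rule star_algebraI)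
      (use V mult star one c in \<open>auto simp: subspace_of_def a_ac m_assoc l_zero l_one r_one l_distr r_distr
        csmult_l_distr csmult_r_distr csmult_assoc smult_mult_left smult_mult_right
        star_add star_smult star_mult\<close>)
qed

text \<open>The additive inverse of a ring record is defined relative to its carrier, so the two
  differences are not the same term. Both equal x plus (-1) times y, which mentions no
  inverse.\<close>

lemma minus_subset:
  assumes "star_algebra (A\<lparr>carrier := V\<rparr>)" "V \<subseteq> carrier A" "x \<in> V" "y \<in> V"
  shows "x \<ominus>\<^bsub>A\<lparr>carrier := V\<rparr>\<^esub> y = x \<ominus> y"
proof -
  interpret V: star_algebra "A\<lparr>carrier := V\<rparr>"
    by fact
  show ?thesis
    using V.minus_eq_csmult[of x y] minus_eq_csmult[of x y] assms by (simp add: subset_iff)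
qed

end

section \<open>Norm closures and generated C*-subalgebras\<close>

context cstar_algebra
begin

lemma norm_closure_subset_carrier: "norm_closure A S \<subseteq> carrier A"
  by (auto simp: norm_closure_def)

lemma norm_closure_mono: "S \<subseteq> T \<Longrightarrow> norm_closure A S \<subseteq> norm_closure A T"
  unfolding norm_closure_def by blast

lemma subset_norm_closure: "S \<subseteq> carrier A \<Longrightarrow> S \<subseteq> norm_closure A S"
proof
  fix x assume "S \<subseteq> carrier A" "x \<in> S"
  then show "x \<in> norm_closure A S"
    by (auto simp: norm_closure_def intro!: exI[of _ "\<lambda>_. x"])
qed

lemma norm_closure_iff:
  assumes S: "S \<subseteq> carrier A"
  shows "l \<in> norm_closure A S \<longleftrightarrow> l \<in> carrier A \<and> (\<forall>e>0. \<exists>x\<in>S. nrm A (x \<ominus> l) < e)"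
proof (safe)
  fix e :: real assume l: "l \<in> norm_closure A S" and e: "e > 0"
  then obtain x where "\<And>n. x n \<in> S" "(\<lambda>n. nrm A (x n \<ominus> l)) \<longlonglongrightarrow> 0"
    by (auto simp: norm_closure_def)
  with e have "eventually (\<lambda>n. nrm A (x n \<ominus> l) < e) sequentially"
    by (auto dest: order_tendstoD(2))
  then show "\<exists>x\<in>S. nrm A (x \<ominus> l) < e"
    using \<open>\<And>n. x n \<in> S\<close> by (auto simp: eventually_sequentially)
next
  assume l: "l \<in> carrier A" and *: "\<forall>e>0. \<exists>x\<in>S. nrm A (x \<ominus> l) < e"
  have "\<exists>x. \<forall>n. x n \<in> S \<and> nrm A (x n \<ominus> l) < inverse (Suc n)"
    using * by (intro choice allI) (simp add: Bex_def)
  then obtain x where x: "\<And>n. x n \<in> S" "\<And>n. nrm A (x n \<ominus> l) < inverse (Suc n)"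
    by blast
  have "(\<lambda>n. nrm A (x n \<ominus> l)) \<longlonglongrightarrow> 0"
  proof (rule Lim_null_comparison[OF _ LIMSEQ_inverse_real_of_nat])
    have "norm (nrm A (x n \<ominus> l)) \<le> inverse (Suc n)" for n
      using x(2)[of n] x(1)[of n] S l by (auto simp: subset_iff)
    then show "\<forall>\<^sub>F n in sequentially. norm (nrm A (x n \<ominus> l)) \<le> inverse (real (Suc n))"
      by simp
  qed
  then show "l \<in> norm_closure A S"
    using l x(1) by (auto simp: norm_closure_def)
qed (simp add: norm_closure_def)

lemma norm_closure_idem: 
  assumes S: "S \<subseteq> carrier A"
  shows "norm_closure A (norm_closure A S) \<subseteq> norm_closure A S"
proof
  fix l assume l: "l \<in> norm_closure A (norm_closure A S)"
  then have lc: "l \<in> carrier A"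
    by (simp add: norm_closure_def)
  show "l \<in> norm_closure A S"
    unfolding norm_closure_iff[OF S]
  proof (intro conjI lc allI impI)
    fix e :: real assume "e > 0"
    then have e: "e / 2 > 0"
      by simp
    obtain y where y: "y \<in> norm_closure A S" "nrm A (y \<ominus> l) < e / 2"
      using l norm_closure_iff[OF norm_closure_subset_carrier] e by blast
    obtain x where x: "x \<in> S" "nrm A (x \<ominus> y) < e / 2"
      using y(1) norm_closure_iff[OF S] e by blast
    have "nrm A (x \<ominus> l) \<le> nrm A (x \<ominus> y) + nrm A (y \<ominus> l)"
      using x(1) y(1) S lc norm_closure_subset_carrier by (intro p_triangle_minus) auto
    also have "\<dots> < e"
      using x y by simp
    finally show "\<exists>x\<in>S. nrm A (x \<ominus> l) < e"
      using x(1) by blast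
  qed
qed

lemma cstar_subset_norm_closure:
  assumes V: "subspace_of A V" and mult: "\<And>x y. \<lbrakk>x \<in> V; y \<in> V\<rbrakk> \<Longrightarrow> x \<otimes> y \<in> V"
    and star: "\<And>x. x \<in> V \<Longrightarrow> star A x \<in> V"
  shows "cstar_subset A (norm_closure A V)"
proof -
  have Vc: "V \<subseteq> carrier A"
    using V by (simp add: subspace_of_def)
  have in_closureI: "l \<in> norm_closure A V"
    if "\<And>n. f n \<in> V" "(\<lambda>n. nrm A (f n \<ominus> l)) \<longlonglongrightarrow> 0" "l \<in> carrier A" for f l
    using that by (auto simp: norm_closure_def)
  have ops: "x \<oplus> y \<in> norm_closure A V \<and> x \<otimes> y \<in> norm_closure A V \<and> c \<odot> x \<in> norm_closure A V
      \<and> star A x \<in> norm_closure A V"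
    if x: "x \<in> norm_closure A V" and y: "y \<in> norm_closure A V" for x y c
  proof -
    obtain f where f: "\<And>n. f n \<in> V" "(\<lambda>n. nrm A (f n \<ominus> x)) \<longlonglongrightarrow> 0"
      using x by (auto simp: norm_closure_def)
    obtain g where g: "\<And>n. g n \<in> V" "(\<lambda>n. nrm A (g n \<ominus> y)) \<longlonglongrightarrow> 0"
      using y by (auto simp: norm_closure_def)
    have c: "x \<in> carrier A" "y \<in> carrier A" "\<And>n. f n \<in> carrier A" "\<And>n. g n \<in> carrier A"
      using x y f(1) g(1) Vc by (auto simp: norm_closure_def)
    \<comment> \<open>The limit of the products needs a bound on the first factors that is uniform
      in n; it exists because a convergent sequence is Cauchy. The second bound is the norm of the
      limit y.\<close>
    have "f \<in> cauchy_seqs A (nrm A)"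
      using f c by (intro convergent_imp_cauchy_seqs)
    then obtain B where B: "\<And>n. nrm A (f n) \<le> B"
      using cauchy_seqs_bounded by blast
    have V': "f n \<oplus> g n \<in> V" "f n \<otimes> g n \<in> V" "c \<odot> f n \<in> V" "star A (f n) \<in> V" for n
      using V mult star f(1) g(1) by (auto simp: subspace_of_def)
    have "x \<oplus> y \<in> norm_closure A V"
      by (rule in_closureI[where f = "\<lambda>n. f n \<oplus> g n"]) (use V' f g c in \<open>auto intro!: null_add\<close>)
    moreover have "x \<otimes> y \<in> norm_closure A V"
      by (rule in_closureI[where f = "\<lambda>n. f n \<otimes> g n"])
        (use V' f g c B in \<open>auto intro!: null_mult[where B = B and B' = "nrm A y"] m_closed\<close>)
    moreover have "c \<odot> x \<in> norm_closure A V"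
      by (rule in_closureI[where f = "\<lambda>n. c \<odot> f n"]) (use V' f c in \<open>auto intro!: null_smult\<close>)
    moreover have "star A x \<in> norm_closure A V"
      by (rule in_closureI[where f = "\<lambda>n. star A (f n)"]) (use V' f c in \<open>auto intro!: null_star\<close>)
    ultimately show ?thesis
      by blast
  qed
  have "\<zero> \<in> norm_closure A V"
    using subset_norm_closure[OF Vc] V by (auto simp: subspace_of_def)
  then show ?thesis
    using ops norm_closure_idem[OF Vc] norm_closure_subset_carrier
    by (auto simp: cstar_subset_def subspace_of_def)
qed

lemma cstar_subset_closed_span:
  assumes S: "S \<subseteq> carrier A" and mult: "\<And>x y. \<lbrakk>x \<in> S; y \<in> S\<rbrakk> \<Longrightarrow> x \<otimes> y \<in> S"
    and star: "\<And>x. x \<in> S \<Longrightarrow> star A x \<in> S"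
  shows "cstar_subset A (closed_span A S)"
  unfolding closed_span_def
  by (intro cstar_subset_norm_closure subspace_span S span_mult_closed span_star_closed mult star)

lemma subset_closed_span: "S \<subseteq> carrier A \<Longrightarrow> S \<subseteq> closed_span A S"
  unfolding closed_span_def
  using subset_norm_closure[OF span_subset_carrier] hull_subset[of S "subspace_of A"] by blast

lemma cstar_algebra_subset:
  assumes V: "cstar_subset A V" and one: "\<one> \<in> V"
  shows "cstar_algebra (A\<lparr>carrier := V\<rparr>)"
proof -
  have Vc: "V \<subseteq> carrier A"
    using V by (simp add: cstar_subset_def subspace_of_def)
  have sa: "star_algebra (A\<lparr>carrier := V\<rparr>)"
    using V one by (intro star_algebra_subset) (auto simp: cstar_subset_def)
  note minus = minus_subset[OF sa Vc]
  show ?thesis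
  proof (intro cstar_algebra.intro cstar_algebra_axioms.intro sa)
    show "cstar_seminorm (A\<lparr>carrier := V\<rparr>) (nrm (A\<lparr>carrier := V\<rparr>))"
      using cstar_seminorm_nrm Vc by (auto simp: cstar_seminorm_def subset_iff)
    show "x = \<zero>\<^bsub>A\<lparr>carrier := V\<rparr>\<^esub>" if "x \<in> carrier (A\<lparr>carrier := V\<rparr>)" "nrm (A\<lparr>carrier := V\<rparr>) x = 0" for x
      using that nrm_eq_zero Vc by auto
    fix X assume X: "X \<in> cauchy_seqs (A\<lparr>carrier := V\<rparr>) (nrm (A\<lparr>carrier := V\<rparr>))"
    then have XV: "X n \<in> V" for n
      by (simp add: cauchy_seqs_def)
    then have "X \<in> cauchy_seqs A (nrm A)"
      using X Vc by (auto simp: cauchy_seqs_def minus)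
    then obtain l where l: "l \<in> carrier A" "(\<lambda>n. nrm A (X n \<ominus> l)) \<longlonglongrightarrow> 0"
      using complete by blast
    then have "l \<in> V"
      using V XV unfolding cstar_subset_def norm_closure_def by blast
    with l XV show "\<exists>l\<in>carrier (A\<lparr>carrier := V\<rparr>).
        (\<lambda>n. nrm (A\<lparr>carrier := V\<rparr>) (X n \<ominus>\<^bsub>A\<lparr>carrier := V\<rparr>\<^esub> l)) \<longlonglongrightarrow> 0"
      by (auto simp: minus)
  qed
qed

lemma cstar_subset_carrier: "cstar_subset A (carrier A)"
  using norm_closure_subset_carrier by (auto simp: cstar_subset_def subspace_of_def m_closed)

text \<open>All conditions of \<open>cstar_subset\<close>, norm closedness included, pass to
  intersections. The carrier belongs to the family, which keeps the intersection inside it.\<close>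

lemma cstar_subset_generated:
  assumes S: "S \<subseteq> carrier A"
  shows "cstar_subset A (cstar_subset A hull S)"
proof -
  let ?C = "{V. cstar_subset A V \<and> S \<subseteq> V}"
  have "carrier A \<in> ?C"
    using cstar_subset_carrier S by blast
  then have "\<Inter>?C \<subseteq> carrier A"
    by (rule Inter_lower)
  moreover have "\<zero> \<in> \<Inter>?C"
    by (auto simp: cstar_subset_def subspace_of_def)
  moreover have "x \<oplus> y \<in> \<Inter>?C" "x \<otimes> y \<in> \<Inter>?C" "c \<odot> x \<in> \<Inter>?C" "star A x \<in> \<Inter>?C"
    if "x \<in> \<Inter>?C" "y \<in> \<Inter>?C" for x y c
    using that by (auto simp: cstar_subset_def subspace_of_def)
  moreover have "norm_closure A (\<Inter>?C) \<subseteq> \<Inter>?C"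
  proof
    fix l assume "l \<in> norm_closure A (\<Inter>?C)"
    then have "l \<in> norm_closure A V" if "V \<in> ?C" for V
      using norm_closure_mono[of "\<Inter>?C" V] that by blast
    then have "l \<in> V" if "V \<in> ?C" for V
      using that unfolding cstar_subset_def by blast
    then show "l \<in> \<Inter>?C"
      by blast
  qed
  ultimately have "cstar_subset A (\<Inter>?C)"
    unfolding cstar_subset_def subspace_of_def by (intro conjI ballI allI) assumption+
  then show ?thesis
    by (simp add: hull_def)
qed

lemma cstar_algebra_generated:
  assumes "S \<subseteq> carrier A" "\<one> \<in> S"
  shows "cstar_algebra (cstar_generated A S)"
  unfolding cstar_generated_def
  using cstar_subset_generated[OF assms(1)] assms(2) hull_subset[of S "cstar_subset A"]
  by (intro cstar_algebra_subset) auto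

end

text \<open>Linearity handles the span; \<open>contr\<close> is the continuity that carries its
  limits along.\<close>

lemma closed_span_hom:
  assumes A: "cstar_algebra A" and B: "cstar_algebra B" and f: "unital_star_hom A B f"
    and contr: "\<And>x. x \<in> carrier A \<Longrightarrow> nrm B (f x) \<le> nrm A x"
    and S: "S \<subseteq> carrier A" and x: "x \<in> closed_span A S"
  shows "f x \<in> closed_span B (f ` S)"
proof -
  interpret A: cstar_algebra A by fact
  interpret B: cstar_algebra B by fact
  interpret star_hom A B f
    using f by (intro star_homI A.star_algebra_axioms B.star_algebra_axioms)
  have fS: "f ` S \<subseteq> carrier B"
    using S by auto
  have span: "f y \<in> subspace_of B hull (f ` S)" if y: "y \<in> subspace_of A hull S" for y
    using y
  proof (rule hull_induct[where P = "\<lambda>y. y \<in> carrier A \<and> f y \<in> subspace_of B hull (f ` S)", THEN conjunct2])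
    show "subspace_of A {y. y \<in> carrier A \<and> f y \<in> subspace_of B hull (f ` S)}"
      using B.subspace_span[OF fS] by (auto simp: subspace_of_def hom_zero hom_add hom_smult)
  qed (use S hull_subset[of "f ` S" "subspace_of B"] in blast)
  obtain y where y: "\<And>n. y n \<in> subspace_of A hull S" "(\<lambda>n. nrm A (y n \<ominus>\<^bsub>A\<^esub> x)) \<longlonglongrightarrow> 0"
    and xc: "x \<in> carrier A"
    using x by (auto simp: closed_span_def norm_closure_def)
  have yc: "y n \<in> carrier A" for n
    using y(1) A.span_subset_carrier[OF S] by blast
  have "(\<lambda>n. nrm B (f (y n) \<ominus>\<^bsub>B\<^esub> f x)) \<longlonglongrightarrow> 0"
  proof (rule Lim_null_comparison[OF _ y(2)], intro eventuallyI)
    show "norm (nrm B (f (y n) \<ominus>\<^bsub>B\<^esub> f x)) \<le> nrm A (y n \<ominus>\<^bsub>A\<^esub> x)" for n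
      using contr[of "y n \<ominus>\<^bsub>A\<^esub> x"] xc yc[of n] by (simp add: hom_minus)
  qed
  then show ?thesis
    unfolding closed_span_def norm_closure_def using span y(1) xc
    by (auto intro!: exI[of _ "\<lambda>n. f (y n)"])
qed

section \<open>The Hausdorff completion\<close>

definition cauchy_class :: "('a, 'm) star_alg_scheme \<Rightarrow> ('a \<Rightarrow> real) \<Rightarrow> (nat \<Rightarrow> 'a) \<Rightarrow> (nat \<Rightarrow> 'a) set" where
  "cauchy_class A p x = null_difference A p `` {x}"

context seminormed_star_algebra
begin

abbreviation "\<C> \<equiv> cstar_completion A p"
abbreviation "cls \<equiv> cauchy_class A p"

lemma null_difference_iff:
  "(x, y) \<in> null_difference A p \<longleftrightarrow>
     x \<in> cauchy_seqs A p \<and> y \<in> cauchy_seqs A p \<and> (\<lambda>n. p (x n \<ominus> y n)) \<longlonglongrightarrow> 0"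
  by (simp add: null_difference_def)

lemma equiv_null_difference: "equiv (cauchy_seqs A p) (null_difference A p)"
proof (rule equivI)
  show "null_difference A p \<subseteq> cauchy_seqs A p \<times> cauchy_seqs A p"
    by (auto simp: null_difference_def)
  show "refl_on (cauchy_seqs A p) (null_difference A p)"
    by (auto simp: refl_on_def null_difference_def cauchy_seqs_closed)
  show "sym (null_difference A p)"
    by (auto simp: sym_def null_difference_def cauchy_seqs_closed p_minus_commute)
  show "trans (null_difference A p)"
    by (auto simp: trans_def null_difference_def cauchy_seqs_closed intro: null_trans)
qed

lemma cls_eq_iff:
  "\<lbrakk>x \<in> cauchy_seqs A p; y \<in> cauchy_seqs A p\<rbrakk> \<Longrightarrow> cls x = cls y \<longleftrightarrow> (\<lambda>n. p (x n \<ominus> y n)) \<longlonglongrightarrow> 0"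
  unfolding cauchy_class_def
  using eq_equiv_class_iff[OF equiv_null_difference] by (simp add: null_difference_iff)

lemma carrier_completion: "carrier \<C> = cls ` cauchy_seqs A p"
  by (auto simp: cstar_completion_def Let_def cauchy_class_def quotient_def)

lemma cls_closed [simp, intro]: "x \<in> cauchy_seqs A p \<Longrightarrow> cls x \<in> carrier \<C>"
  by (simp add: carrier_completion)

lemma congruent2_null_difference:
  assumes "\<And>x y. \<lbrakk>x \<in> cauchy_seqs A p; y \<in> cauchy_seqs A p\<rbrakk> \<Longrightarrow> (\<lambda>n. f (x n) (y n)) \<in> cauchy_seqs A p"
    and "\<And>x y x' y'. \<lbrakk>(x, x') \<in> null_difference A p; (y, y') \<in> null_difference A p\<rbrakk>
      \<Longrightarrow> (\<lambda>n. p (f (x n) (y n) \<ominus> f (x' n) (y' n))) \<longlonglongrightarrow> 0"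
  shows "congruent2 (null_difference A p) (null_difference A p) (\<lambda>x y. cls (\<lambda>n. f (x n) (y n)))"
proof (rule congruent2I')
  fix x x' y y' assume *: "(x, x') \<in> null_difference A p" "(y, y') \<in> null_difference A p"
  then have "x \<in> cauchy_seqs A p" "x' \<in> cauchy_seqs A p" "y \<in> cauchy_seqs A p" "y' \<in> cauchy_seqs A p"
    by (simp_all add: null_difference_iff)
  then show "cls (\<lambda>n. f (x n) (y n)) = cls (\<lambda>n. f (x' n) (y' n))"
    using assms(1) assms(2)[OF *] by (simp add: cls_eq_iff)
qed

lemma cls_UN2:
  assumes "congruent2 (null_difference A p) (null_difference A p) g"
    and "x \<in> cauchy_seqs A p" "y \<in> cauchy_seqs A p"
  shows "(\<Union>x'\<in>cls x. \<Union>y'\<in>cls y. g x' y') = g x y"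
  using UN_equiv_class2[OF equiv_null_difference equiv_null_difference assms]
  by (simp add: cauchy_class_def)

lemma cls_add:
  assumes "x \<in> cauchy_seqs A p" "y \<in> cauchy_seqs A p"
  shows "cls x \<oplus>\<^bsub>\<C>\<^esub> cls y = cls (\<lambda>n. x n \<oplus> y n)"
proof -
  have "congruent2 (null_difference A p) (null_difference A p) (\<lambda>x y. cls (\<lambda>n. x n \<oplus> y n))"
    by (rule congruent2_null_difference)
      (auto simp: null_difference_iff cauchy_seqs_closed intro!: cauchy_seqs_add null_add)
  from cls_UN2[OF this assms] show ?thesis
    by (simp add: cstar_completion_def Let_def cauchy_class_def)
qed

lemma cls_mult:
  assumes "x \<in> cauchy_seqs A p" "y \<in> cauchy_seqs A p"
  shows "cls x \<otimes>\<^bsub>\<C>\<^esub> cls y = cls (\<lambda>n. x n \<otimes> y n)"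
proof -
  have "(\<lambda>n. p (x n \<otimes> y n \<ominus> x' n \<otimes> y' n)) \<longlonglongrightarrow> 0"
    if "(x, x') \<in> null_difference A p" "(y, y') \<in> null_difference A p" for x y x' y'
  proof -
    have c: "x \<in> cauchy_seqs A p" "x' \<in> cauchy_seqs A p" "y \<in> cauchy_seqs A p" "y' \<in> cauchy_seqs A p"
      using that by (simp_all add: null_difference_iff)
    obtain B where "\<And>n. p (x n) \<le> B"
      using cauchy_seqs_bounded[OF c(1)] by blast
    moreover obtain B' where "\<And>n. p (y' n) \<le> B'"
      using cauchy_seqs_bounded[OF c(4)] by blast
    ultimately show ?thesis
      using that c by (intro null_mult) (auto simp: null_difference_iff cauchy_seqs_closed)
  qed
  then have "congruent2 (null_difference A p) (null_difference A p) (\<lambda>x y. cls (\<lambda>n. x n \<otimes> y n))"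
    by (intro congruent2_null_difference cauchy_seqs_mult)
  from cls_UN2[OF this assms] show ?thesis
    by (simp add: cstar_completion_def Let_def cauchy_class_def)
qed

lemma cls_UN:
  assumes "\<And>x. x \<in> cauchy_seqs A p \<Longrightarrow> (\<lambda>n. f (x n)) \<in> cauchy_seqs A p"
    and "\<And>x x'. (x, x') \<in> null_difference A p \<Longrightarrow> (\<lambda>n. p (f (x n) \<ominus> f (x' n))) \<longlonglongrightarrow> 0"
    and x: "x \<in> cauchy_seqs A p"
  shows "(\<Union>x'\<in>cls x. cls (\<lambda>n. f (x' n))) = cls (\<lambda>n. f (x n))"
proof -
  have "(\<lambda>x. cls (\<lambda>n. f (x n))) respects null_difference A p"
    using assms(1,2) by (intro congruentI) (simp add: cls_eq_iff null_difference_iff)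
  from UN_equiv_class[OF equiv_null_difference this x] show ?thesis
    by (simp add: cauchy_class_def)
qed

lemma cls_smult:
  assumes "x \<in> cauchy_seqs A p"
  shows "c \<odot>\<^bsub>\<C>\<^esub> cls x = cls (\<lambda>n. c \<odot> x n)"
proof -
  have "(\<Union>x'\<in>cls x. cls (\<lambda>n. c \<odot> x' n)) = cls (\<lambda>n. c \<odot> x n)"
    by (rule cls_UN)
      (use assms in \<open>auto simp: null_difference_iff cauchy_seqs_closed intro!: cauchy_seqs_smult null_smult\<close>)
  then show ?thesis
    by (simp add: cstar_completion_def Let_def cauchy_class_def)
qed

lemma cls_star:
  assumes "x \<in> cauchy_seqs A p"
  shows "star \<C> (cls x) = cls (\<lambda>n. star A (x n))"
proof -
  have "(\<Union>x'\<in>cls x. cls (\<lambda>n. star A (x' n))) = cls (\<lambda>n. star A (x n))"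
    by (rule cls_UN)
      (use assms in \<open>auto simp: null_difference_iff cauchy_seqs_closed intro!: cauchy_seqs_star null_star\<close>)
  then show ?thesis
    by (simp add: cstar_completion_def Let_def cauchy_class_def)
qed

lemma cls_one: "\<one>\<^bsub>\<C>\<^esub> = cls (\<lambda>n. \<one>)" and cls_zero: "\<zero>\<^bsub>\<C>\<^esub> = cls (\<lambda>n. \<zero>)"
  by (simp_all add: cstar_completion_def Let_def cauchy_class_def)

text \<open>The norm of a class is a definite description. The reverse triangle inequality makes the
  seminorms of a representative a Cauchy sequence of reals and shows that equivalent representatives
  share the limit, so the description denotes it.\<close>

lemma nrm_cls: "x \<in> cauchy_seqs A p \<Longrightarrow> (\<lambda>n. p (x n)) \<longlonglongrightarrow> nrm \<C> (cls x)"
proof -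
  assume x: "x \<in> cauchy_seqs A p"
  have "Cauchy (\<lambda>n. p (x n))"
    unfolding Cauchy_def
  proof (intro allI impI)
    fix e :: real assume "e > 0"
    then obtain N where N: "\<And>m n. \<lbrakk>m \<ge> N; n \<ge> N\<rbrakk> \<Longrightarrow> p (x m \<ominus> x n) < e"
      using cauchy_seqsE[OF x] by blast
    have "dist (p (x m)) (p (x n)) \<le> p (x m \<ominus> x n)" for m n
      using p_diff_le x by (simp add: dist_real_def cauchy_seqs_closed)
    then show "\<exists>M. \<forall>m\<ge>M. \<forall>n\<ge>M. dist (p (x m)) (p (x n)) < e"
      using N by (meson order_le_less_trans)
  qed
  then obtain l where l: "(\<lambda>n. p (x n)) \<longlonglongrightarrow> l"
    using Cauchy_convergent_iff convergent_def by metis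
  have "(\<lambda>n. p (y n)) \<longlonglongrightarrow> l" if y: "y \<in> cls x" for y
  proof -
    have *: "(x, y) \<in> null_difference A p"
      using y by (simp add: cauchy_class_def)
    then have c: "y n \<in> carrier A" "x n \<in> carrier A" for n
      by (simp_all add: null_difference_iff cauchy_seqs_closed)
    have "(\<lambda>n. p (x n) - p (y n)) \<longlonglongrightarrow> 0"
      by (rule Lim_null_comparison[where g = "\<lambda>n. p (x n \<ominus> y n)"])
        (use * c p_diff_le in \<open>auto simp: null_difference_iff intro!: eventuallyI\<close>)
    from tendsto_diff[OF l this] show ?thesis
      by simp
  qed
  moreover have xx: "x \<in> cls x"
    using x equiv_class_self[OF equiv_null_difference] by (simp add: cauchy_class_def)
  ultimately have "(THE l. \<forall>y\<in>cls x. (\<lambda>n. p (y n)) \<longlonglongrightarrow> l) = l"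
    using l LIMSEQ_unique by (intro the_equality) blast+
  then show ?thesis
    using l by (simp add: cstar_completion_def Let_def)
qed

lemma nrm_cls_const: "a \<in> carrier A \<Longrightarrow> nrm \<C> (cls (\<lambda>n. a)) = p a"
  using nrm_cls[OF cauchy_seqs_const] LIMSEQ_unique tendsto_const by blast

lemma star_algebra_completion: "star_algebra \<C>"
  by (rule star_algebraI)
    (auto simp: carrier_completion cls_add cls_mult cls_smult cls_star cls_one cls_zero
      cauchy_seqs_add cauchy_seqs_mult cauchy_seqs_smult cauchy_seqs_star cauchy_seqs_const
      cauchy_seqs_closed a_assoc m_assoc l_zero l_one r_one l_distr r_distr
      csmult_l_distr csmult_r_distr csmult_assoc smult_mult_left smult_mult_right
      star_add star_smult star_mult a_comm a_lcomm)

lemma cls_minus: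
  assumes x: "x \<in> cauchy_seqs A p" and y: "y \<in> cauchy_seqs A p"
  shows "cls x \<ominus>\<^bsub>\<C>\<^esub> cls y = cls (\<lambda>n. x n \<ominus> y n)"
proof -
  interpret C: star_algebra \<C>
    by (rule star_algebra_completion)
  show ?thesis
    using assms by (simp add: C.minus_eq_csmult cls_smult cls_add cauchy_seqs_smult
      minus_eq_csmult cauchy_seqs_closed)
qed

lemma cauchy_seqs_minus:
  "\<lbrakk>x \<in> cauchy_seqs A p; y \<in> cauchy_seqs A p\<rbrakk> \<Longrightarrow> (\<lambda>n. x n \<ominus> y n) \<in> cauchy_seqs A p"
  using cauchy_seqs_add[OF _ cauchy_seqs_smult[of y "-1"], of x]
  by (simp add: minus_eq_csmult cauchy_seqs_closed)

text \<open>The constant sequence at a late entry of a representative is close to the whole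
  class.\<close>

lemma completion_dense:
  assumes X: "X \<in> carrier \<C>" and e: "e > 0"
  shows "\<exists>a\<in>carrier A. nrm \<C> (X \<ominus>\<^bsub>\<C>\<^esub> cls (\<lambda>n. a)) < e"
proof -
  obtain x where x: "x \<in> cauchy_seqs A p" "X = cls x"
    using X by (auto simp: carrier_completion)
  obtain N where N: "\<And>m n. \<lbrakk>m \<ge> N; n \<ge> N\<rbrakk> \<Longrightarrow> p (x m \<ominus> x n) < e / 2"
    using cauchy_seqsE[OF x(1), of "e / 2"] e by auto
  have xN: "x N \<in> carrier A"
    using x(1) by (rule cauchy_seqs_closed)
  have "(\<lambda>n. p (x n \<ominus> x N)) \<longlonglongrightarrow> nrm \<C> (cls x \<ominus>\<^bsub>\<C>\<^esub> cls (\<lambda>n. x N))"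
    using nrm_cls[OF cauchy_seqs_minus[OF x(1) cauchy_seqs_const[OF xN]]]
    by (simp add: cls_minus x(1) xN cauchy_seqs_const)
  then have "nrm \<C> (cls x \<ominus>\<^bsub>\<C>\<^esub> cls (\<lambda>n. x N)) \<le> e / 2"
    by (rule LIMSEQ_le_const2) (use N in \<open>auto intro!: exI[of _ N] less_imp_le\<close>)
  then show ?thesis
    using x(2) xN e by (intro bexI[of _ "x N"]) auto
qed

lemma cstar_seminorm_completion: "cstar_seminorm \<C> (nrm \<C>)"
proof -
  have nonneg: "0 \<le> nrm \<C> (cls x)" if x: "x \<in> cauchy_seqs A p" for x
    using nrm_cls[OF x] by (rule LIMSEQ_le_const) (use x in \<open>auto simp: cauchy_seqs_closed\<close>)
  have tri: "nrm \<C> (cls (\<lambda>n. x n \<oplus> y n)) \<le> nrm \<C> (cls x) + nrm \<C> (cls y)"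
    if x: "x \<in> cauchy_seqs A p" and y: "y \<in> cauchy_seqs A p" for x y
    using nrm_cls[OF cauchy_seqs_add[OF x y]] tendsto_add[OF nrm_cls[OF x] nrm_cls[OF y]]
    by (rule LIMSEQ_le) (use x y in \<open>auto simp: cauchy_seqs_closed p_triangle\<close>)
  have mult: "nrm \<C> (cls (\<lambda>n. x n \<otimes> y n)) \<le> nrm \<C> (cls x) * nrm \<C> (cls y)"
    if x: "x \<in> cauchy_seqs A p" and y: "y \<in> cauchy_seqs A p" for x y
    using nrm_cls[OF cauchy_seqs_mult[OF x y]] tendsto_mult[OF nrm_cls[OF x] nrm_cls[OF y]]
    by (rule LIMSEQ_le) (use x y in \<open>auto simp: cauchy_seqs_closed p_mult\<close>)
  have smult: "nrm \<C> (cls (\<lambda>n. c \<odot> x n)) = cmod c * nrm \<C> (cls x)" if x: "x \<in> cauchy_seqs A p" for c x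
  proof (rule LIMSEQ_unique[OF nrm_cls[OF cauchy_seqs_smult[OF x]]])
    show "(\<lambda>n. p (c \<odot> x n)) \<longlonglongrightarrow> cmod c * nrm \<C> (cls x)"
      using tendsto_mult_left[OF nrm_cls[OF x]] x by (simp add: p_smult cauchy_seqs_closed)
  qed
  have cst: "nrm \<C> (cls (\<lambda>n. star A (x n) \<otimes> x n)) = (nrm \<C> (cls x))\<^sup>2" if x: "x \<in> cauchy_seqs A p" for x
  proof (rule LIMSEQ_unique[OF nrm_cls[OF cauchy_seqs_mult[OF cauchy_seqs_star[OF x] x]]])
    show "(\<lambda>n. p (star A (x n) \<otimes> x n)) \<longlonglongrightarrow> (nrm \<C> (cls x))\<^sup>2"
      using tendsto_power[OF nrm_cls[OF x]] x by (simp add: p_cstar cauchy_seqs_closed)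
  qed
  show ?thesis
    unfolding cstar_seminorm_def carrier_completion
    by (auto simp: cls_add cls_mult cls_smult cls_star cauchy_seqs_star nonneg tri mult smult cst)
qed

lemma cstar_algebra_completion: "cstar_algebra \<C>"
proof (intro cstar_algebra.intro cstar_algebra_axioms.intro star_algebra_completion cstar_seminorm_completion)
  interpret C: seminormed_star_algebra \<C> "nrm \<C>"
    by (intro seminormed_star_algebra.intro seminormed_star_algebra_axioms.intro
      star_algebra_completion cstar_seminorm_completion)
  show "X = \<zero>\<^bsub>\<C>\<^esub>" if X: "X \<in> carrier \<C>" "nrm \<C> X = 0" for X
  proof -
    obtain x where x: "x \<in> cauchy_seqs A p" "X = cls x"
      using X(1) by (auto simp: carrier_completion)
    then show ?thesis
      using nrm_cls[OF x(1)] X(2) by (simp add: cls_zero cls_eq_iff cauchy_seqs_const cauchy_seqs_closed)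
  qed
  fix X assume X: "X \<in> cauchy_seqs \<C> (nrm \<C>)"
  then have Xc: "X n \<in> carrier \<C>" for n
    by (rule C.cauchy_seqs_closed)
  \<comment> \<open>Diagonal choice: a n is an element of the original algebra within 1/(n+1) of X
    n. The sequence \<open>a\<close> turns out to be Cauchy itself, and its class is the limit of
    X.\<close>
  have "\<exists>a. \<forall>n. a n \<in> carrier A \<and> nrm \<C> (X n \<ominus>\<^bsub>\<C>\<^esub> cls (\<lambda>_. a n)) < inverse (Suc n)"
  proof (intro choice allI)
    fix n
    have "inverse (real (Suc n)) > 0"
      by simp
    from completion_dense[OF Xc this]
    show "\<exists>a. a \<in> carrier A \<and> nrm \<C> (X n \<ominus>\<^bsub>\<C>\<^esub> cls (\<lambda>_. a)) < inverse (Suc n)"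
      by blast
  qed
  then obtain a where a: "\<And>n. a n \<in> carrier A"
    "\<And>n. nrm \<C> (X n \<ominus>\<^bsub>\<C>\<^esub> cls (\<lambda>_. a n)) < inverse (Suc n)"
    by blast
  have ac: "cls (\<lambda>_. a n) \<in> carrier \<C>" for n
    using a(1) cauchy_seqs_const by blast
  have near: "(\<lambda>n. nrm \<C> (X n \<ominus>\<^bsub>\<C>\<^esub> cls (\<lambda>_. a n))) \<longlonglongrightarrow> 0"
  proof (rule Lim_null_comparison[OF _ LIMSEQ_inverse_real_of_nat], intro eventuallyI)
    show "norm (nrm \<C> (X n \<ominus>\<^bsub>\<C>\<^esub> cls (\<lambda>_. a n))) \<le> inverse (real (Suc n))" for n
      using a(2)[of n] C.p_nonneg[of "X n \<ominus>\<^bsub>\<C>\<^esub> cls (\<lambda>_. a n)"] Xc ac by simp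
  qed
  have eq: "nrm \<C> (cls (\<lambda>_. a m) \<ominus>\<^bsub>\<C>\<^esub> cls (\<lambda>_. a n)) = p (a m \<ominus> a n)" for m n
    using a(1) by (simp add: cls_minus cauchy_seqs_const nrm_cls_const)
  \<comment> \<open>The distance of a m and a n is estimated along the chain a m, X m, X n, a
    n.\<close>
  have "((\<lambda>i. nrm \<C> (cls (\<lambda>_. a (fst i)) \<ominus>\<^bsub>\<C>\<^esub> X (fst i))) \<longlongrightarrow> 0) (sequentially \<times>\<^sub>F sequentially)"
    using filterlim_compose[OF near filterlim_fst] Xc ac by (simp add: C.p_minus_commute)
  moreover have "((\<lambda>i. nrm \<C> (X (fst i) \<ominus>\<^bsub>\<C>\<^esub> X (snd i))) \<longlongrightarrow> 0) (sequentially \<times>\<^sub>F sequentially)"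
    using X by (simp add: C.cauchy_seqs_iff)
  ultimately have "((\<lambda>i. nrm \<C> (cls (\<lambda>_. a (fst i)) \<ominus>\<^bsub>\<C>\<^esub> X (snd i))) \<longlongrightarrow> 0) (sequentially \<times>\<^sub>F sequentially)"
    by (rule C.null_trans) (use Xc ac in auto)
  moreover have "((\<lambda>i. nrm \<C> (X (snd i) \<ominus>\<^bsub>\<C>\<^esub> cls (\<lambda>_. a (snd i)))) \<longlongrightarrow> 0) (sequentially \<times>\<^sub>F sequentially)"
    using filterlim_compose[OF near filterlim_snd] .
  ultimately have "((\<lambda>i. nrm \<C> (cls (\<lambda>_. a (fst i)) \<ominus>\<^bsub>\<C>\<^esub> cls (\<lambda>_. a (snd i)))) \<longlongrightarrow> 0)
      (sequentially \<times>\<^sub>F sequentially)"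
    by (rule C.null_trans) (use Xc ac in auto)
  then have aC: "a \<in> cauchy_seqs A p"
    using a(1) by (simp add: cauchy_seqs_iff eq)
  have "(\<lambda>n. nrm \<C> (cls (\<lambda>_. a n) \<ominus>\<^bsub>\<C>\<^esub> cls a)) \<longlonglongrightarrow> 0"
  proof (rule LIMSEQ_I)
    fix e :: real assume "e > 0"
    then obtain N where N: "\<And>m n. \<lbrakk>m \<ge> N; n \<ge> N\<rbrakk> \<Longrightarrow> p (a m \<ominus> a n) < e / 2"
      using cauchy_seqsE[OF aC, of "e / 2"] by auto
    have le: "nrm \<C> (cls (\<lambda>_. a m) \<ominus>\<^bsub>\<C>\<^esub> cls a) \<le> e / 2" if "m \<ge> N" for m
    proof -
      have "(\<lambda>n. p (a m \<ominus> a n)) \<longlonglongrightarrow> nrm \<C> (cls (\<lambda>_. a m) \<ominus>\<^bsub>\<C>\<^esub> cls a)"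
        using nrm_cls[OF cauchy_seqs_minus[OF cauchy_seqs_const[OF a(1)] aC]]
        by (simp add: cls_minus a(1) aC cauchy_seqs_const)
      then show ?thesis
        by (rule LIMSEQ_le_const2) (use N that in \<open>auto intro!: exI[of _ N] less_imp_le\<close>)
    qed
    have ge: "0 \<le> nrm \<C> (cls (\<lambda>_. a m) \<ominus>\<^bsub>\<C>\<^esub> cls a)" for m
      using ac aC by (intro C.p_nonneg C.minus_closed) auto
    have "norm (nrm \<C> (cls (\<lambda>_. a m) \<ominus>\<^bsub>\<C>\<^esub> cls a) - 0) < e" if "m \<ge> N" for m
      using le[OF that] ge[of m] \<open>e > 0\<close> by simp
    then show "\<exists>N. \<forall>n\<ge>N. norm (nrm \<C> (cls (\<lambda>_. a n) \<ominus>\<^bsub>\<C>\<^esub> cls a) - 0) < e"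
      by blast
  qed
  with near have "(\<lambda>n. nrm \<C> (X n \<ominus>\<^bsub>\<C>\<^esub> cls a)) \<longlonglongrightarrow> 0"
    by (rule C.null_trans) (use Xc ac aC in auto)
  then show "\<exists>l\<in>carrier \<C>. (\<lambda>n. nrm \<C> (X n \<ominus>\<^bsub>\<C>\<^esub> l)) \<longlonglongrightarrow> 0"
    using aC by blast
qed

lemma unital_star_hom_cls_const: "unital_star_hom A \<C> (\<lambda>a. cls (\<lambda>n. a))"
  by (auto simp: unital_star_hom_def ring_hom_def cls_add cls_mult cls_smult cls_star cls_one cauchy_seqs_const)

text \<open>A contraction preserves Cauchy sequences and null differences, so the limit of f along a
  representative exists in B and depends only on the class. Every algebraic law for the extension is
  a law for f in the limit.\<close>

lemma completion_hom_extension: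
  assumes B: "cstar_algebra B" and f: "unital_star_hom A B f"
    and contr: "\<And>a. a \<in> carrier A \<Longrightarrow> nrm B (f a) \<le> p a"
  shows "\<exists>F. unital_star_hom \<C> B F \<and> (\<forall>a\<in>carrier A. F (cls (\<lambda>n. a)) = f a) \<and>
    (\<forall>X\<in>carrier \<C>. nrm B (F X) \<le> nrm \<C> X)"
proof -
  interpret B: cstar_algebra B by fact
  interpret star_hom A B f
    using f by (intro star_homI star_algebra_axioms B.star_algebra_axioms)
  note hom_closed [simp]
  have contr2: "nrm B (f a \<ominus>\<^bsub>B\<^esub> f b) \<le> p (a \<ominus> b)" if "a \<in> carrier A" "b \<in> carrier A" for a b
    using contr[of "a \<ominus> b"] that by (simp add: hom_minus)
  \<comment> \<open>A relation rather than a function, because existence and uniqueness of the limit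
    are established separately.\<close>
  define lim where "lim x l \<longleftrightarrow> l \<in> carrier B \<and> (\<lambda>n. nrm B (f (x n) \<ominus>\<^bsub>B\<^esub> l)) \<longlonglongrightarrow> 0" for x l
  have ex: "\<exists>l. lim x l" if x: "x \<in> cauchy_seqs A p" for x
  proof -
    have "(\<lambda>n. f (x n)) \<in> cauchy_seqs B (nrm B)"
      unfolding B.cauchy_seqs_iff
    proof (intro conjI allI)
      show "((\<lambda>i. nrm B (f (x (fst i)) \<ominus>\<^bsub>B\<^esub> f (x (snd i)))) \<longlongrightarrow> 0) (sequentially \<times>\<^sub>F sequentially)"
        by (rule Lim_null_comparison[where g = "\<lambda>i. p (x (fst i) \<ominus> x (snd i))"])
          (use x contr2 in \<open>auto simp: cauchy_seqs_iff intro!: eventuallyI\<close>)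
    qed (use x in \<open>simp add: cauchy_seqs_closed hom_closed\<close>)
    then show ?thesis
      using B.complete unfolding lim_def by blast
  qed
  have uniq: "l = l'" if x: "(x, x') \<in> null_difference A p" and l: "lim x l" and l': "lim x' l'" for x x' l l'
  proof -
    have c: "x n \<in> carrier A" "x' n \<in> carrier A" for n
      using x by (simp_all add: null_difference_iff cauchy_seqs_closed)
    have "(\<lambda>n. nrm B (f (x n) \<ominus>\<^bsub>B\<^esub> f (x' n))) \<longlonglongrightarrow> 0"
      by (rule Lim_null_comparison[where g = "\<lambda>n. p (x n \<ominus> x' n)"])
        (use x c contr2 in \<open>auto simp: null_difference_iff intro!: eventuallyI\<close>)
    then have "(\<lambda>n. nrm B (f (x n) \<ominus>\<^bsub>B\<^esub> l')) \<longlonglongrightarrow> 0"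
      by (rule B.null_trans[where g = "\<lambda>n. f (x' n)"]) (use l' c in \<open>auto simp: lim_def hom_closed\<close>)
    then show ?thesis
      using l l' c unfolding lim_def by (intro B.limit_unique[where x = "\<lambda>n. f (x n)"]) (auto simp: hom_closed)
  qed
  define F where "F X = (THE l. \<exists>x\<in>cauchy_seqs A p. X = cls x \<and> lim x l)" for X
  have F_eq: "F (cls x) = l" if x: "x \<in> cauchy_seqs A p" and l: "lim x l" for x l
    unfolding F_def
  proof (rule the_equality)
    show "\<exists>y\<in>cauchy_seqs A p. cls x = cls y \<and> lim y l"
      using x l by blast
    fix l' assume "\<exists>y\<in>cauchy_seqs A p. cls x = cls y \<and> lim y l'"
    then obtain y where y: "y \<in> cauchy_seqs A p" "cls x = cls y" "lim y l'"
      by blast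
    then have "(x, y) \<in> null_difference A p"
      using x by (simp add: null_difference_iff cls_eq_iff)
    then show "l' = l"
      using uniq l y(3) by blast
  qed
  have limF: "lim x (F (cls x))" if "x \<in> cauchy_seqs A p" for x
    using ex[OF that] F_eq[OF that] by auto
  then have Fc: "F (cls x) \<in> carrier B" and
    Flim: "(\<lambda>n. nrm B (f (x n) \<ominus>\<^bsub>B\<^esub> F (cls x))) \<longlonglongrightarrow> 0" if "x \<in> cauchy_seqs A p" for x
    using that unfolding lim_def by blast+
  have const: "F (cls (\<lambda>n. a)) = f a" if "a \<in> carrier A" for a
    using that by (intro F_eq) (auto simp: lim_def cauchy_seqs_const hom_closed)
  have fc: "f (x n) \<in> carrier B" if "x \<in> cauchy_seqs A p" for x n
    using that by (simp add: cauchy_seqs_closed hom_closed)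
  have add: "F (cls (\<lambda>n. x n \<oplus> y n)) = F (cls x) \<oplus>\<^bsub>B\<^esub> F (cls y)"
    if x: "x \<in> cauchy_seqs A p" and y: "y \<in> cauchy_seqs A p" for x y
  proof (rule F_eq[OF cauchy_seqs_add[OF x y]])
    show "lim (\<lambda>n. x n \<oplus> y n) (F (cls x) \<oplus>\<^bsub>B\<^esub> F (cls y))"
      using B.null_add[OF Flim[OF x] Flim[OF y]] x y Fc fc
      by (auto simp: lim_def hom_add cauchy_seqs_closed)
  qed
  have smult: "F (cls (\<lambda>n. c \<odot> x n)) = c \<odot>\<^bsub>B\<^esub> F (cls x)" if x: "x \<in> cauchy_seqs A p" for c x
  proof (rule F_eq[OF cauchy_seqs_smult[OF x]])
    show "lim (\<lambda>n. c \<odot> x n) (c \<odot>\<^bsub>B\<^esub> F (cls x))"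
      using B.null_smult[OF Flim[OF x]] x Fc fc
      by (auto simp: lim_def hom_smult cauchy_seqs_closed)
  qed
  have star: "F (cls (\<lambda>n. star A (x n))) = star B (F (cls x))" if x: "x \<in> cauchy_seqs A p" for x
  proof (rule F_eq[OF cauchy_seqs_star[OF x]])
    show "lim (\<lambda>n. star A (x n)) (star B (F (cls x)))"
      using B.null_star[OF Flim[OF x]] x Fc fc
      by (auto simp: lim_def hom_star cauchy_seqs_closed)
  qed
  have mult: "F (cls (\<lambda>n. x n \<otimes> y n)) = F (cls x) \<otimes>\<^bsub>B\<^esub> F (cls y)"
    if x: "x \<in> cauchy_seqs A p" and y: "y \<in> cauchy_seqs A p" for x y
  proof (rule F_eq[OF cauchy_seqs_mult[OF x y]])
    obtain C where C: "\<And>n. p (x n) \<le> C"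
      using cauchy_seqs_bounded[OF x] by blast
    have "nrm B (f (x n)) \<le> C" for n
      using C[of n] contr[of "x n"] x by (simp add: cauchy_seqs_closed order_trans)
    then show "lim (\<lambda>n. x n \<otimes> y n) (F (cls x) \<otimes>\<^bsub>B\<^esub> F (cls y))"
      using B.null_mult[OF Flim[OF x] Flim[OF y], where B = C and B' = "nrm B (F (cls y))"] x y Fc fc
      by (auto simp: lim_def hom_mult cauchy_seqs_closed B.m_closed)
  qed
  have "unital_star_hom \<C> B F"
    unfolding unital_star_hom_def ring_hom_def carrier_completion
    by (auto simp: cls_add cls_mult cls_smult cls_star cls_one const hom_one add mult smult star Fc)
  moreover have "nrm B (F (cls x)) \<le> nrm \<C> (cls x)" if x: "x \<in> cauchy_seqs A p" for x
    using B.nrm_tendsto[OF Flim[OF x] fc[OF x] Fc[OF x]] nrm_cls[OF x]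
    by (rule LIMSEQ_le) (use x contr in \<open>auto simp: cauchy_seqs_closed\<close>)
  ultimately show ?thesis
    using const by (intro exI[of _ F]) (auto simp: carrier_completion)
qed

end

section \<open>Bounded operators on \<open>\<ell>\<^sup>2\<close>\<close>

text \<open>Membership and norm bound both follow from the finite partial sums. Estimates in
  \<open>ell2\<close> are thereby reduced to the Minkowski and Cauchy-Schwarz inequalities for
  \<open>L2_set\<close> on finite sets.\<close>

lemma ell2_boundI:
  assumes "\<And>g. g \<notin> S \<Longrightarrow> x g = 0"
    and bound: "\<And>F. \<lbrakk>finite F; F \<subseteq> S\<rbrakk> \<Longrightarrow> L2_set (\<lambda>g. cmod (x g)) F \<le> C"
  shows "x \<in> ell2 S" "ell2_norm S x \<le> C"
proof -
  have C: "C \<ge> 0"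
    using bound[of "{}"] by simp
  have sum: "(\<Sum>g\<in>F. (cmod (x g))\<^sup>2) \<le> C\<^sup>2" if "finite F" "F \<subseteq> S" for F
    using bound[OF that] C by (simp add: L2_set_def sqrt_le_D)
  have summ: "(\<lambda>g. (cmod (x g))\<^sup>2) summable_on S"
    by (rule nonneg_bdd_above_summable_on) (use sum in \<open>auto intro!: bdd_aboveI[of _ "C\<^sup>2"]\<close>)
  then show "x \<in> ell2 S"
    using assms(1) by (simp add: ell2_def)
  have "(\<Sum>\<^sub>\<infinity>g\<in>S. (cmod (x g))\<^sup>2) \<le> C\<^sup>2"
    using summ sum by (rule infsum_le_finite_sums)
  then show "ell2_norm S x \<le> C"
    using C by (simp add: ell2_norm_def real_le_lsqrt infsum_nonneg)
qed

lemma ell2_norm_nonneg [simp]: "0 \<le> ell2_norm S x"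
  by (simp add: ell2_norm_def infsum_nonneg)

lemma ell2_norm_sq: "(ell2_norm S x)\<^sup>2 = (\<Sum>\<^sub>\<infinity>g\<in>S. (cmod (x g))\<^sup>2)"
  by (simp add: ell2_norm_def infsum_nonneg)

lemma L2_set_le_ell2_norm:
  assumes "x \<in> ell2 S" "finite F" "F \<subseteq> S"
  shows "L2_set (\<lambda>g. cmod (x g)) F \<le> ell2_norm S x"
  unfolding L2_set_def ell2_norm_def
  using assms by (auto simp: ell2_def intro!: real_sqrt_le_mono finite_sum_le_infsum)

lemma ell2_outside: "\<lbrakk>x \<in> ell2 S; g \<notin> S\<rbrakk> \<Longrightarrow> x g = 0"
  by (simp add: ell2_def)

lemma cmod_le_ell2_norm: "x \<in> ell2 S \<Longrightarrow> cmod (x g) \<le> ell2_norm S x"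
  using L2_set_le_ell2_norm[of x S "{g}"] by (cases "g \<in> S") (simp_all add: ell2_outside L2_set_def)

lemma ell2_add:
  assumes "x \<in> ell2 S" "y \<in> ell2 S"
  shows "(\<lambda>g. x g + y g) \<in> ell2 S"
    and "ell2_norm S (\<lambda>g. x g + y g) \<le> ell2_norm S x + ell2_norm S y"
proof -
  have "L2_set (\<lambda>g. cmod (x g + y g)) F \<le> ell2_norm S x + ell2_norm S y" if "finite F" "F \<subseteq> S" for F
  proof -
    have "L2_set (\<lambda>g. cmod (x g + y g)) F \<le> L2_set (\<lambda>g. cmod (x g) + cmod (y g)) F"
      by (rule L2_set_mono) (auto simp: norm_triangle_ineq)
    also have "\<dots> \<le> L2_set (\<lambda>g. cmod (x g)) F + L2_set (\<lambda>g. cmod (y g)) F"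
      by (rule L2_set_triangle_ineq)
    also have "\<dots> \<le> ell2_norm S x + ell2_norm S y"
      using assms that by (intro add_mono L2_set_le_ell2_norm)
    finally show ?thesis .
  qed
  note * = ell2_boundI[where x = "\<lambda>g. x g + y g", OF _ this]
  show "(\<lambda>g. x g + y g) \<in> ell2 S"
    and "ell2_norm S (\<lambda>g. x g + y g) \<le> ell2_norm S x + ell2_norm S y"
    using * assms by (auto simp: ell2_outside)
qed

lemma ell2_smult: "x \<in> ell2 S \<Longrightarrow> (\<lambda>g. c * x g) \<in> ell2 S"
  by (auto simp: ell2_def norm_mult power_mult_distrib intro!: summable_on_cmult_right)

lemma ell2_norm_smult: "ell2_norm S (\<lambda>g. c * x g) = cmod c * ell2_norm S x"
  by (simp add: ell2_norm_def norm_mult power_mult_distrib infsum_cmult_right' real_sqrt_mult)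

lemma ell2_zero [simp]: "(\<lambda>g. 0) \<in> ell2 S"
  by (simp add: ell2_def)

lemma ell2_norm_zero [simp]: "ell2_norm S (\<lambda>g. 0) = 0"
  by (simp add: ell2_norm_def)

lemma ell2_norm_eq_zero: "\<lbrakk>x \<in> ell2 S; ell2_norm S x = 0\<rbrakk> \<Longrightarrow> x = (\<lambda>g. 0)"
  using cmod_le_ell2_norm[of x S] by fastforce

lemma ell2_diff:
  assumes "x \<in> ell2 S" "y \<in> ell2 S"
  shows "(\<lambda>g. x g - y g) \<in> ell2 S"
  using ell2_add(1)[OF assms(1) ell2_smult[OF assms(2), of "-1"]] by simp

lemma ell2_inner_abs_summable:
  assumes x: "x \<in> ell2 S" and y: "y \<in> ell2 S"
  shows "(\<lambda>g. cnj (x g) * y g) abs_summable_on S"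
    and "(\<Sum>\<^sub>\<infinity>g\<in>S. cmod (cnj (x g) * y g)) \<le> ell2_norm S x * ell2_norm S y"
proof -
  have sum: "(\<Sum>g\<in>F. cmod (cnj (x g) * y g)) \<le> ell2_norm S x * ell2_norm S y"
    if "finite F" "F \<subseteq> S" for F
  proof -
    have "(\<Sum>g\<in>F. cmod (cnj (x g) * y g)) \<le> L2_set (\<lambda>g. cmod (x g)) F * L2_set (\<lambda>g. cmod (y g)) F"
      using L2_set_mult_ineq[of "\<lambda>g. cmod (x g)" "\<lambda>g. cmod (y g)" F] by (simp add: norm_mult)
    also have "\<dots> \<le> ell2_norm S x * ell2_norm S y"
      using x y that by (intro mult_mono L2_set_le_ell2_norm) auto
    finally show ?thesis .
  qed
  show summ: "(\<lambda>g. cnj (x g) * y g) abs_summable_on S"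
    by (rule nonneg_bdd_above_summable_on)
      (use sum in \<open>auto intro!: bdd_aboveI[of _ "ell2_norm S x * ell2_norm S y"]\<close>)
  show "(\<Sum>\<^sub>\<infinity>g\<in>S. cmod (cnj (x g) * y g)) \<le> ell2_norm S x * ell2_norm S y"
    using summ sum by (rule infsum_le_finite_sums)
qed

lemmas ell2_inner_summable = abs_summable_summable[OF ell2_inner_abs_summable(1)]

lemma ell2_cauchy_schwarz:
  "\<lbrakk>x \<in> ell2 S; y \<in> ell2 S\<rbrakk> \<Longrightarrow> cmod (ell2_inner S x y) \<le> ell2_norm S x * ell2_norm S y"
  unfolding ell2_inner_def
  using norm_infsum_bound[OF ell2_inner_abs_summable(1)] ell2_inner_abs_summable(2) order_trans by blast

lemma ell2_inner_add_right:
  "\<lbrakk>x \<in> ell2 S; y \<in> ell2 S; z \<in> ell2 S\<rbrakk> \<Longrightarrow>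
    ell2_inner S x (\<lambda>g. y g + z g) = ell2_inner S x y + ell2_inner S x z"
  unfolding ell2_inner_def by (simp add: distrib_left infsum_add ell2_inner_summable)

lemma ell2_inner_smult_right:
  "ell2_inner S x (\<lambda>g. c * y g) = c * ell2_inner S x y"
  unfolding ell2_inner_def by (simp add: mult.left_commute infsum_cmult_right')

lemma ell2_inner_commute: "cnj (ell2_inner S x y) = ell2_inner S y x"
  unfolding ell2_inner_def by (simp flip: infsum_cnj add: mult.commute)

lemma ell2_inner_add_left:
  assumes "x \<in> ell2 S" "y \<in> ell2 S" "z \<in> ell2 S"
  shows "ell2_inner S (\<lambda>g. y g + z g) x = ell2_inner S y x + ell2_inner S z x"
  using arg_cong[OF ell2_inner_add_right[OF assms], of cnj] by (simp add: ell2_inner_commute)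

lemma ell2_inner_smult_left:
  "ell2_inner S (\<lambda>g. c * y g) x = cnj c * ell2_inner S y x"
  using arg_cong[OF ell2_inner_smult_right[of S x c y], of cnj] by (simp add: ell2_inner_commute)

lemma ell2_inner_self:
  assumes x: "x \<in> ell2 S"
  shows "ell2_inner S x x = complex_of_real ((ell2_norm S x)\<^sup>2)"
proof -
  have "cnj (x g) * x g = complex_of_real ((cmod (x g))\<^sup>2)" for g
    by (simp add: complex_norm_square mult.commute del: of_real_power)
  then show ?thesis
    unfolding ell2_inner_def ell2_norm_sq
    using x by (simp add: ell2_def has_sum_of_real infsumI del: of_real_power)
qed

lemma ell2_inner_delta_left:
  assumes "g \<in> S"
  shows "ell2_inner S (delta g) x = x g"
proof -
  have "ell2_inner S (delta g) x = (\<Sum>\<^sub>\<infinity>h\<in>{g}. x h)"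
    unfolding ell2_inner_def by (rule infsum_cong_neutral) (use assms in \<open>auto simp: delta_def\<close>)
  then show ?thesis
    by simp
qed

lemma ell2_eqI:
  assumes "x \<in> ell2 S" "y \<in> ell2 S" "\<And>g. g \<in> S \<Longrightarrow> ell2_inner S (delta g) x = ell2_inner S (delta g) y"
  shows "x = y"
  using assms by (intro ext) (metis ell2_inner_delta_left ell2_outside)

definition ell2_restrict :: "'g set \<Rightarrow> ('g \<Rightarrow> complex) \<Rightarrow> 'g \<Rightarrow> complex" where
  "ell2_restrict F x = (\<lambda>g. if g \<in> F then x g else 0)"

lemma ell2_restrict_finite:
  assumes "finite F" "F \<subseteq> S"
  shows "ell2_restrict F x \<in> ell2 S" "ell2_norm S (ell2_restrict F x) = L2_set (\<lambda>g. cmod (x g)) F"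
proof -
  have "(\<lambda>g. (cmod (ell2_restrict F x g))\<^sup>2) summable_on F"
    using assms by simp
  then have "(\<lambda>g. (cmod (ell2_restrict F x g))\<^sup>2) summable_on S"
    by (rule summable_on_cong_neutral[THEN iffD1, rotated -1])
      (use assms in \<open>auto simp: ell2_restrict_def\<close>)
  then show "ell2_restrict F x \<in> ell2 S"
    using assms by (auto simp: ell2_def ell2_restrict_def)
  have "(\<Sum>\<^sub>\<infinity>g\<in>S. (cmod (ell2_restrict F x g))\<^sup>2) = (\<Sum>\<^sub>\<infinity>g\<in>F. (cmod (x g))\<^sup>2)"
    by (rule infsum_cong_neutral) (use assms in \<open>auto simp: ell2_restrict_def\<close>)
  then show "ell2_norm S (ell2_restrict F x) = L2_set (\<lambda>g. cmod (x g)) F"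
    using assms by (simp add: ell2_norm_def L2_set_def)
qed

lemma ell2_norm_delta [simp]: "q \<in> S \<Longrightarrow> ell2_norm S (delta q) = 1"
  using ell2_restrict_finite(2)[of "{q}" S "delta q"]
  by (simp add: delta_def ell2_restrict_def if_distrib L2_set_def cong: if_cong)

text \<open>The squared norm of the remainder is the total sum minus a partial sum. This density of
  finitely supported vectors is what extends the adjoint identity from finite sums to all
  vectors.\<close>

lemma ell2_restrict_tendsto:
  assumes x: "x \<in> ell2 S"
  shows "((\<lambda>F. ell2_norm S (\<lambda>g. x g - ell2_restrict F x g)) \<longlongrightarrow> 0) (finite_subsets_at_top S)"
proof -
  let ?f = "\<lambda>g. (cmod (x g))\<^sup>2"
  have f: "?f summable_on S"
    using x by (simp add: ell2_def)
  have eq: "(\<Sum>\<^sub>\<infinity>g\<in>S. (cmod (x g - ell2_restrict F x g))\<^sup>2) = infsum ?f S - sum ?f F"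
    if F: "finite F" "F \<subseteq> S" for F
  proof -
    have "(\<Sum>\<^sub>\<infinity>g\<in>S. (cmod (x g - ell2_restrict F x g))\<^sup>2) = infsum ?f (S - F)"
      by (rule infsum_cong_neutral) (auto simp: ell2_restrict_def)
    also have "\<dots> = infsum ?f S - infsum ?f F"
      using f F by (intro infsum_Diff) auto
    finally show ?thesis
      using F by simp
  qed
  have "((\<lambda>F. sqrt (infsum ?f S - sum ?f F)) \<longlongrightarrow> sqrt (infsum ?f S - infsum ?f S)) (finite_subsets_at_top S)"
    by (intro tendsto_intros infsum_tendsto f)
  then have "((\<lambda>F. sqrt (infsum ?f S - sum ?f F)) \<longlongrightarrow> 0) (finite_subsets_at_top S)"
    by simp
  then show ?thesis
    by (rule Lim_transform_eventually)
      (auto simp: ell2_norm_def eq intro!: eventually_finite_subsets_at_top_weakI)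
qed

section \<open>Bounded operators, their norm and their adjoints\<close>

lemma bounded_opsD:
  assumes "T \<in> bounded_ops S"
  shows "T \<in> extensional (ell2 S)" "x \<in> ell2 S \<Longrightarrow> T x \<in> ell2 S"
    "\<lbrakk>x \<in> ell2 S; y \<in> ell2 S\<rbrakk> \<Longrightarrow> T (\<lambda>g. x g + y g) = (\<lambda>g. T x g + T y g)"
    "x \<in> ell2 S \<Longrightarrow> T (\<lambda>g. c * x g) = (\<lambda>g. c * T x g)"
    "\<exists>C. \<forall>x\<in>ell2 S. ell2_norm S (T x) \<le> C * ell2_norm S x"
  using assms by (auto simp: bounded_ops_def)

lemma bounded_ops_eqI:
  "\<lbrakk>T \<in> bounded_ops S; U \<in> bounded_ops S; \<And>x. x \<in> ell2 S \<Longrightarrow> T x = U x\<rbrakk> \<Longrightarrow> T = U"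
  by (rule extensionalityI[where A = "ell2 S"]) (auto dest: bounded_opsD(1))

lemma bounded_ops_zero_vec: "T \<in> bounded_ops S \<Longrightarrow> T (\<lambda>g. 0) = (\<lambda>g. 0)"
  using bounded_opsD(4)[of T S "\<lambda>g. 0" 0] by simp

lemma bounded_ops_diff:
  assumes T: "T \<in> bounded_ops S" and x: "x \<in> ell2 S" and y: "y \<in> ell2 S"
  shows "T (\<lambda>g. x g - y g) = (\<lambda>g. T x g - T y g)"
  using bounded_opsD(3)[OF T x ell2_smult[OF y, of "-1"]] bounded_opsD(4)[OF T y, of "-1"] by simp

lemma bdd_above_op_norm:
  assumes T: "T \<in> bounded_ops S"
  shows "bdd_above ((\<lambda>x. ell2_norm S (T x)) ` {x \<in> ell2 S. ell2_norm S x \<le> 1})"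
proof -
  obtain C where C: "\<And>x. x \<in> ell2 S \<Longrightarrow> ell2_norm S (T x) \<le> C * ell2_norm S x"
    using bounded_opsD(5)[OF T] by blast
  \<comment> \<open>The constant in \<open>bounded_ops\<close> may be negative when
    \<open>ell2 S\<close> contains only the zero vector.\<close>
  have "ell2_norm S (T z) \<le> max 0 C" if z: "z \<in> ell2 S" "ell2_norm S z \<le> 1" for z
  proof -
    have "ell2_norm S (T z) \<le> max 0 C * ell2_norm S z"
      using C[OF z(1)] by (rule order_trans) (simp add: mult_right_mono)
    also have "\<dots> \<le> max 0 C * 1"
      using z(2) by (intro mult_left_mono) auto
    finally show ?thesis
      by simp
  qed
  then show ?thesis
    by (intro bdd_aboveI2[where M = "max 0 C"]) simp
qed

lemma nrm_ell2_ops_bound: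
  assumes T: "T \<in> bounded_ops S" and x: "x \<in> ell2 S"
  shows "ell2_norm S (T x) \<le> nrm (ell2_ops S) T * ell2_norm S x"
proof (cases "ell2_norm S x = 0")
  case True
  then have "x = (\<lambda>g. 0)"
    using x ell2_norm_eq_zero by blast
  then show ?thesis
    using T by (simp add: bounded_ops_zero_vec)
next
  case False
  let ?n = "ell2_norm S x"
  let ?y = "\<lambda>g. complex_of_real (inverse ?n) * x g"
  have n: "?n > 0"
    using False ell2_norm_nonneg[of S x] by linarith
  have y: "?y \<in> ell2 S" "ell2_norm S ?y \<le> 1"
    using x n by (simp_all only: ell2_smult ell2_norm_smult) (simp add: norm_inverse)
  have "inverse ?n * ell2_norm S (T x) = ell2_norm S (T ?y)"
    using n by (simp only: bounded_opsD(4)[OF T x] ell2_norm_smult) (simp add: norm_inverse)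
  also have "\<dots> \<le> nrm (ell2_ops S) T"
    unfolding ell2_ops_def by (simp, rule cSUP_upper) (use y bdd_above_op_norm[OF T] in simp_all)
  finally show ?thesis
    using n by (simp add: field_simps)
qed

lemma nrm_ell2_ops_le:
  assumes "\<And>x. x \<in> ell2 S \<Longrightarrow> ell2_norm S (T x) \<le> C * ell2_norm S x" "C \<ge> 0"
  shows "nrm (ell2_ops S) T \<le> C"
  unfolding ell2_ops_def
proof (simp, rule cSUP_least)
  show "{x \<in> ell2 S. ell2_norm S x \<le> 1} \<noteq> {}"
    using ell2_zero ell2_norm_zero by (metis (mono_tags, lifting) empty_iff mem_Collect_eq zero_le_one)
  fix x assume "x \<in> {x \<in> ell2 S. ell2_norm S x \<le> 1}"
  then have x: "x \<in> ell2 S" "ell2_norm S x \<le> 1"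
    by auto
  show "ell2_norm S (T x) \<le> C"
    using assms(1)[OF x(1)] mult_left_mono[OF x(2) assms(2)] by simp
qed

lemma nrm_ell2_ops_nonneg: "T \<in> bounded_ops S \<Longrightarrow> 0 \<le> nrm (ell2_ops S) T"
proof -
  assume T: "T \<in> bounded_ops S"
  have "ell2_norm S (T (\<lambda>g. 0)) \<le> nrm (ell2_ops S) T"
    unfolding ell2_ops_def by (simp, rule cSUP_upper) (use bdd_above_op_norm[OF T] in simp_all)
  then show ?thesis
    using T by (simp add: bounded_ops_zero_vec)
qed

lemma bounded_opsI:
  assumes "T \<in> extensional (ell2 S)" "\<And>x. x \<in> ell2 S \<Longrightarrow> T x \<in> ell2 S"
    "\<And>x y. \<lbrakk>x \<in> ell2 S; y \<in> ell2 S\<rbrakk> \<Longrightarrow> T (\<lambda>g. x g + y g) = (\<lambda>g. T x g + T y g)"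
    "\<And>c x. x \<in> ell2 S \<Longrightarrow> T (\<lambda>g. c * x g) = (\<lambda>g. c * T x g)"
    "\<And>x. x \<in> ell2 S \<Longrightarrow> ell2_norm S (T x) \<le> C * ell2_norm S x"
  shows "T \<in> bounded_ops S"
  using assms unfolding bounded_ops_def by blast

text \<open>The coordinate at g of the adjoint applied to x has to be the inner product of
  \<open>delta g\<close> with it, that is of \<open>T (delta g)\<close> with x. Taking this as the
  definition yields the adjoint coordinate by coordinate.\<close>

definition adjoint_op :: "'g set \<Rightarrow> (('g \<Rightarrow> complex) \<Rightarrow> 'g \<Rightarrow> complex) \<Rightarrow> ('g \<Rightarrow> complex) \<Rightarrow> 'g \<Rightarrow> complex" where
  "adjoint_op S T = (\<lambda>x\<in>ell2 S. \<lambda>g. if g \<in> S then ell2_inner S (T (delta g)) x else 0)"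

lemma inner_op_restrict:
  assumes T: "T \<in> bounded_ops S" and F: "finite F" "F \<subseteq> S" and x: "x \<in> ell2 S"
  shows "ell2_inner S (T (ell2_restrict F y)) x = (\<Sum>g\<in>F. cnj (y g) * ell2_inner S (T (delta g)) x)"
  using F
proof (induction F rule: finite_induct)
  case empty
  have "ell2_restrict {} y = (\<lambda>g. 0)"
    by (simp add: ell2_restrict_def)
  then show ?case
    by (simp add: bounded_ops_zero_vec[OF T] ell2_inner_def)
next
  case (insert a F)
  have eq: "ell2_restrict (insert a F) y = (\<lambda>g. y a * delta a g + ell2_restrict F y g)"
    using insert(2) by (auto simp: ell2_restrict_def delta_def fun_eq_iff)
  have a: "delta a \<in> ell2 S"
    using insert by (simp add: delta_in_ell2)
  have "T (ell2_restrict (insert a F) y) = (\<lambda>g. y a * T (delta a) g + T (ell2_restrict F y) g)"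
    unfolding eq using insert T a
    by (simp add: bounded_opsD(3)[OF T] bounded_opsD(4)[OF T] ell2_smult ell2_restrict_finite)
  then show ?case
    using insert T a x
    by (simp add: ell2_inner_add_left ell2_inner_smult_left ell2_smult bounded_opsD(2) ell2_restrict_finite)
qed

text \<open>The candidate u is tested against its own restriction to F: if l is the norm of that
  restriction, then l^2 is the inner product of T applied to it with x, hence at most
  \<open>nrm (ell2_ops S) T\<close> times l times the norm of x. Dividing by l bounds all finite
  pieces at once.\<close>

lemma adjoint_op_bound:
  assumes T: "T \<in> bounded_ops S" and x: "x \<in> ell2 S"
  shows "adjoint_op S T x \<in> ell2 S"
    "ell2_norm S (adjoint_op S T x) \<le> nrm (ell2_ops S) T * ell2_norm S x"
proof -
  let ?u = "adjoint_op S T x"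
  have bound: "L2_set (\<lambda>g. cmod (?u g)) F \<le> nrm (ell2_ops S) T * ell2_norm S x"
    if F: "finite F" "F \<subseteq> S" for F
  proof -
    let ?l = "L2_set (\<lambda>g. cmod (?u g)) F"
    have "ell2_inner S (T (ell2_restrict F ?u)) x = (\<Sum>g\<in>F. cnj (?u g) * ?u g)"
      using F x by (subst inner_op_restrict[OF T F x]) (auto simp: adjoint_op_def intro!: sum.cong)
    also have "\<dots> = (\<Sum>g\<in>F. complex_of_real ((cmod (?u g))\<^sup>2))"
      by (intro sum.cong refl) (simp add: complex_norm_square mult.commute del: of_real_power)
    also have "\<dots> = complex_of_real (?l\<^sup>2)"
      by (simp add: L2_set_def sum_nonneg)
    finally have "?l\<^sup>2 = cmod (ell2_inner S (T (ell2_restrict F ?u)) x)"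
      by (simp add: norm_power)
    also have "\<dots> \<le> ell2_norm S (T (ell2_restrict F ?u)) * ell2_norm S x"
      using T F x by (intro ell2_cauchy_schwarz) (auto simp: bounded_opsD(2) ell2_restrict_finite)
    also have "\<dots> \<le> (nrm (ell2_ops S) T * ?l) * ell2_norm S x"
      using nrm_ell2_ops_bound[OF T ell2_restrict_finite(1)[OF F]] ell2_restrict_finite(2)[OF F]
      by (intro mult_right_mono) auto
    finally have "?l * ?l \<le> (nrm (ell2_ops S) T * ell2_norm S x) * ?l"
      by (simp add: power2_eq_square mult_ac)
    moreover have "?l \<ge> 0" "nrm (ell2_ops S) T * ell2_norm S x \<ge> 0"
      using nrm_ell2_ops_nonneg[OF T] by auto
    ultimately show ?thesis
      by (cases "?l = 0") (auto simp: mult_le_cancel_right)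
  qed
  have outside: "?u g = 0" if "g \<notin> S" for g
    using x that by (simp add: adjoint_op_def)
  show "?u \<in> ell2 S" "ell2_norm S ?u \<le> nrm (ell2_ops S) T * ell2_norm S x"
    using ell2_boundI[OF outside bound] by simp_all
qed

lemma adjoint_op_in_bounded_ops:
  assumes T: "T \<in> bounded_ops S"
  shows "adjoint_op S T \<in> bounded_ops S"
proof (rule bounded_opsI[where C = "nrm (ell2_ops S) T"])
  show "adjoint_op S T (\<lambda>g. x g + y g) = (\<lambda>g. adjoint_op S T x g + adjoint_op S T y g)"
    if "x \<in> ell2 S" "y \<in> ell2 S" for x y
    using that T by (auto simp: adjoint_op_def ell2_add ell2_inner_add_right bounded_opsD(2) delta_in_ell2)
  show "adjoint_op S T (\<lambda>g. c * x g) = (\<lambda>g. c * adjoint_op S T x g)" if "x \<in> ell2 S" for c x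
    using that T by (auto simp: adjoint_op_def ell2_smult ell2_inner_smult_right)
qed (use adjoint_op_bound[OF T] in \<open>auto simp: adjoint_op_def\<close>)

text \<open>For y cut down to a finite set the identity is a finite sum. As the set grows, one side
  converges by summability of the inner product and the other because T is bounded.\<close>

lemma adjoint_op_inner:
  assumes T: "T \<in> bounded_ops S" and x: "x \<in> ell2 S" and y: "y \<in> ell2 S"
  shows "ell2_inner S (adjoint_op S T x) y = ell2_inner S x (T y)"
proof -
  let ?u = "adjoint_op S T x" and ?F = "finite_subsets_at_top S"
  have eq: "ell2_inner S x (T (ell2_restrict F y)) = (\<Sum>g\<in>F. cnj (?u g) * y g)"
    if F: "finite F" "F \<subseteq> S" for F
  proof -
    have "ell2_inner S x (T (ell2_restrict F y)) = cnj (\<Sum>g\<in>F. cnj (y g) * ell2_inner S (T (delta g)) x)"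
      by (simp only: inner_op_restrict[OF T F x, symmetric] ell2_inner_commute)
    also have "\<dots> = (\<Sum>g\<in>F. cnj (?u g) * y g)"
      using F x by (auto simp: adjoint_op_def mult.commute intro!: sum.cong)
    finally show ?thesis .
  qed
  have "((\<lambda>F. \<Sum>g\<in>F. cnj (?u g) * y g) \<longlongrightarrow> ell2_inner S ?u y) ?F"
    unfolding ell2_inner_def
    using adjoint_op_bound[OF T x] y by (intro infsum_tendsto ell2_inner_summable)
  then have lim1: "((\<lambda>F. ell2_inner S x (T (ell2_restrict F y))) \<longlongrightarrow> ell2_inner S ?u y) ?F"
    by (rule Lim_transform_eventually) (auto simp: eq intro!: eventually_finite_subsets_at_top_weakI)
  have "((\<lambda>F. ell2_inner S x (T y) - ell2_inner S x (T (ell2_restrict F y))) \<longlongrightarrow> 0) ?F"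
  proof (rule Lim_null_comparison)
    show "((\<lambda>F. ell2_norm S x * (nrm (ell2_ops S) T * ell2_norm S (\<lambda>g. y g - ell2_restrict F y g))) \<longlongrightarrow> 0) ?F"
      by (intro tendsto_mult_right_zero ell2_restrict_tendsto y)
    show "\<forall>\<^sub>F F in ?F. norm (ell2_inner S x (T y) - ell2_inner S x (T (ell2_restrict F y)))
        \<le> ell2_norm S x * (nrm (ell2_ops S) T * ell2_norm S (\<lambda>g. y g - ell2_restrict F y g))"
    proof (rule eventually_finite_subsets_at_top_weakI)
      fix F assume F: "finite F" "F \<subseteq> S"
      let ?r = "ell2_restrict F y"
      have r: "?r \<in> ell2 S" "(\<lambda>g. y g - ?r g) \<in> ell2 S"
        using F y by (auto simp: ell2_restrict_finite ell2_diff)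
      have "ell2_inner S x (T y) = ell2_inner S x (\<lambda>g. T (\<lambda>g. y g - ?r g) g + T ?r g)"
        using T y r by (simp add: bounded_ops_diff)
      also have "\<dots> = ell2_inner S x (T (\<lambda>g. y g - ?r g)) + ell2_inner S x (T ?r)"
        using T x r by (intro ell2_inner_add_right) (auto simp: bounded_opsD(2))
      finally have "norm (ell2_inner S x (T y) - ell2_inner S x (T ?r)) =
          norm (ell2_inner S x (T (\<lambda>g. y g - ?r g)))"
        by simp
      also have "\<dots> \<le> ell2_norm S x * ell2_norm S (T (\<lambda>g. y g - ?r g))"
        using T x r by (intro ell2_cauchy_schwarz) (auto simp: bounded_opsD(2))
      also have "\<dots> \<le> ell2_norm S x * (nrm (ell2_ops S) T * ell2_norm S (\<lambda>g. y g - ?r g))"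
        using nrm_ell2_ops_bound[OF T r(2)] by (intro mult_left_mono) auto
      finally show "norm (ell2_inner S x (T y) - ell2_inner S x (T ?r))
        \<le> ell2_norm S x * (nrm (ell2_ops S) T * ell2_norm S (\<lambda>g. y g - ?r g))" .
    qed
  qed
  from tendsto_diff[OF tendsto_const[of "ell2_inner S x (T y)"] this]
  have "((\<lambda>F. ell2_inner S x (T (ell2_restrict F y))) \<longlongrightarrow> ell2_inner S x (T y)) ?F"
    by simp
  from tendsto_unique[OF finite_subsets_at_top_neq_bot lim1 this] show ?thesis .
qed

text \<open>Vectors are determined by their inner products with the \<open>delta g\<close>, so an
  adjoint is unique and the definite description in \<open>star\<close> can be evaluated. Each star
  law then amounts to exhibiting an operator with the right inner products.\<close>

lemma star_ell2_ops_eqI: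
  assumes T: "T \<in> bounded_ops S" and U: "U \<in> bounded_ops S"
    and adj: "\<And>x y. \<lbrakk>x \<in> ell2 S; y \<in> ell2 S\<rbrakk> \<Longrightarrow> ell2_inner S (U x) y = ell2_inner S x (T y)"
  shows "star (ell2_ops S) T = U"
proof -
  have "V = U" if V: "V \<in> bounded_ops S"
    "\<forall>x\<in>ell2 S. \<forall>y\<in>ell2 S. ell2_inner S (V x) y = ell2_inner S x (T y)" for V
  proof (rule bounded_ops_eqI[OF V(1) U])
    fix x assume x: "x \<in> ell2 S"
    show "V x = U x"
    proof (rule ell2_eqI)
      fix g assume "g \<in> S"
      then have "ell2_inner S (V x) (delta g) = ell2_inner S (U x) (delta g)"
        using V(2) adj x by (simp add: delta_in_ell2)
      then show "ell2_inner S (delta g) (V x) = ell2_inner S (delta g) (U x)"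
        by (metis ell2_inner_commute)
    qed (rule bounded_opsD(2)[OF V(1) x] bounded_opsD(2)[OF U x])+
  qed
  then have "(THE U. U \<in> bounded_ops S \<and>
      (\<forall>x\<in>ell2 S. \<forall>y\<in>ell2 S. ell2_inner S (U x) y = ell2_inner S x (T y))) = U"
    using U adj by (intro the_equality) blast+
  then show ?thesis
    by (simp add: ell2_ops_def)
qed

lemma star_ell2_ops: "T \<in> bounded_ops S \<Longrightarrow> star (ell2_ops S) T = adjoint_op S T"
  by (intro star_ell2_ops_eqI adjoint_op_in_bounded_ops adjoint_op_inner)

section \<open>The C*-algebra of bounded operators\<close>

lemma ell2_ops_simps:
  "carrier (ell2_ops S) = bounded_ops S"
  "mult (ell2_ops S) T U = compose (ell2 S) T U"
  "one (ell2_ops S) = (\<lambda>x\<in>ell2 S. x)"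
  "zero (ell2_ops S) = (\<lambda>x\<in>ell2 S. (\<lambda>g. 0))"
  "add (ell2_ops S) T U = (\<lambda>x\<in>ell2 S. (\<lambda>g. T x g + U x g))"
  "smult (ell2_ops S) c T = (\<lambda>x\<in>ell2 S. (\<lambda>g. c * T x g))"
  by (simp_all add: ell2_ops_def)

lemma ell2_ops_apply:
  assumes "x \<in> ell2 S"
  shows "(T \<otimes>\<^bsub>ell2_ops S\<^esub> U) x = T (U x)"
    "\<one>\<^bsub>ell2_ops S\<^esub> x = x"
    "\<zero>\<^bsub>ell2_ops S\<^esub> x = (\<lambda>g. 0)"
    "(T \<oplus>\<^bsub>ell2_ops S\<^esub> U) x = (\<lambda>g. T x g + U x g)"
    "(c \<odot>\<^bsub>ell2_ops S\<^esub> T) x = (\<lambda>g. c * T x g)"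
  using assms by (simp_all add: ell2_ops_simps compose_def)

lemma ell2_norm_add_apply_le:
  assumes T: "T \<in> bounded_ops S" and U: "U \<in> bounded_ops S" and x: "x \<in> ell2 S"
  shows "ell2_norm S ((T \<oplus>\<^bsub>ell2_ops S\<^esub> U) x) \<le> (nrm (ell2_ops S) T + nrm (ell2_ops S) U) * ell2_norm S x"
  using ell2_add(2)[OF bounded_opsD(2)[OF T x] bounded_opsD(2)[OF U x]]
    nrm_ell2_ops_bound[OF T x] nrm_ell2_ops_bound[OF U x] x
  by (simp add: ell2_ops_apply algebra_simps)

lemma ell2_norm_smult_apply_le:
  assumes T: "T \<in> bounded_ops S" and x: "x \<in> ell2 S"
  shows "ell2_norm S ((c \<odot>\<^bsub>ell2_ops S\<^esub> T) x) \<le> cmod c * nrm (ell2_ops S) T * ell2_norm S x"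
  using mult_left_mono[OF nrm_ell2_ops_bound[OF T x], of "cmod c"] x
  by (simp add: ell2_ops_apply ell2_norm_smult mult.assoc)

lemma ell2_norm_mult_apply_le:
  assumes T: "T \<in> bounded_ops S" and U: "U \<in> bounded_ops S" and x: "x \<in> ell2 S"
  shows "ell2_norm S ((T \<otimes>\<^bsub>ell2_ops S\<^esub> U) x) \<le> nrm (ell2_ops S) T * nrm (ell2_ops S) U * ell2_norm S x"
proof -
  have "ell2_norm S (T (U x)) \<le> nrm (ell2_ops S) T * ell2_norm S (U x)"
    using T U x by (intro nrm_ell2_ops_bound) (auto simp: bounded_opsD)
  also have "\<dots> \<le> nrm (ell2_ops S) T * (nrm (ell2_ops S) U * ell2_norm S x)"
    using T U x by (intro mult_left_mono nrm_ell2_ops_bound nrm_ell2_ops_nonneg)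
  finally show ?thesis
    using x by (simp add: ell2_ops_apply mult.assoc)
qed

lemma bounded_ops_add: "\<lbrakk>T \<in> bounded_ops S; U \<in> bounded_ops S\<rbrakk> \<Longrightarrow> T \<oplus>\<^bsub>ell2_ops S\<^esub> U \<in> bounded_ops S"
  by (rule bounded_opsI[OF _ _ _ _ ell2_norm_add_apply_le])
    (auto simp: ell2_ops_simps ell2_add bounded_opsD ell2_smult algebra_simps extensional_def)

lemma bounded_ops_smult: "T \<in> bounded_ops S \<Longrightarrow> c \<odot>\<^bsub>ell2_ops S\<^esub> T \<in> bounded_ops S"
  by (rule bounded_opsI[OF _ _ _ _ ell2_norm_smult_apply_le])
    (auto simp: ell2_ops_simps ell2_add bounded_opsD ell2_smult algebra_simps extensional_def)

lemma bounded_ops_mult: "\<lbrakk>T \<in> bounded_ops S; U \<in> bounded_ops S\<rbrakk> \<Longrightarrow> T \<otimes>\<^bsub>ell2_ops S\<^esub> U \<in> bounded_ops S"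
  by (rule bounded_opsI[OF _ _ _ _ ell2_norm_mult_apply_le])
    (auto simp: ell2_ops_simps compose_def ell2_add bounded_opsD ell2_smult algebra_simps extensional_def)

lemma bounded_ops_one: "\<one>\<^bsub>ell2_ops S\<^esub> \<in> bounded_ops S"
  by (rule bounded_opsI[where C = 1]) (auto simp: ell2_ops_simps ell2_add ell2_smult)

lemma bounded_ops_zero: "\<zero>\<^bsub>ell2_ops S\<^esub> \<in> bounded_ops S"
  by (rule bounded_opsI[where C = 1]) (auto simp: ell2_ops_simps ell2_add ell2_smult)

lemma star_algebra_ell2_ops: "star_algebra (ell2_ops S)"
proof (rule star_algebraI, unfold ell2_ops_simps(1))
  note cl = bounded_ops_add bounded_ops_smult bounded_ops_mult bounded_ops_one bounded_ops_zero
  note ap = ell2_ops_apply bounded_opsD(2)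
  have star: "star (ell2_ops S) T \<in> bounded_ops S" if "T \<in> bounded_ops S" for T
    using that by (simp add: star_ell2_ops adjoint_op_in_bounded_ops)
  have inner: "ell2_inner S (star (ell2_ops S) T x) y = ell2_inner S x (T y)"
    if "T \<in> bounded_ops S" "x \<in> ell2 S" "y \<in> ell2 S" for T x y
    using that by (simp add: star_ell2_ops adjoint_op_inner)
  have inner': "ell2_inner S (T x) y = ell2_inner S x (star (ell2_ops S) T y)"
    if "T \<in> bounded_ops S" "x \<in> ell2 S" "y \<in> ell2 S" for T x y
    using inner[OF that(1,3,2)] ell2_inner_commute by metis
  note seq = star_ell2_ops_eqI
  fix T U V :: "('a \<Rightarrow> complex) \<Rightarrow> 'a \<Rightarrow> complex" and c d :: complex
  assume T: "T \<in> bounded_ops S"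
  show "star (ell2_ops S) T \<in> bounded_ops S"
    using T by (rule star)
  show "star (ell2_ops S) (star (ell2_ops S) T) = T"
    using T by (intro seq star) (simp_all add: inner')
  show "star (ell2_ops S) (c \<odot>\<^bsub>ell2_ops S\<^esub> T) = cnj c \<odot>\<^bsub>ell2_ops S\<^esub> star (ell2_ops S) T"
    using T by (intro seq cl star)
      (simp_all add: ap star ell2_inner_smult_left ell2_inner_smult_right inner)
  show "\<zero>\<^bsub>ell2_ops S\<^esub> \<oplus>\<^bsub>ell2_ops S\<^esub> T = T"
    by (rule bounded_ops_eqI[where S = S]) (simp_all add: cl ap T)
  show "\<one>\<^bsub>ell2_ops S\<^esub> \<otimes>\<^bsub>ell2_ops S\<^esub> T = T"
    by (rule bounded_ops_eqI[where S = S]) (simp_all add: cl ap T)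
  show "T \<otimes>\<^bsub>ell2_ops S\<^esub> \<one>\<^bsub>ell2_ops S\<^esub> = T"
    by (rule bounded_ops_eqI[where S = S]) (simp_all add: cl ap T)
  show "1 \<odot>\<^bsub>ell2_ops S\<^esub> T = T"
    by (rule bounded_ops_eqI[where S = S]) (simp_all add: cl ap T)
  show "0 \<odot>\<^bsub>ell2_ops S\<^esub> T = \<zero>\<^bsub>ell2_ops S\<^esub>"
    by (rule bounded_ops_eqI[where S = S]) (simp_all add: cl ap T)
  show "c \<odot>\<^bsub>ell2_ops S\<^esub> T \<in> bounded_ops S"
    using T by (rule cl)
  show "(c + d) \<odot>\<^bsub>ell2_ops S\<^esub> T = c \<odot>\<^bsub>ell2_ops S\<^esub> T \<oplus>\<^bsub>ell2_ops S\<^esub> d \<odot>\<^bsub>ell2_ops S\<^esub> T"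
    by (rule bounded_ops_eqI[where S = S]) (simp_all add: cl ap T algebra_simps)
  show "(c * d) \<odot>\<^bsub>ell2_ops S\<^esub> T = c \<odot>\<^bsub>ell2_ops S\<^esub> (d \<odot>\<^bsub>ell2_ops S\<^esub> T)"
    by (rule bounded_ops_eqI[where S = S]) (simp_all add: cl ap T algebra_simps)
  assume U: "U \<in> bounded_ops S"
  show "T \<oplus>\<^bsub>ell2_ops S\<^esub> U \<in> bounded_ops S" "T \<otimes>\<^bsub>ell2_ops S\<^esub> U \<in> bounded_ops S"
    using T U by (simp_all add: cl)
  show "T \<oplus>\<^bsub>ell2_ops S\<^esub> U = U \<oplus>\<^bsub>ell2_ops S\<^esub> T"
    by (rule bounded_ops_eqI[where S = S]) (simp_all add: cl ap T U bounded_opsD(4)[OF T] algebra_simps)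
  show "c \<odot>\<^bsub>ell2_ops S\<^esub> (T \<oplus>\<^bsub>ell2_ops S\<^esub> U) = c \<odot>\<^bsub>ell2_ops S\<^esub> T \<oplus>\<^bsub>ell2_ops S\<^esub> c \<odot>\<^bsub>ell2_ops S\<^esub> U"
    by (rule bounded_ops_eqI[where S = S]) (simp_all add: cl ap T U bounded_opsD(4)[OF T] algebra_simps)
  show "(c \<odot>\<^bsub>ell2_ops S\<^esub> T) \<otimes>\<^bsub>ell2_ops S\<^esub> U = c \<odot>\<^bsub>ell2_ops S\<^esub> (T \<otimes>\<^bsub>ell2_ops S\<^esub> U)"
    by (rule bounded_ops_eqI[where S = S]) (simp_all add: cl ap T U bounded_opsD(4)[OF T] algebra_simps)
  show "T \<otimes>\<^bsub>ell2_ops S\<^esub> (c \<odot>\<^bsub>ell2_ops S\<^esub> U) = c \<odot>\<^bsub>ell2_ops S\<^esub> (T \<otimes>\<^bsub>ell2_ops S\<^esub> U)"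
    by (rule bounded_ops_eqI[where S = S]) (simp_all add: cl ap T U bounded_opsD(4)[OF T] algebra_simps)
  show "star (ell2_ops S) (T \<oplus>\<^bsub>ell2_ops S\<^esub> U) = star (ell2_ops S) T \<oplus>\<^bsub>ell2_ops S\<^esub> star (ell2_ops S) U"
    using T U by (intro seq cl star)
      (simp_all add: ap star ell2_inner_add_left ell2_inner_add_right inner)
  show "star (ell2_ops S) (T \<otimes>\<^bsub>ell2_ops S\<^esub> U) = star (ell2_ops S) U \<otimes>\<^bsub>ell2_ops S\<^esub> star (ell2_ops S) T"
    using T U by (intro seq cl star) (simp_all add: ap star inner)
  assume V: "V \<in> bounded_ops S"
  show "(T \<oplus>\<^bsub>ell2_ops S\<^esub> U) \<oplus>\<^bsub>ell2_ops S\<^esub> V = T \<oplus>\<^bsub>ell2_ops S\<^esub> (U \<oplus>\<^bsub>ell2_ops S\<^esub> V)"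
    by (rule bounded_ops_eqI[where S = S]) (simp_all add: cl ap T U V bounded_opsD(3)[OF V] algebra_simps)
  show "(T \<otimes>\<^bsub>ell2_ops S\<^esub> U) \<otimes>\<^bsub>ell2_ops S\<^esub> V = T \<otimes>\<^bsub>ell2_ops S\<^esub> (U \<otimes>\<^bsub>ell2_ops S\<^esub> V)"
    by (rule bounded_ops_eqI[where S = S]) (simp_all add: cl ap T U V bounded_opsD(3)[OF V] algebra_simps)
  show "(T \<oplus>\<^bsub>ell2_ops S\<^esub> U) \<otimes>\<^bsub>ell2_ops S\<^esub> V = T \<otimes>\<^bsub>ell2_ops S\<^esub> V \<oplus>\<^bsub>ell2_ops S\<^esub> U \<otimes>\<^bsub>ell2_ops S\<^esub> V"
    by (rule bounded_ops_eqI[where S = S]) (simp_all add: cl ap T U V bounded_opsD(3)[OF V] algebra_simps)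
  show "V \<otimes>\<^bsub>ell2_ops S\<^esub> (T \<oplus>\<^bsub>ell2_ops S\<^esub> U) = V \<otimes>\<^bsub>ell2_ops S\<^esub> T \<oplus>\<^bsub>ell2_ops S\<^esub> V \<otimes>\<^bsub>ell2_ops S\<^esub> U"
    by (rule bounded_ops_eqI[where S = S]) (simp_all add: cl ap T U V bounded_opsD(3)[OF V] algebra_simps)
qed (intro bounded_ops_one bounded_ops_zero)+

lemma ell2_ops_minus_apply:
  assumes "T \<in> bounded_ops S" "U \<in> bounded_ops S" "x \<in> ell2 S"
  shows "(T \<ominus>\<^bsub>ell2_ops S\<^esub> U) x = (\<lambda>g. T x g - U x g)"
proof -
  interpret star_algebra "ell2_ops S"
    by (rule star_algebra_ell2_ops)
  show ?thesis
    using assms minus_eq_csmult[of T U] by (simp add: ell2_ops_simps(1) ell2_ops_apply)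
qed

lemma ell2_inner_star_ell2_ops:
  assumes "T \<in> bounded_ops S" "x \<in> ell2 S" "y \<in> ell2 S"
  shows "ell2_inner S (star (ell2_ops S) T x) y = ell2_inner S x (T y)"
  using assms by (simp add: star_ell2_ops adjoint_op_inner)

lemma cstar_seminorm_ell2_ops: "cstar_seminorm (ell2_ops S) (nrm (ell2_ops S))"
proof -
  let ?n = "nrm (ell2_ops S)"
  note nonneg = nrm_ell2_ops_nonneg
  have tri: "?n (T \<oplus>\<^bsub>ell2_ops S\<^esub> U) \<le> ?n T + ?n U" if T: "T \<in> bounded_ops S" and U: "U \<in> bounded_ops S" for T U
    by (rule nrm_ell2_ops_le[OF ell2_norm_add_apply_le[OF T U]]) (use nonneg[OF T] nonneg[OF U] in simp_all)
  have smult_le: "?n (c \<odot>\<^bsub>ell2_ops S\<^esub> T) \<le> cmod c * ?n T" if T: "T \<in> bounded_ops S" for c T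
    by (rule nrm_ell2_ops_le[OF ell2_norm_smult_apply_le[OF T]]) (use nonneg[OF T] in simp_all)
  have smult: "?n (c \<odot>\<^bsub>ell2_ops S\<^esub> T) = cmod c * ?n T" if T: "T \<in> bounded_ops S" for c T
  proof (cases "c = 0")
    case True
    then show ?thesis
      using smult_le[OF T, of c] nonneg[OF bounded_ops_smult[OF T, of c]] by simp
  next
    case False
    \<comment> \<open>The one-sided estimate, applied to the inverse scalar, gives the reverse
      inequality.\<close>
    have "inverse c \<odot>\<^bsub>ell2_ops S\<^esub> (c \<odot>\<^bsub>ell2_ops S\<^esub> T) = T"
      using T False by (intro bounded_ops_eqI[where S = S]) (simp_all add: ell2_ops_apply bounded_ops_smult flip: mult.assoc)
    then have "?n T \<le> inverse (cmod c) * ?n (c \<odot>\<^bsub>ell2_ops S\<^esub> T)"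
      using smult_le[OF bounded_ops_smult[OF T], of "inverse c" c] by (simp add: norm_inverse)
    then have "cmod c * ?n T \<le> ?n (c \<odot>\<^bsub>ell2_ops S\<^esub> T)"
      using False by (simp add: field_simps)
    then show ?thesis
      using smult_le[OF T, of c] by simp
  qed
  have mult: "?n (T \<otimes>\<^bsub>ell2_ops S\<^esub> U) \<le> ?n T * ?n U" if T: "T \<in> bounded_ops S" and U: "U \<in> bounded_ops S" for T U
    by (rule nrm_ell2_ops_le[OF ell2_norm_mult_apply_le[OF T U]]) (use nonneg[OF T] nonneg[OF U] in simp_all)
  have star: "star (ell2_ops S) T \<in> bounded_ops S" if "T \<in> bounded_ops S" for T
    using that by (simp add: star_ell2_ops adjoint_op_in_bounded_ops)
  have star_le: "?n (star (ell2_ops S) T) \<le> ?n T" if T: "T \<in> bounded_ops S" for T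
    using adjoint_op_bound(2)[OF T] nonneg[OF T] by (simp add: nrm_ell2_ops_le star_ell2_ops[OF T])
  have cst: "?n (star (ell2_ops S) T \<otimes>\<^bsub>ell2_ops S\<^esub> T) = (?n T)\<^sup>2" if T: "T \<in> bounded_ops S" for T
  proof (rule antisym)
    have "?n (star (ell2_ops S) T \<otimes>\<^bsub>ell2_ops S\<^esub> T) \<le> ?n (star (ell2_ops S) T) * ?n T"
      using T by (intro mult star)
    also have "\<dots> \<le> ?n T * ?n T"
      using T by (intro mult_right_mono star_le nonneg)
    finally show "?n (star (ell2_ops S) T \<otimes>\<^bsub>ell2_ops S\<^esub> T) \<le> (?n T)\<^sup>2"
      by (simp add: power2_eq_square)
    let ?s = "?n (star (ell2_ops S) T \<otimes>\<^bsub>ell2_ops S\<^esub> T)"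
    have s: "star (ell2_ops S) T \<otimes>\<^bsub>ell2_ops S\<^esub> T \<in> bounded_ops S"
      using T by (intro bounded_ops_mult star)
    \<comment> \<open>The squared norm of T x is the inner product of (star T) T x with x, so it is
      at most ?s times the squared norm of x.\<close>
    have "?n T \<le> sqrt ?s"
    proof (rule nrm_ell2_ops_le)
      fix x assume x: "x \<in> ell2 S"
      have Tx: "T x \<in> ell2 S"
        using T x by (rule bounded_opsD)
      have "complex_of_real ((ell2_norm S (T x))\<^sup>2) = ell2_inner S (star (ell2_ops S) T (T x)) x"
        using ell2_inner_self[OF Tx] ell2_inner_star_ell2_ops[OF T Tx x] by simp
      then have "(ell2_norm S (T x))\<^sup>2 = cmod (ell2_inner S (star (ell2_ops S) T (T x)) x)"
        by (metis abs_of_nonneg norm_of_real zero_le_power2)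
      also have "\<dots> \<le> ell2_norm S (star (ell2_ops S) T (T x)) * ell2_norm S x"
        using Tx x star[OF T] by (intro ell2_cauchy_schwarz) (auto simp: bounded_opsD)
      also have "\<dots> \<le> (?s * ell2_norm S x) * ell2_norm S x"
        using nrm_ell2_ops_bound[OF s x] x by (intro mult_right_mono) (auto simp: ell2_ops_apply)
      finally have "(ell2_norm S (T x))\<^sup>2 \<le> (sqrt ?s * ell2_norm S x)\<^sup>2"
        using nonneg[OF s] by (simp add: power_mult_distrib) (simp add: power2_eq_square mult_ac)
      then show "ell2_norm S (T x) \<le> sqrt ?s * ell2_norm S x"
        using nonneg[OF s] by (rule_tac power2_le_imp_le) auto
    qed (use nonneg[OF s] in simp)
    then have "(?n T)\<^sup>2 \<le> (sqrt ?s)\<^sup>2"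
      using nonneg[OF T] by (rule power_mono)
    then show "(?n T)\<^sup>2 \<le> ?s"
      using nonneg[OF s] by simp
  qed
  show ?thesis
    unfolding cstar_seminorm_def ell2_ops_simps(1)
    using nonneg tri smult mult cst by blast
qed

lemma cstar_algebra_ell2_ops: "cstar_algebra (ell2_ops S)"
proof (intro cstar_algebra.intro cstar_algebra_axioms.intro star_algebra_ell2_ops cstar_seminorm_ell2_ops)
  let ?A = "ell2_ops S"
  interpret A: seminormed_star_algebra ?A "nrm ?A"
    by (intro seminormed_star_algebra.intro seminormed_star_algebra_axioms.intro
      star_algebra_ell2_ops cstar_seminorm_ell2_ops)
  show "T = \<zero>\<^bsub>?A\<^esub>" if T: "T \<in> carrier ?A" "nrm ?A T = 0" for T
  proof (rule bounded_ops_eqI)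
    show Tb: "T \<in> bounded_ops S"
      using T by (simp add: ell2_ops_simps)
    fix x assume x: "x \<in> ell2 S"
    have "ell2_norm S (T x) = 0"
      using nrm_ell2_ops_bound[OF Tb x] T(2) ell2_norm_nonneg[of S "T x"] by simp
    then have "T x = (\<lambda>g. 0)"
      using bounded_opsD(2)[OF Tb x] by (intro ell2_norm_eq_zero)
    then show "T x = \<zero>\<^bsub>?A\<^esub> x"
      using x by (simp add: ell2_ops_apply)
  qed (rule bounded_ops_zero)
  fix T assume TC: "T \<in> cauchy_seqs ?A (nrm ?A)"
  have T: "T n \<in> bounded_ops S" for n
    using A.cauchy_seqs_closed[OF TC] by (simp add: ell2_ops_simps)
  have minus: "T m \<ominus>\<^bsub>?A\<^esub> T n \<in> bounded_ops S" for m n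
    using abelian_group.minus_closed[OF A.abelian_group_A, of "T m" "T n"] T by (simp add: ell2_ops_simps(1))
  have diff: "ell2_norm S (\<lambda>g. T m x g - T n x g) \<le> nrm ?A (T m \<ominus>\<^bsub>?A\<^esub> T n) * ell2_norm S x"
    if "x \<in> ell2 S" for x m n
    using nrm_ell2_ops_bound[OF minus that] ell2_ops_minus_apply[OF T T that] by simp
  have "convergent (\<lambda>n. T n x g)" if x: "x \<in> ell2 S" for x g
  proof (rule Cauchy_convergent, rule CauchyI)
    fix e :: real assume e: "e > 0"
    \<comment> \<open>The summand 1 keeps the quotient meaningful for the zero vector.\<close>
    define e' where "e' = e / (ell2_norm S x + 1)"
    have pos: "ell2_norm S x + 1 > 0"
      using ell2_norm_nonneg[of S x] by linarith
    then have e': "e' > 0"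
      using e by (simp add: e'_def)
    obtain N where N: "\<And>m n. \<lbrakk>m \<ge> N; n \<ge> N\<rbrakk> \<Longrightarrow> nrm ?A (T m \<ominus>\<^bsub>?A\<^esub> T n) < e'"
      using A.cauchy_seqsE[OF TC e'] by blast
    have "norm (T m x g - T n x g) < e" if mn: "m \<ge> N" "n \<ge> N" for m n
    proof -
      have "norm (T m x g - T n x g) \<le> ell2_norm S (\<lambda>g. T m x g - T n x g)"
        using T x by (intro cmod_le_ell2_norm[of "\<lambda>g. T m x g - T n x g"] ell2_diff) (auto simp: bounded_opsD)
      also have "\<dots> \<le> e' * ell2_norm S x"
        using diff[OF x, of m n] N[OF mn] by (meson ell2_norm_nonneg less_imp_le mult_right_mono order_trans)
      also have "\<dots> < e' * (ell2_norm S x + 1)"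
        using e' by simp
      also have "\<dots> = e"
        using pos by (simp add: e'_def)
      finally show ?thesis .
    qed
    then show "\<exists>M. \<forall>m\<ge>M. \<forall>n\<ge>M. norm (T m x g - T n x g) < e"
      by blast
  qed
  then have conv: "(\<lambda>n. T n x g) \<longlonglongrightarrow> lim (\<lambda>n. T n x g)" if "x \<in> ell2 S" for x g
    using that by (simp add: convergent_LIMSEQ_iff)
  define L where "L = (\<lambda>x\<in>ell2 S. \<lambda>g. lim (\<lambda>n. T n x g))"
  have L: "(\<lambda>n. T n x g) \<longlonglongrightarrow> L x g" if "x \<in> ell2 S" for x g
    using conv[OF that] that by (simp add: L_def)
  have L_out: "L x g = 0" if "x \<in> ell2 S" "g \<notin> S" for x g
    using L[OF that(1), of g] ell2_outside[OF bounded_opsD(2)[OF T that(1)] that(2)]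
    by (simp add: LIMSEQ_const_iff)
  \<comment> \<open>On a finite set of coordinates the norm estimate survives the coordinatewise
    limit. The bound does not depend on the set, so it holds for the whole vector, with the same N
    for every x.\<close>
  have near: "(\<lambda>g. T m x g - L x g) \<in> ell2 S \<and> ell2_norm S (\<lambda>g. T m x g - L x g) \<le> e * ell2_norm S x"
    if x: "x \<in> ell2 S" and N: "\<And>n. n \<ge> N \<Longrightarrow> nrm ?A (T m \<ominus>\<^bsub>?A\<^esub> T n) < e" for x m N e
  proof -
    have "L2_set (\<lambda>g. cmod (T m x g - L x g)) F \<le> e * ell2_norm S x" if F: "finite F" "F \<subseteq> S" for F
    proof (rule LIMSEQ_le_const2)
      show "(\<lambda>n. L2_set (\<lambda>g. cmod (T m x g - T n x g)) F) \<longlonglongrightarrow> L2_set (\<lambda>g. cmod (T m x g - L x g)) F"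
        unfolding L2_set_def by (intro tendsto_intros L x)
      have "L2_set (\<lambda>g. cmod (T m x g - T n x g)) F \<le> e * ell2_norm S x" if n: "n \<ge> N" for n
      proof -
        have "L2_set (\<lambda>g. cmod (T m x g - T n x g)) F \<le> ell2_norm S (\<lambda>g. T m x g - T n x g)"
          using T x F by (intro L2_set_le_ell2_norm ell2_diff) (auto simp: bounded_opsD)
        also have "\<dots> \<le> e * ell2_norm S x"
          using diff[OF x, of m n] N[OF n] by (meson ell2_norm_nonneg less_imp_le mult_right_mono order_trans)
        finally show ?thesis .
      qed
      then show "\<exists>N. \<forall>n\<ge>N. L2_set (\<lambda>g. cmod (T m x g - T n x g)) F \<le> e * ell2_norm S x"
        by blast
    qed
    moreover have "T m x g - L x g = 0" if "g \<notin> S" for g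
      using L_out[OF x that] ell2_outside[OF bounded_opsD(2)[OF T x] that] by simp
    ultimately show ?thesis
      using ell2_boundI[of S "\<lambda>g. T m x g - L x g"] by blast
  qed
  have Lb: "L \<in> bounded_ops S"
  proof -
    obtain N where N: "\<And>m n. \<lbrakk>m \<ge> N; n \<ge> N\<rbrakk> \<Longrightarrow> nrm ?A (T m \<ominus>\<^bsub>?A\<^esub> T n) < 1"
      using A.cauchy_seqsE[OF TC zero_less_one] by blast
    have *: "(\<lambda>g. T N x g - L x g) \<in> ell2 S" "ell2_norm S (\<lambda>g. T N x g - L x g) \<le> 1 * ell2_norm S x"
      if x: "x \<in> ell2 S" for x
      using near[where m = N and N = N, OF x N] by auto
    \<comment> \<open>That L x lies in \<open>ell2\<close> is not known beforehand; it follows by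
      writing L x as T N x minus the difference controlled by \<open>near\<close>.\<close>
    have eq: "L x = (\<lambda>g. T N x g + (-1) * (T N x g - L x g))" for x
      by simp
    show ?thesis
    proof (rule bounded_opsI[where C = "nrm ?A (T N) + 1"])
      fix x assume x: "x \<in> ell2 S"
      show "L x \<in> ell2 S"
        by (subst eq[of x]) (intro ell2_add ell2_smult * bounded_opsD(2)[OF T] x)
      have "ell2_norm S (L x) \<le> ell2_norm S (T N x) + ell2_norm S (\<lambda>g. (-1) * (T N x g - L x g))"
        by (subst eq[of x], rule ell2_add) (intro ell2_smult * bounded_opsD(2)[OF T] x)+
      also have "\<dots> = ell2_norm S (T N x) + ell2_norm S (\<lambda>g. T N x g - L x g)"
        by (simp only: ell2_norm_smult) simp
      also have "\<dots> \<le> (nrm ?A (T N) + 1) * ell2_norm S x"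
        using *(2)[OF x] nrm_ell2_ops_bound[OF T x, of N] by (simp add: algebra_simps)
      finally show "ell2_norm S (L x) \<le> (nrm ?A (T N) + 1) * ell2_norm S x" .
    next
      fix x y :: "'a \<Rightarrow> complex" and c assume x: "x \<in> ell2 S"
      show "L (\<lambda>g. c * x g) = (\<lambda>g. c * L x g)"
      proof
        fix g
        have "(\<lambda>n. T n (\<lambda>g. c * x g) g) \<longlonglongrightarrow> c * L x g"
          unfolding bounded_opsD(4)[OF T x] by (intro tendsto_intros L x)
        then show "L (\<lambda>g. c * x g) g = c * L x g"
          using L[OF ell2_smult[OF x]] LIMSEQ_unique by blast
      qed
      assume y: "y \<in> ell2 S"
      show "L (\<lambda>g. x g + y g) = (\<lambda>g. L x g + L y g)"
      proof
        fix g
        have "(\<lambda>n. T n (\<lambda>g. x g + y g) g) \<longlonglongrightarrow> L x g + L y g"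
          unfolding bounded_opsD(3)[OF T x y] by (intro tendsto_intros L x y)
        then show "L (\<lambda>g. x g + y g) g = L x g + L y g"
          using L[OF ell2_add(1)[OF x y]] LIMSEQ_unique by blast
      qed
    qed (simp add: L_def)
  qed
  have "(\<lambda>n. nrm ?A (T n \<ominus>\<^bsub>?A\<^esub> L)) \<longlonglongrightarrow> 0"
  proof (rule LIMSEQ_I)
    fix e :: real assume e: "e > 0"
    then obtain N where N: "\<And>m n. \<lbrakk>m \<ge> N; n \<ge> N\<rbrakk> \<Longrightarrow> nrm ?A (T m \<ominus>\<^bsub>?A\<^esub> T n) < e / 2"
      using A.cauchy_seqsE[OF TC, of "e / 2"] by auto
    have "norm (nrm ?A (T m \<ominus>\<^bsub>?A\<^esub> L) - 0) < e" if m: "m \<ge> N" for m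
    proof -
      have "nrm ?A (T m \<ominus>\<^bsub>?A\<^esub> L) \<le> e / 2"
      proof (rule nrm_ell2_ops_le)
        fix x assume x: "x \<in> ell2 S"
        show "ell2_norm S ((T m \<ominus>\<^bsub>?A\<^esub> L) x) \<le> e / 2 * ell2_norm S x"
          using near[where m = m and N = N, OF x N[OF m]] ell2_ops_minus_apply[OF T Lb x] by simp
      qed (use e in simp)
      moreover have "0 \<le> nrm ?A (T m \<ominus>\<^bsub>?A\<^esub> L)"
        using A.p_nonneg[of "T m \<ominus>\<^bsub>?A\<^esub> L"] abelian_group.minus_closed[OF A.abelian_group_A, of "T m" L] T Lb by (simp add: ell2_ops_simps(1))
      ultimately show ?thesis
        using e by simp
    qed
    then show "\<exists>N. \<forall>n\<ge>N. norm (nrm ?A (T n \<ominus>\<^bsub>?A\<^esub> L) - 0) < e"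
      by blast
  qed
  then show "\<exists>L\<in>carrier ?A. (\<lambda>n. nrm ?A (T n \<ominus>\<^bsub>?A\<^esub> L)) \<longlonglongrightarrow> 0"
    using Lb by (auto simp: ell2_ops_simps(1))
qed

section \<open>Diagonal operators\<close>

definition diag_op :: "'g set \<Rightarrow> ('g \<Rightarrow> complex) \<Rightarrow> ('g \<Rightarrow> complex) \<Rightarrow> 'g \<Rightarrow> complex" where
  "diag_op S f = (\<lambda>x\<in>ell2 S. \<lambda>g. f g * x g)"

lemma diag_op_bounded:
  assumes "\<And>g. g \<in> S \<Longrightarrow> cmod (f g) \<le> C"
  shows "diag_op S f \<in> bounded_ops S"
proof (cases "S = {}")
  \<comment> \<open>With S empty the assumption says nothing about the sign of C, so the bound 0 is
    used.\<close>
  case True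
  then have "ell2 S = {\<lambda>g. 0}"
    by (auto simp: ell2_def)
  then show ?thesis
    by (intro bounded_opsI[where C = 0]) (auto simp: diag_op_def)
next
  case False
  then have C: "C \<ge> 0"
    using assms norm_ge_zero order_trans by blast
  have "(\<lambda>g. f g * x g) \<in> ell2 S \<and> ell2_norm S (\<lambda>g. f g * x g) \<le> C * ell2_norm S x" if x: "x \<in> ell2 S" for x
  proof -
    have "L2_set (\<lambda>g. cmod (f g * x g)) F \<le> C * ell2_norm S x" if F: "finite F" "F \<subseteq> S" for F
    proof -
      have "L2_set (\<lambda>g. cmod (f g * x g)) F \<le> L2_set (\<lambda>g. C * cmod (x g)) F"
        using assms F C by (intro L2_set_mono) (auto simp: norm_mult intro!: mult_right_mono)
      also have "\<dots> = C * L2_set (\<lambda>g. cmod (x g)) F"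
        using C by (simp add: L2_set_right_distrib)
      also have "\<dots> \<le> C * ell2_norm S x"
        using x F C by (intro mult_left_mono L2_set_le_ell2_norm)
      finally show ?thesis .
    qed
    then show ?thesis
      using ell2_boundI[of S "\<lambda>g. f g * x g"] ell2_outside[OF x] by auto
  qed
  then show ?thesis
    by (intro bounded_opsI[where C = C]) (auto simp: diag_op_def ell2_add ell2_smult algebra_simps)
qed

lemma indicator_op_eq_diag_op: "indicator_op S K = diag_op S (\<lambda>g. if g \<in> K then 1 else 0)"
  by (auto simp: indicator_op_def diag_op_def intro!: restrict_ext)

lemma indicator_op_bounded: "indicator_op S K \<in> bounded_ops S"
  unfolding indicator_op_eq_diag_op by (rule diag_op_bounded[where C = 1]) simp

section \<open>Contractivity of star homomorphisms into operators\<close>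

lemma ell2_norm_diff_sq:
  assumes x: "x \<in> ell2 S" and y: "y \<in> ell2 S"
  shows "(ell2_norm S (\<lambda>g. x g - y g))\<^sup>2 = (ell2_norm S x)\<^sup>2 - 2 * Re (ell2_inner S x y) + (ell2_norm S y)\<^sup>2"
proof -
  have y': "(\<lambda>g. (-1) * y g) \<in> ell2 S"
    using y by (rule ell2_smult)
  let ?z = "\<lambda>g. x g + (-1) * y g"
  have z: "?z \<in> ell2 S"
    by (rule ell2_add(1)[OF x y'])
  have "ell2_inner S ?z ?z = ell2_inner S ?z x + ell2_inner S ?z (\<lambda>g. (-1) * y g)"
    by (rule ell2_inner_add_right[OF z x y'])
  also have "\<dots> = ell2_inner S x x - ell2_inner S y x - ell2_inner S x y + ell2_inner S y y"
    by (simp only: ell2_inner_add_left[OF x x y'] ell2_inner_add_left[OF y x y']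
        ell2_inner_smult_right ell2_inner_smult_left distrib_left) simp
  finally have "Re (ell2_inner S ?z ?z) = Re (ell2_inner S x x) - Re (ell2_inner S y x) - Re (ell2_inner S x y) + Re (ell2_inner S y y)"
    by simp
  moreover have "Re (ell2_inner S y x) = Re (ell2_inner S x y)"
    by (metis complex_cnj(1) complex_surj ell2_inner_commute complex.sel(1))
  ultimately show ?thesis
    using ell2_inner_self[OF x] ell2_inner_self[OF y] ell2_inner_self[OF z]
    by (simp del: of_real_power)
qed

text \<open>If \<open>\<parallel>h\<parallel> < t = \<parallel>f h\<parallel>\<close>, then \<open>1 - h\<^sup>2/t\<^sup>2\<close> is invertible by a Neumann series, hence
  \<open>1 - (f h)\<^sup>2/t\<^sup>2\<close> is bounded below. Vectors at which \<open>f h\<close> almost attains its norm contradict this.\<close>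

lemma star_hom_ell2_contractive_selfadjoint:
  assumes A: "cstar_algebra A" and f: "unital_star_hom A (ell2_ops S) f"
    and h: "h \<in> carrier A" "star A h = h"
  shows "nrm (ell2_ops S) (f h) \<le> nrm A h"
proof (rule ccontr)
  interpret A: cstar_algebra A by fact
  let ?B = "ell2_ops S"
  interpret B: cstar_algebra ?B
    by (rule cstar_algebra_ell2_ops)
  interpret star_hom A ?B f
    using f by (intro star_homI A.star_algebra_axioms B.star_algebra_axioms)
  let ?T = "f h"
  define t where "t = nrm ?B ?T"
  assume "\<not> nrm ?B ?T \<le> nrm A h"
  then have ht: "nrm A h < t"
    by (simp add: t_def)
  with A.p_nonneg[OF h(1)] have t: "t > 0"
    by linarith
  \<comment> \<open>This scaling gives d norm below 1 in A while \<open>f d\<close> still has norm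
    at most 1.\<close>
  let ?c = "complex_of_real (inverse (t\<^sup>2))"
  define d where "d = ?c \<odot>\<^bsub>A\<^esub> (h \<otimes>\<^bsub>A\<^esub> h)"
  have dc: "d \<in> carrier A"
    using h by (simp add: d_def A.m_closed)
  have "nrm A d \<le> inverse (t\<^sup>2) * (nrm A h * nrm A h)"
    using A.p_mult[OF h(1) h(1)] h t by (simp add: d_def A.p_smult A.m_closed norm_inverse norm_power)
  also have "\<dots> < inverse (t\<^sup>2) * (t * t)"
    using ht t A.p_nonneg[OF h(1)] by (intro mult_strict_left_mono mult_strict_mono') auto
  also have "\<dots> = 1"
    using t by (simp add: power2_eq_square field_simps)
  finally obtain u where u: "u \<in> carrier A" "(\<one>\<^bsub>A\<^esub> \<ominus>\<^bsub>A\<^esub> d) \<otimes>\<^bsub>A\<^esub> u = \<one>\<^bsub>A\<^esub>"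
    using A.neumann_inverse[OF dc] by blast
  have "star A d = d"
    using h dc by (simp add: d_def A.star_smult A.star_mult A.m_closed)
  \<comment> \<open>Since d is self-adjoint, the star of the right inverse u is a left inverse, and
    its image V undoes \<one> - f d on vectors.\<close>
  then have "star A u \<otimes>\<^bsub>A\<^esub> (\<one>\<^bsub>A\<^esub> \<ominus>\<^bsub>A\<^esub> d) = \<one>\<^bsub>A\<^esub>"
    using arg_cong[OF u(2), of "star A"] u(1) dc by (simp add: A.star_mult A.star_minus)
  from arg_cong[OF this, of f]
  have VD: "f (star A u) \<otimes>\<^bsub>?B\<^esub> (\<one>\<^bsub>?B\<^esub> \<ominus>\<^bsub>?B\<^esub> f d) = \<one>\<^bsub>?B\<^esub>"
    using u(1) dc by (simp add: hom_mult hom_minus hom_one)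
  define V where "V = f (star A u)"
  have V: "V \<in> bounded_ops S" and T: "?T \<in> bounded_ops S" and D: "f d \<in> bounded_ops S"
    using hom_closed[of "star A u"] hom_closed[OF h(1)] hom_closed[OF dc] u(1)
    by (simp_all add: V_def ell2_ops_simps(1))
  have fd: "f d = ?c \<odot>\<^bsub>?B\<^esub> (?T \<otimes>\<^bsub>?B\<^esub> ?T)"
    using h by (simp add: d_def hom_smult hom_mult A.m_closed del: of_real_inverse)
  have Tsa: "star ?B ?T = ?T"
    using h hom_star[OF h(1)] by simp
  \<comment> \<open>The summand 1 forces C \<ge> 1, which puts the k defined next between 0 and
    1.\<close>
  define C where "C = nrm ?B V + 1"
  have C: "C \<ge> 1"
    using nrm_ell2_ops_nonneg[OF V] by (simp add: C_def)
  \<comment> \<open>Expanding the squared norm of x - f d x gives |x|^2 \<le> 2 C^2 (|x|^2 - |f h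
    x|^2 / t^2). Solved for |f h x|^2 this reads |f h x|^2 \<le> t^2 k |x|^2, so the norm t of f h
    would be at most t times the square root of k.\<close>
  define k where "k = 1 - inverse (2 * C\<^sup>2)"
  have "C\<^sup>2 \<ge> 1"
    using C by (simp add: power2_eq_square mult_ge1_I)
  then have "0 < 2 * C\<^sup>2" "1 \<le> 2 * C\<^sup>2"
    by linarith+
  then have "0 < inverse (2 * C\<^sup>2)" "inverse (2 * C\<^sup>2) \<le> 1"
    using le_imp_inverse_le[of 1 "2 * C\<^sup>2"] by (simp_all del: inverse_mult_distrib)
  then have k: "0 \<le> k" "k < 1"
    by (simp_all add: k_def)
  have "ell2_norm S (?T x) \<le> (t * sqrt k) * ell2_norm S x" if x: "x \<in> ell2 S" for x
  proof -
    let ?n = "ell2_norm S x"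
    have Tx: "?T x \<in> ell2 S" and Dx: "f d x \<in> ell2 S"
      using x T D by (auto simp: bounded_opsD)
    have Dx_eq: "f d x = (\<lambda>g. ?c * ?T (?T x) g)"
      using x by (simp add: fd ell2_ops_apply del: of_real_inverse)
    have "ell2_inner S x (f d x) = ?c * ell2_inner S x (?T (?T x))"
      unfolding Dx_eq by (rule ell2_inner_smult_right)
    also have "ell2_inner S x (?T (?T x)) = ell2_inner S (?T x) (?T x)"
      using ell2_inner_star_ell2_ops[OF T x Tx] Tsa by simp
    also have "\<dots> = complex_of_real ((ell2_norm S (?T x))\<^sup>2)"
      using Tx by (rule ell2_inner_self)
    finally have inner: "Re (ell2_inner S x (f d x)) = inverse (t\<^sup>2) * (ell2_norm S (?T x))\<^sup>2"
      by (simp del: of_real_inverse of_real_power)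
    have "ell2_norm S (f d x) = inverse (t\<^sup>2) * ell2_norm S (?T (?T x))"
      unfolding Dx_eq ell2_norm_smult by (simp add: norm_inverse norm_power)
    also have "\<dots> \<le> inverse (t\<^sup>2) * (t * (t * ?n))"
      using order_trans[OF nrm_ell2_ops_bound[OF T Tx, folded t_def]
          mult_left_mono[OF nrm_ell2_ops_bound[OF T x, folded t_def], of t]] t
      by (intro mult_left_mono) auto
    also have "\<dots> = ?n"
      using t by (simp add: power2_eq_square field_simps)
    finally have Dle: "(ell2_norm S (f d x))\<^sup>2 \<le> ?n\<^sup>2"
      by (intro power_mono) simp_all
    let ?y = "\<lambda>g. x g - f d x g"
    have y: "?y \<in> ell2 S"
      using x Dx by (rule ell2_diff)
    have "x = (V \<otimes>\<^bsub>?B\<^esub> (\<one>\<^bsub>?B\<^esub> \<ominus>\<^bsub>?B\<^esub> f d)) x"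
      using x VD by (simp add: V_def ell2_ops_apply)
    also have "\<dots> = V ?y"
      using x D by (simp add: ell2_ops_apply ell2_ops_minus_apply bounded_ops_one)
    finally have "?n \<le> nrm ?B V * ell2_norm S ?y"
      using nrm_ell2_ops_bound[OF V y] by simp
    also have "\<dots> \<le> C * ell2_norm S ?y"
      by (intro mult_right_mono) (simp_all add: C_def)
    finally have "?n\<^sup>2 \<le> (C * ell2_norm S ?y)\<^sup>2"
      by (intro power_mono) simp_all
    also have "\<dots> = C\<^sup>2 * (?n\<^sup>2 - 2 * (inverse (t\<^sup>2) * (ell2_norm S (?T x))\<^sup>2) + (ell2_norm S (f d x))\<^sup>2)"
      using ell2_norm_diff_sq[OF x Dx] inner by (simp add: power_mult_distrib)
    also have "\<dots> \<le> C\<^sup>2 * (2 * (?n\<^sup>2 - inverse (t\<^sup>2) * (ell2_norm S (?T x))\<^sup>2))"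
      using Dle by (intro mult_left_mono) auto
    finally have "inverse (2 * C\<^sup>2) * ?n\<^sup>2 \<le>
        inverse (2 * C\<^sup>2) * (C\<^sup>2 * (2 * (?n\<^sup>2 - inverse (t\<^sup>2) * (ell2_norm S (?T x))\<^sup>2)))"
      by (rule mult_left_mono) simp
    also have "inverse (2 * C\<^sup>2) * (C\<^sup>2 * (2 * y)) = y" for y
      using C by simp
    finally have "inverse (2 * C\<^sup>2) * ?n\<^sup>2 \<le> ?n\<^sup>2 - inverse (t\<^sup>2) * (ell2_norm S (?T x))\<^sup>2" .
    then have "inverse (t\<^sup>2) * (ell2_norm S (?T x))\<^sup>2 \<le> k * ?n\<^sup>2"
      by (simp add: k_def left_diff_distrib)
    then have "(ell2_norm S (?T x))\<^sup>2 \<le> t\<^sup>2 * (k * ?n\<^sup>2)"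
      using t by (simp add: field_simps)
    also have "\<dots> = (t * sqrt k * ?n)\<^sup>2"
      using k by (simp add: power_mult_distrib)
    finally show ?thesis
      using t k by (rule_tac power2_le_imp_le) auto
  qed
  then have "t \<le> t * sqrt k"
    unfolding t_def using t k by (intro nrm_ell2_ops_le) (auto simp: t_def)
  moreover have "sqrt k < 1"
    using k by simp
  ultimately show False
    using t by simp
qed

lemma star_hom_ell2_contractive:
  assumes A: "cstar_algebra A" and f: "unital_star_hom A (ell2_ops S) f" and x: "x \<in> carrier A"
  shows "nrm (ell2_ops S) (f x) \<le> nrm A x"
proof -
  interpret A: cstar_algebra A by fact
  interpret B: cstar_algebra "ell2_ops S"
    by (rule cstar_algebra_ell2_ops)
  interpret star_hom A "ell2_ops S" f
    using f by (intro star_homI A.star_algebra_axioms B.star_algebra_axioms)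
  have "(nrm (ell2_ops S) (f x))\<^sup>2 = nrm (ell2_ops S) (f (star A x \<otimes>\<^bsub>A\<^esub> x))"
    using x B.p_cstar[OF hom_closed[OF x]] by (simp add: hom_mult hom_star)
  also have "\<dots> \<le> nrm A (star A x \<otimes>\<^bsub>A\<^esub> x)"
    using x by (intro star_hom_ell2_contractive_selfadjoint A f) (auto simp: A.m_closed A.star_mult)
  also have "\<dots> = (nrm A x)\<^sup>2"
    using x by (rule A.p_cstar)
  finally show ?thesis
    using A.p_nonneg[OF x] by (rule power2_le_imp_le)
qed

section \<open>Norms of combinations of commuting projections\<close>

text \<open>A constant factor disappears under high roots: if b < a with b positive, the powers of a
  / b eventually exceed 2.\<close>

lemma le_of_two_powers_le:
  fixes a b :: real
  assumes le: "\<And>k. a ^ (2 ^ k) \<le> 2 * b ^ (2 ^ k)" and b: "0 \<le> b"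
  shows "a \<le> b"
proof (rule ccontr)
  assume "\<not> a \<le> b"
  then have ab: "b < a"
    by simp
  show False
  proof (cases "b = 0")
    case True
    then show ?thesis
      using le[of 0] ab by simp
  next
    case False
    then have b': "b > 0"
      using b by simp
    let ?r = "a / b"
    have r: "?r > 1"
      using ab b' by simp
    then obtain n where n: "2 < ?r ^ n"
      using real_arch_pow by blast
    also have "?r ^ n \<le> ?r ^ (2 ^ n)"
      using r by (intro power_increasing) (auto intro: less_imp_le)
    finally show False
      using le[of n] b' by (simp add: power_divide field_simps)
  qed
qed

context cstar_algebra
begin

lemma nrm_projection_le_one:
  assumes "z \<in> carrier A" "z \<otimes> z = z" "star A z = z"
  shows "nrm A z \<le> 1"
proof -
  have "nrm A z = (nrm A z)\<^sup>2"
    using p_cstar[OF assms(1)] assms by simp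
  then show ?thesis
    by (cases "nrm A z = 0") (auto simp: power2_eq_square)
qed

lemma complement_projection:
  assumes z: "z \<in> carrier A" "z \<otimes> z = z" "star A z = z"
  shows "\<one> \<ominus> z \<in> carrier A" "(\<one> \<ominus> z) \<otimes> (\<one> \<ominus> z) = \<one> \<ominus> z" "star A (\<one> \<ominus> z) = \<one> \<ominus> z"
    "z \<otimes> (\<one> \<ominus> z) = \<zero>" "(\<one> \<ominus> z) \<oplus> z = \<one>"
proof -
  show c: "\<one> \<ominus> z \<in> carrier A" and "star A (\<one> \<ominus> z) = \<one> \<ominus> z"
    using z by (simp_all add: minus_eq_csmult star_add star_smult)
  show "(\<one> \<ominus> z) \<oplus> z = \<one>"
    using z by (intro minus_add_cancel) auto
  show 0: "z \<otimes> (\<one> \<ominus> z) = \<zero>"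
  proof -
    have "z \<otimes> (\<one> \<ominus> z) = z \<oplus> (-1) \<odot> z"
      using z by (simp add: minus_eq_csmult r_distr smult_mult_right r_one)
    also have "\<dots> = z \<ominus> z"
      using z by (simp only: minus_eq_csmult)
    finally show ?thesis
      using z by simp
  qed
  have "(\<one> \<ominus> z) \<otimes> (\<one> \<ominus> z) = (\<one> \<ominus> z) \<ominus> z \<otimes> (\<one> \<ominus> z)"
    using z c by (subst (1) minus_eq_csmult) (simp_all add: l_distr smult_mult_left minus_eq_csmult l_one m_closed)
  then show "(\<one> \<ominus> z) \<otimes> (\<one> \<ominus> z) = \<one> \<ominus> z"
    using 0 c by simp
qed

text \<open>The triangle inequality only gives a bound \<open>2M\<close>; applied to the powers \<open>h^(2^k)\<close>, whose norms are
  powers of \<open>\<parallel>h\<parallel>\<close>, it gives the sharp bound \<open>M\<close>.\<close>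

lemma nrm_selfadjoint_split:
  assumes z: "z \<in> carrier A" "z \<otimes> z = z" "star A z = z"
    and h: "h \<in> carrier A" "star A h = h" "z \<otimes> h = h \<otimes> z"
    and M: "nrm A (h \<otimes> z) \<le> M" "nrm A (h \<otimes> (\<one> \<ominus> z)) \<le> M"
  shows "nrm A h ^ (2 ^ k) \<le> 2 * M ^ (2 ^ k)"
  using h M
proof (induction k arbitrary: h M)
  case 0
  have "h = h \<otimes> ((\<one> \<ominus> z) \<oplus> z)"
    using complement_projection(5)[OF z] 0 by (simp add: r_one)
  then have "h = h \<otimes> (\<one> \<ominus> z) \<oplus> h \<otimes> z"
    using complement_projection(1)[OF z] z 0 by (simp add: r_distr)
  then have "nrm A h \<le> nrm A (h \<otimes> (\<one> \<ominus> z)) + nrm A (h \<otimes> z)"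
    using p_triangle[of "h \<otimes> (\<one> \<ominus> z)" "h \<otimes> z"] complement_projection(1)[OF z] z 0
    by (simp add: m_closed)
  with 0 show ?case
    by simp
next
  case (Suc k)
  note hh = Suc.prems(1-3)
  let ?w = "\<one> \<ominus> z"
  note w = complement_projection(1-3)[OF z]
  have wh: "?w \<otimes> h = h \<otimes> ?w"
    using z hh by (simp add: minus_eq_csmult l_distr r_distr smult_mult_left smult_mult_right l_one r_one)
  \<comment> \<open>As v is idempotent and commutes with h, (h v)^2 = h^2 v. So the bound M for h
    turns into M^2 for its square, which is what the induction hypothesis is fed with.\<close>
  have sq: "nrm A ((h \<otimes> h) \<otimes> v) \<le> M\<^sup>2"
    if v: "v \<in> carrier A" "v \<otimes> v = v" "v \<otimes> h = h \<otimes> v" "nrm A (h \<otimes> v) \<le> M" for v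
  proof -
    have "(h \<otimes> v) \<otimes> (h \<otimes> v) = h \<otimes> (v \<otimes> h) \<otimes> v"
      using hh(1) v(1) by (simp add: m_assoc m_closed)
    also have "\<dots> = (h \<otimes> h) \<otimes> (v \<otimes> v)"
      using hh(1) v(1) by (simp only: v(3)) (simp add: m_assoc m_closed)
    finally have eq: "(h \<otimes> v) \<otimes> (h \<otimes> v) = (h \<otimes> h) \<otimes> v"
      using v(2) by simp
    have "nrm A ((h \<otimes> h) \<otimes> v) \<le> nrm A (h \<otimes> v) * nrm A (h \<otimes> v)"
      unfolding eq[symmetric] using hh v by (intro p_mult m_closed)
    also have "\<dots> \<le> M * M"
      using v hh by (intro mult_mono order_trans[OF p_nonneg v(4)] p_nonneg m_closed)
    finally show ?thesis
      by (simp add: power2_eq_square)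
  qed
  have "nrm A (h \<otimes> h) ^ (2 ^ k) \<le> 2 * (M\<^sup>2) ^ (2 ^ k)"
  proof (rule Suc.IH)
    show "star A (h \<otimes> h) = h \<otimes> h"
      using hh by (simp add: star_mult)
    have "z \<otimes> (h \<otimes> h) = (z \<otimes> h) \<otimes> h"
      using hh(1) z(1) by (simp add: m_assoc)
    also have "z \<otimes> h = h \<otimes> z"
      by (rule hh(3))
    also have "(h \<otimes> z) \<otimes> h = h \<otimes> (z \<otimes> h)"
      using hh(1) z(1) by (simp add: m_assoc)
    also have "z \<otimes> h = h \<otimes> z"
      by (rule hh(3))
    also have "h \<otimes> (h \<otimes> z) = (h \<otimes> h) \<otimes> z"
      using hh(1) z(1) by (simp add: m_assoc)
    finally show "z \<otimes> (h \<otimes> h) = (h \<otimes> h) \<otimes> z" .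
    show "nrm A ((h \<otimes> h) \<otimes> z) \<le> M\<^sup>2"
      using sq[of z] z hh Suc.prems by blast
    show "nrm A ((h \<otimes> h) \<otimes> ?w) \<le> M\<^sup>2"
      using sq[of ?w] w wh Suc.prems by blast
  qed (use hh in \<open>simp add: m_closed\<close>)
  moreover have "nrm A (h \<otimes> h) = (nrm A h)\<^sup>2"
    using p_cstar[OF hh(1)] hh by simp
  ultimately show ?case
    by (simp add: power_mult)
qed

text \<open>An element commuting with z is block diagonal, and its norm is governed by the larger
  block. With h = (star x) x the bounds M become M^2 by the C*-identity;
  \<open>nrm_selfadjoint_split\<close> then bounds the powers of the norm of h up to a factor 2,
  which \<open>le_of_two_powers_le\<close> removes.\<close>

lemma nrm_split_projection:
  assumes z: "z \<in> carrier A" "z \<otimes> z = z" "star A z = z"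
    and x: "x \<in> carrier A" "z \<otimes> x = x \<otimes> z"
    and M: "nrm A (x \<otimes> z) \<le> M" "nrm A (x \<otimes> (\<one> \<ominus> z)) \<le> M"
  shows "nrm A x \<le> M"
proof -
  let ?h = "star A x \<otimes> x"
  let ?w = "\<one> \<ominus> z"
  note w = complement_projection(1-3)[OF z]
  have M0: "0 \<le> M"
    using order_trans[OF p_nonneg M(1)] x z by (simp add: m_closed)
  have wx: "?w \<otimes> x = x \<otimes> ?w"
    using z x by (simp add: minus_eq_csmult l_distr r_distr smult_mult_left smult_mult_right l_one r_one)
  \<comment> \<open>Taking the star of v x = x v with v self-adjoint shows that v commutes with the
    star of x as well.\<close>
  have comm: "v \<otimes> star A x = star A x \<otimes> v"
    if v: "v \<in> carrier A" "star A v = v" "v \<otimes> x = x \<otimes> v" for v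
  proof -
    have "star A (v \<otimes> x) = star A (x \<otimes> v)"
      by (simp only: v(3))
    then show ?thesis
      using v(1,2) x(1) by (simp add: star_mult)
  qed
  have sq: "nrm A (?h \<otimes> v) \<le> M\<^sup>2"
    if v: "v \<in> carrier A" "v \<otimes> v = v" "star A v = v" "v \<otimes> x = x \<otimes> v" "nrm A (x \<otimes> v) \<le> M" for v
  proof -
    have "star A (x \<otimes> v) \<otimes> (x \<otimes> v) = (v \<otimes> star A x) \<otimes> (x \<otimes> v)"
      using v x by (simp add: star_mult)
    also have "\<dots> = star A x \<otimes> ((v \<otimes> x) \<otimes> v)"
      by (subst comm[OF v(1,3,4)]) (use v(1) x(1) in \<open>simp add: m_assoc m_closed\<close>)
    also have "\<dots> = ?h \<otimes> (v \<otimes> v)"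
      using v(1) x by (simp only: v(4)) (simp add: m_assoc m_closed)
    finally have "nrm A (?h \<otimes> v) = (nrm A (x \<otimes> v))\<^sup>2"
      using p_cstar[of "x \<otimes> v"] v x by (simp add: m_closed)
    then show ?thesis
      using v x by (simp add: power_mono m_closed)
  qed
  have zh: "z \<otimes> ?h = ?h \<otimes> z"
    using comm[OF z(1,3) x(2)] x z by (metis m_assoc star_closed)
  have "nrm A ?h ^ (2 ^ k) \<le> 2 * (M\<^sup>2) ^ (2 ^ k)" for k
    by (rule nrm_selfadjoint_split[OF z])
      (use x z zh sq[of z] sq[of ?w] w wx M in \<open>simp_all add: m_closed star_mult\<close>)
  then have "nrm A ?h \<le> M\<^sup>2"
    by (rule le_of_two_powers_le) simp
  then show ?thesis
    using p_cstar[OF x(1)] M0 by (auto intro: power2_le_imp_le)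
qed

lemma list_product_commute:
  assumes "x \<in> carrier A" "\<And>y. y \<in> set ys \<Longrightarrow> y \<in> carrier A" "\<And>y. y \<in> set ys \<Longrightarrow> x \<otimes> y = y \<otimes> x"
  shows "x \<otimes> list_product A ys = list_product A ys \<otimes> x"
  using assms(2,3)
proof (induction ys)
  case (Cons y ys)
  then have c: "y \<in> carrier A" "list_product A ys \<in> carrier A"
    by auto
  have "x \<otimes> (y \<otimes> list_product A ys) = (x \<otimes> y) \<otimes> list_product A ys"
    using assms(1) c by (simp add: m_assoc)
  also have "\<dots> = y \<otimes> (x \<otimes> list_product A ys)"
    using assms(1) c Cons.prems(2)[of y] by (simp add: m_assoc)
  also have "\<dots> = (y \<otimes> list_product A ys) \<otimes> x"
    using Cons assms(1) c by (simp add: m_assoc)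
  finally show ?case
    by simp
qed (use assms(1) in \<open>simp add: l_one r_one\<close>)

text \<open>Repetitions of commuting idempotents are absorbed. This bridges to (T4), which is stated
  for lists without repetition.\<close>

lemma list_product_remdups:
  assumes "\<And>j. j \<in> set js \<Longrightarrow> c j \<in> carrier A" "\<And>j. j \<in> set js \<Longrightarrow> c j \<otimes> c j = c j"
    and "\<And>i j. \<lbrakk>i \<in> set js; j \<in> set js\<rbrakk> \<Longrightarrow> c i \<otimes> c j = c j \<otimes> c i"
  shows "list_product A (map c (remdups js)) = list_product A (map c js)"
proof -
  have absorb: "c j \<otimes> list_product A (map c ks) = list_product A (map c ks)"
    if "j \<in> set ks" "set ks \<subseteq> set js" for j ks
    using that
  proof (induction ks)
    case (Cons k ks)
    have c: "c k \<in> carrier A" "c j \<in> carrier A" "list_product A (map c ks) \<in> carrier A"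
      using Cons.prems by (auto intro!: list_product_closed assms(1))
    show ?case
    proof (cases "j = k")
      case True
      then show ?thesis
        using c Cons.prems assms(2)[of k] by (simp flip: m_assoc)
    next
      case False
      have "c j \<otimes> (c k \<otimes> list_product A (map c ks)) = (c j \<otimes> c k) \<otimes> list_product A (map c ks)"
        using c by (simp add: m_assoc)
      also have "c j \<otimes> c k = c k \<otimes> c j"
        using False Cons.prems by (intro assms(3)) auto
      also have "(c k \<otimes> c j) \<otimes> list_product A (map c ks) = c k \<otimes> (c j \<otimes> list_product A (map c ks))"
        using c by (simp add: m_assoc)
      finally show ?thesis
        using False Cons by simp
    qed
  qed simp
  have "list_product A (map c (remdups ks)) = list_product A (map c ks)" if "set ks \<subseteq> set js" for ks
    using that by (induction ks) (use absorb in auto)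
  then show ?thesis
    by simp
qed

end

text \<open>What (T1)-(T4) provide for neutral words, so that one norm estimate serves the universal
  and the reduced algebra. Indices are words, \<open>meet\<close> is concatenation and
  \<open>top\<close> the empty word; different indices may have the same set, and
  \<open>e_cong\<close> then identifies their projections.\<close>

locale projection_system = cstar_algebra A
  for A :: "('a, 'm) cstar_alg_scheme" (structure) +
  fixes W :: "'i set" and K :: "'i \<Rightarrow> 'x set" and meet :: "'i \<Rightarrow> 'i \<Rightarrow> 'i" and top :: 'i and e :: "'i \<Rightarrow> 'a"
  assumes e_closed: "i \<in> W \<Longrightarrow> e i \<in> carrier A"
    and e_star: "i \<in> W \<Longrightarrow> star A (e i) = e i"
    and meet_closed: "\<lbrakk>i \<in> W; j \<in> W\<rbrakk> \<Longrightarrow> meet i j \<in> W"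
    and K_meet: "\<lbrakk>i \<in> W; j \<in> W\<rbrakk> \<Longrightarrow> K (meet i j) = K i \<inter> K j"
    and e_meet: "\<lbrakk>i \<in> W; j \<in> W\<rbrakk> \<Longrightarrow> e (meet i j) = e i \<otimes> e j"
    and top_closed: "top \<in> W"
    and e_top: "e top = \<one>"
    and e_cong: "\<lbrakk>i \<in> W; j \<in> W; K i = K j\<rbrakk> \<Longrightarrow> e i = e j"
    and e_empty: "\<lbrakk>i \<in> W; K i = {}\<rbrakk> \<Longrightarrow> e i = \<zero>"
    and e_union: "\<lbrakk>i \<in> W; js \<in> lists W; distinct js; js \<noteq> []; K i = (\<Union>j\<in>set js. K j)\<rbrakk>
      \<Longrightarrow> list_product A (map (\<lambda>j. e i \<ominus> e j) js) = \<zero>"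
begin

text \<open>The indices \<open>meet i j\<close> and \<open>meet j i\<close> differ but have the same
  set, so \<open>e_cong\<close> makes the two products equal. Idempotence arises in the same way
  from \<open>meet i i\<close>.\<close>

lemma e_commute: "\<lbrakk>i \<in> W; j \<in> W\<rbrakk> \<Longrightarrow> e i \<otimes> e j = e j \<otimes> e i"
  using e_meet[of i j] e_meet[of j i] e_cong[of "meet i j" "meet j i"]
  by (simp add: meet_closed K_meet Int_commute)

lemma e_idem: "i \<in> W \<Longrightarrow> e i \<otimes> e i = e i"
  using e_meet[of i i] e_cong[of "meet i i" i] by (simp add: meet_closed K_meet)

abbreviation "ne j \<equiv> \<one> \<ominus> e j"

lemmas ne = complement_projection[OF e_closed e_idem e_star]

lemma ne_commute: "\<lbrakk>i \<in> W; j \<in> W\<rbrakk> \<Longrightarrow> e i \<otimes> ne j = ne j \<otimes> e i"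
  using e_commute[of i j] e_closed
  by (simp add: minus_eq_csmult l_distr r_distr smult_mult_left smult_mult_right l_one r_one)

text \<open>The projection belonging to \<open>K i - (\<Union>j\<in>set js. K j)\<close>.\<close>

definition atom :: "'i \<Rightarrow> 'i list \<Rightarrow> 'a" where
  "atom i js = e i \<otimes> list_product A (map ne js)"

lemma ne_product_closed: "js \<in> lists W \<Longrightarrow> list_product A (map ne js) \<in> carrier A"
  by (intro list_product_closed) (auto simp: ne(1))

lemma atom_closed: "\<lbrakk>i \<in> W; js \<in> lists W\<rbrakk> \<Longrightarrow> atom i js \<in> carrier A"
  unfolding atom_def by (intro m_closed e_closed ne_product_closed)

lemma e_ne_product_commute:
  "\<lbrakk>k \<in> W; js \<in> lists W\<rbrakk> \<Longrightarrow> e k \<otimes> list_product A (map ne js) = list_product A (map ne js) \<otimes> e k"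
  by (rule list_product_commute) (auto simp: e_closed ne(1) ne_commute)

lemma e_atom_commute: "\<lbrakk>k \<in> W; i \<in> W; js \<in> lists W\<rbrakk> \<Longrightarrow> e k \<otimes> atom i js = atom i js \<otimes> e k"
proof -
  assume k: "k \<in> W" and i: "i \<in> W" and js: "js \<in> lists W"
  note c = e_closed[OF k] e_closed[OF i] ne_product_closed[OF js]
  have "e k \<otimes> atom i js = (e k \<otimes> e i) \<otimes> list_product A (map ne js)"
    using c by (simp add: atom_def m_assoc)
  also have "\<dots> = e i \<otimes> (e k \<otimes> list_product A (map ne js))"
    using c e_commute[OF k i] by (simp add: m_assoc)
  also have "\<dots> = atom i js \<otimes> e k"
    using c e_ne_product_commute[OF k js] by (simp add: atom_def m_assoc)
  finally show ?thesis .
qed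

lemma e_mult_atom: "\<lbrakk>k \<in> W; i \<in> W; js \<in> lists W\<rbrakk> \<Longrightarrow> e k \<otimes> atom i js = atom (meet k i) js"
  unfolding atom_def using e_closed ne_product_closed by (simp add: e_meet m_assoc)

lemma ne_mult_atom: "\<lbrakk>k \<in> W; i \<in> W; js \<in> lists W\<rbrakk> \<Longrightarrow> ne k \<otimes> atom i js = atom i (k # js)"
  unfolding atom_def using e_closed ne_product_closed ne(1)[of k] ne_commute[of i k]
  by (simp flip: m_assoc)

lemma nrm_atom_le_one: "\<lbrakk>i \<in> W; js \<in> lists W\<rbrakk> \<Longrightarrow> nrm A (atom i js) \<le> 1"
proof -
  assume i: "i \<in> W" and js: "js \<in> lists W"
  have "nrm A (list_product A (map ne js)) \<le> 1"
    using js
  proof (induction js)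
    case Nil
    then show ?case
      using p_one_le by simp
  next
    case (Cons j js)
    then have j: "j \<in> W" and js: "js \<in> lists W"
      by auto
    have "nrm A (ne j \<otimes> list_product A (map ne js)) \<le> nrm A (ne j) * nrm A (list_product A (map ne js))"
      using ne(1)[OF j j j] ne_product_closed[OF js] by (intro p_mult)
    also have "\<dots> \<le> 1 * 1"
      using Cons.IH nrm_projection_le_one[OF ne(1-3)[OF j j j]] ne_product_closed[OF js]
      by (intro mult_mono) auto
    finally show ?case
      by simp
  qed
  moreover have "nrm A (e i) \<le> 1"
    using i by (intro nrm_projection_le_one e_closed e_idem e_star)
  ultimately have "nrm A (e i) * nrm A (list_product A (map ne js)) \<le> 1 * 1"
    using ne_product_closed[OF js] by (intro mult_mono) auto
  then show ?thesis
    using p_mult[OF e_closed[OF i] ne_product_closed[OF js]] by (simp add: atom_def)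
qed

text \<open>Replacing each j by \<open>meet i j\<close> shrinks the covering sets to subsets of
  \<open>K i\<close> whose union is exactly \<open>K i\<close>, as \<open>e_union\<close> demands;
  correspondingly e i times (1 - e j) is e i - e (meet i j). An empty list means an empty
  \<open>K i\<close> and is covered by \<open>e_empty\<close>.\<close>

lemma atom_eq_zero:
  assumes i: "i \<in> W" and js: "js \<in> lists W" and cover: "K i \<subseteq> (\<Union>j\<in>set js. K j)"
  shows "atom i js = \<zero>"
proof (cases "js = []")
  case True
  then have "e i = \<zero>"
    using cover i by (intro e_empty) auto
  then show ?thesis
    using True by (simp add: atom_def r_one)
next
  case False
  let ?c = "\<lambda>k. e i \<ominus> e k"
  let ?ks = "map (meet i) js"
  have W: "meet i j \<in> W" if "j \<in> set js" for j
    using i js that by (auto intro: meet_closed)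
  have cW: "?c k \<in> carrier A" if "k \<in> W" for k
    using e_closed[OF i] e_closed[OF that] by (simp add: minus_eq_csmult)
  have fac: "e i \<otimes> ne j = ?c (meet i j)" if "j \<in> W" for j
    using e_closed[OF i] e_closed[OF that] e_meet[OF i that]
    by (simp add: minus_eq_csmult r_distr smult_mult_right r_one)
  \<comment> \<open>Each factor contains a copy of e i; the copies commute past the complements and
    merge by idempotence.\<close>
  have "list_product A (map ?c ?ks) = e i \<otimes> list_product A (map ne js)"
    using False js
  proof (induction js rule: list_nonempty_induct)
    case (single j)
    then show ?case
      using fac[of j] e_closed[OF i] by (auto simp: r_one ne(1) cW meet_closed i)
  next
    case (cons j js)
    then have j: "j \<in> W" and js: "js \<in> lists W"
      by auto
    note c = e_closed[OF i] ne(1)[OF j j j] ne_product_closed[OF js]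
    have "list_product A (map ?c (map (meet i) (j # js))) = (e i \<otimes> ne j) \<otimes> (e i \<otimes> list_product A (map ne js))"
      using cons.IH[OF js] fac[OF j] by simp
    also have "\<dots> = e i \<otimes> ((ne j \<otimes> e i) \<otimes> list_product A (map ne js))"
      using c by (simp add: m_assoc m_closed)
    also have "\<dots> = (e i \<otimes> e i) \<otimes> (ne j \<otimes> list_product A (map ne js))"
      using c by (simp add: m_assoc m_closed flip: ne_commute[OF i j])
    finally show ?case
      using e_idem[OF i] by simp
  qed
  moreover have "list_product A (map ?c ?ks) = \<zero>"
  proof -
    \<comment> \<open>Because K k lies inside K i, the projection e k lies below e i.\<close>
    have ek: "e i \<otimes> e k = e k" "e k \<otimes> e i = e k" if "k \<in> set ?ks" for k
    proof -
      have k: "k \<in> W" "K k \<subseteq> K i"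
        using that W i js by (auto simp: K_meet)
      then have "e (meet i k) = e k"
        using i by (intro e_cong meet_closed) (auto simp: K_meet)
      then show "e i \<otimes> e k = e k" "e k \<otimes> e i = e k"
        using e_meet[OF i k(1)] e_commute[OF i k(1)] by auto
    qed
    have kW: "k \<in> W" if "k \<in> set ?ks" for k
      using that W by auto
    \<comment> \<open>From this expansion idempotence and commutation of the factors can be read
      off, the two conditions for dropping repetitions.\<close>
    have prod: "?c k \<otimes> ?c l = (e i \<ominus> e k) \<ominus> (e l \<ominus> e k \<otimes> e l)"
      if "k \<in> set ?ks" "l \<in> set ?ks" for k l
    proof -
      note c = e_closed[OF i] e_closed[OF kW[OF that(1)]] e_closed[OF kW[OF that(2)]]
      have "?c k \<otimes> ?c l = (e i \<otimes> e i \<oplus> (-1) \<odot> (e k \<otimes> e i)) \<oplus> ((-1) \<odot> (e i \<otimes> e l) \<oplus> e k \<otimes> e l)"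
        using c by (simp add: minus_eq_csmult l_distr r_distr smult_mult_left smult_mult_right
          csmult_assoc csmult_r_distr m_closed a_ac)
      also have "\<dots> = (e i \<oplus> (-1) \<odot> e k) \<oplus> ((-1) \<odot> e l \<oplus> e k \<otimes> e l)"
        using ek[OF that(1)] ek[OF that(2)] e_idem[OF i] by simp
      also have "\<dots> = (e i \<ominus> e k) \<ominus> (e l \<ominus> e k \<otimes> e l)"
        using c by (simp add: minus_eq_csmult csmult_r_distr csmult_assoc m_closed)
      finally show ?thesis .
    qed
    \<comment> \<open>Different j can yield the same index \<open>meet i j\<close>, whereas
      \<open>e_union\<close> takes a list of distinct indices.\<close>
    have "list_product A (map ?c (remdups ?ks)) = list_product A (map ?c ?ks)"
    proof (rule list_product_remdups)
      show "?c k \<otimes> ?c k = ?c k" if "k \<in> set ?ks" for k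
        unfolding prod[OF that that] using e_idem[OF kW[OF that]] e_closed[OF kW[OF that]] cW[OF kW[OF that]]
        by simp
      show "?c k \<otimes> ?c l = ?c l \<otimes> ?c k" if "k \<in> set ?ks" "l \<in> set ?ks" for k l
      proof -
        note c = e_closed[OF i] e_closed[OF kW[OF that(1)]] e_closed[OF kW[OF that(2)]]
        show ?thesis
          unfolding prod[OF that] prod[OF that(2,1)] e_commute[OF kW[OF that(2)] kW[OF that(1)]]
          using c by (simp add: minus_eq_csmult csmult_r_distr csmult_assoc m_closed a_ac)
      qed
    qed (use kW cW in blast)
    moreover have "list_product A (map ?c (remdups ?ks)) = \<zero>"
    proof (rule e_union[OF i])
      show "remdups ?ks \<in> lists W"
        using kW by auto
      show "K i = (\<Union>j\<in>set (remdups ?ks). K j)"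
        using cover js i by (auto simp: K_meet in_lists_conv_set)
    qed (use False in auto)
    ultimately show ?thesis
      by simp
  qed
  ultimately show ?thesis
    by (simp add: atom_def)
qed

text \<open>The function that the combination represents: the same coefficients with indicator
  functions in place of projections. In the reduced algebra the combination acts as multiplication
  by it.\<close>

definition symbol :: "(complex \<times> 'i) list \<Rightarrow> 'x \<Rightarrow> complex" where
  "symbol cs g = (\<Sum>(c, i)\<leftarrow>cs. if g \<in> K i then c else 0)"

text \<open>The induction splits along \<open>e k\<close> and \<open>1 - e k\<close> for the first term of the combination; on both
  halves this term is absorbed into the constant \<open>c\<close>.\<close>

lemma nrm_lincomb_atom_le:
  assumes "snd ` set cs \<subseteq> W" "i \<in> W" "js \<in> lists W" "0 \<le> M"
    and "\<And>g. \<lbrakk>g \<in> K i; g \<notin> (\<Union>j\<in>set js. K j)\<rbrakk> \<Longrightarrow> cmod (c + symbol cs g) \<le> M"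
  shows "nrm A ((c \<odot> \<one> \<oplus> lincomb A e cs) \<otimes> atom i js) \<le> M"
  using assms
proof (induction cs arbitrary: i js c)
  case Nil
  note q = atom_closed[OF Nil.prems(2,3)]
  show ?case
  proof (cases "K i \<subseteq> (\<Union>j\<in>set js. K j)")
    case True
    then show ?thesis
      using atom_eq_zero[OF Nil.prems(2,3)] Nil.prems(4) by (simp add: r_null)
  next
    case False
    \<comment> \<open>A point of K i outside all K j exists here, and at such a point the assumed
      bound concerns c alone.\<close>
    then have "cmod c \<le> M"
      using Nil.prems(5) by (auto simp: symbol_def)
    moreover have "nrm A ((c \<odot> \<one> \<oplus> \<zero>) \<otimes> atom i js) = cmod c * nrm A (atom i js)"
      using q by (simp add: r_zero smult_mult_left p_smult l_one)
    ultimately show ?thesis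
      using nrm_atom_le_one[OF Nil.prems(2,3)] mult_left_le[of "nrm A (atom i js)" "cmod c"] by simp
  qed
next
  case (Cons dk cs)
  obtain d k where dk: "dk = (d, k)"
    by (cases dk)
  have k: "k \<in> W" and cs: "snd ` set cs \<subseteq> W" and i: "i \<in> W" and js: "js \<in> lists W"
    using Cons.prems dk by auto
  let ?Y = "lincomb A e cs" and ?q = "atom i js"
  let ?X = "c \<odot> \<one> \<oplus> (d \<odot> e k \<oplus> ?Y)"
  have Y: "?Y \<in> carrier A"
    using e_closed cs by (rule lincomb_closed)
  note q = atom_closed[OF i js]
  note ek = e_closed[OF k]
  have X: "?X \<in> carrier A"
    using Y ek by simp
  have eY: "e k \<otimes> ?Y = ?Y \<otimes> e k"
    using cs
  proof (induction cs)
    case (Cons a cs)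
    obtain b l where a: "a = (b, l)"
      by (cases a)
    have "l \<in> W" "lincomb A e cs \<in> carrier A"
      using Cons.prems a lincomb_closed[where I = W and e = e and cs = cs] e_closed by auto
    then show ?case
      using Cons a ek e_closed[of l] e_commute[OF k, of l]
      by (simp add: l_distr r_distr smult_mult_left smult_mult_right)
  qed (use ek in \<open>simp add: l_null r_null\<close>)
  have eX: "e k \<otimes> ?X = ?X \<otimes> e k"
    using ek Y eY by (simp add: l_distr r_distr smult_mult_left smult_mult_right l_one r_one)
  have comm: "e k \<otimes> (?X \<otimes> ?q) = (?X \<otimes> ?q) \<otimes> e k"
    using eX e_atom_commute[OF k i js] ek X q by (metis m_assoc)
  have "nrm A (?X \<otimes> ?q) \<le> M"
  proof (rule nrm_split_projection[OF ek e_idem[OF k] e_star[OF k] _ comm])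
    let ?q1 = "atom (meet k i) js" and ?q2 = "atom i (k # js)"
    have q1: "?q1 = e k \<otimes> ?q" and q2: "?q2 = ne k \<otimes> ?q"
      using e_mult_atom[OF k i js] ne_mult_atom[OF k i js] by simp_all
    have c12: "?q1 \<in> carrier A" "?q2 \<in> carrier A" "ne k \<in> carrier A"
      using k i js by (auto intro!: atom_closed meet_closed simp: ne(1))
    have ekq1: "e k \<otimes> ?q1 = ?q1"
      unfolding q1 using ek q e_idem[OF k] by (simp flip: m_assoc)
    have "(?X \<otimes> ?q) \<otimes> e k = ?X \<otimes> ?q1"
      using e_atom_commute[OF k i js] X q ek by (simp add: q1 m_assoc)
    also have "\<dots> = ((c + d) \<odot> \<one> \<oplus> ?Y) \<otimes> ?q1"
      using c12 Y ek ekq1 by (simp add: l_distr smult_mult_left csmult_l_distr a_assoc l_one m_closed)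
    also have "nrm A \<dots> \<le> M"
    proof (rule Cons.IH[OF cs meet_closed[OF k i] js Cons.prems(4)])
      fix g assume "g \<in> K (meet k i)" "g \<notin> (\<Union>j\<in>set js. K j)"
      then show "cmod (c + d + symbol cs g) \<le> M"
        using Cons.prems(5)[of g] k i by (simp add: K_meet dk symbol_def add.assoc)
    qed
    finally show "nrm A ((?X \<otimes> ?q) \<otimes> e k) \<le> M" .
    have q_ne: "?q \<otimes> ne k = ?q2"
      unfolding q2 using e_atom_commute[OF k i js] q ek
      by (simp add: minus_eq_csmult l_distr r_distr smult_mult_left smult_mult_right l_one r_one)
    have ekq2: "e k \<otimes> ?q2 = \<zero>"
      unfolding q2 using ek q c12 ne(4)[OF k k k] by (simp add: l_null flip: m_assoc)
    have "(?X \<otimes> ?q) \<otimes> ne k = ?X \<otimes> ?q2"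
      using X q c12 q_ne by (simp add: m_assoc)
    also have "\<dots> = (c \<odot> \<one> \<oplus> ?Y) \<otimes> ?q2"
      using c12 Y ek ekq2 by (simp add: l_distr smult_mult_left l_zero l_one m_closed)
    also have "nrm A \<dots> \<le> M"
    proof (rule Cons.IH[OF cs i _ Cons.prems(4)])
      show "k # js \<in> lists W"
        using k js by simp
      fix g assume "g \<in> K i" "g \<notin> (\<Union>j\<in>set (k # js). K j)"
      then show "cmod (c + symbol cs g) \<le> M"
        using Cons.prems(5)[of g] by (simp add: dk symbol_def)
    qed
    finally show "nrm A ((?X \<otimes> ?q) \<otimes> ne k) \<le> M" .
  qed (use X q in \<open>simp add: m_closed\<close>)
  then show ?case
    by (simp add: dk)
qed

text \<open>The case of the constant 0 and of \<open>atom top []\<close>, which is the unit.\<close>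

lemma nrm_lincomb_le:
  assumes "snd ` set cs \<subseteq> W" "0 \<le> M" "\<And>g. g \<in> K top \<Longrightarrow> cmod (symbol cs g) \<le> M"
  shows "nrm A (lincomb A e cs) \<le> M"
proof -
  have "lincomb A e cs \<in> carrier A"
    using e_closed assms(1) by (rule lincomb_closed)
  then have "(0 \<odot> \<one> \<oplus> lincomb A e cs) \<otimes> atom top [] = lincomb A e cs"
    by (simp add: atom_def e_top l_one r_one l_zero)
  then show ?thesis
    using nrm_lincomb_atom_le[OF assms(1) top_closed, of "[]" M 0] assms(2,3) by simp
qed

end

section \<open>The free unital star algebra\<close>

lemma letters_zero [simp]: "letters 0 = []"
  by (simp add: zero_star_word_def)

lemma letters_plus [simp]: "letters (u + v) = letters u @ letters v"
  by (simp add: plus_star_word_def)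

lemma inj_reverse_star: "inj reverse_star"
  by (rule inj_on_inverseI[where g = reverse_star]) simp

lemma reverse_star_plus: "reverse_star (u + v) = reverse_star v + reverse_star u"
  by (simp add: reverse_star_def plus_star_word_def)

lemma reverse_star_zero [simp]: "reverse_star 0 = 0"
  by (simp add: reverse_star_def zero_star_word_def)

lemma letters_reverse_star: "letters (reverse_star u) = rev (map (\<lambda>(x, b). (x, \<not> b)) (letters u))"
  by (simp add: reverse_star_def)

lemma fst_letters_reverse_star: "fst ` set (letters (reverse_star u)) = fst ` set (letters u)"
  by (force simp: letters_reverse_star image_iff)

lemma poly_mapping_single_induct [case_names zero add]:
  fixes a :: "'a \<Rightarrow>\<^sub>0 'b::monoid_add"
  assumes "P 0"
    and "\<And>u c a. \<lbrakk>u \<notin> Poly_Mapping.keys a; c \<noteq> 0; P a\<rbrakk> \<Longrightarrow> P (Poly_Mapping.single u c + a)"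
  shows "P a"
proof (induction a rule: update_induct)
  case (update f u c)
  have "Poly_Mapping.update u c f = Poly_Mapping.single u c + f"
    using update(1) by (intro poly_mapping_eqI) (auto simp: Poly_Mapping.lookup_update lookup_add lookup_single in_keys_iff when_def)
  then show ?case
    using assms(2) update by simp
qed (rule assms)

lemma keys_single_plus:
  fixes a :: "'a \<Rightarrow>\<^sub>0 'b::monoid_add"
  assumes "u \<notin> Poly_Mapping.keys a" "c \<noteq> 0"
  shows "Poly_Mapping.keys (Poly_Mapping.single u c + a) = insert u (Poly_Mapping.keys a)"
  using assms by (auto simp: in_keys_iff lookup_add lookup_single when_def split: if_splits)

lemma free_star_algebra_simps [simp]:
  "mult (free_star_algebra X) = (*)" "one (free_star_algebra X) = 1"
  "zero (free_star_algebra X) = 0" "add (free_star_algebra X) = (+)"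
  "smult (free_star_algebra X) c a = Poly_Mapping.single 0 c * a"
  "star (free_star_algebra X) a = Poly_Mapping.map cnj (Poly_Mapping.map_key reverse_star a)"
  by (simp_all add: free_star_algebra_def)

lemma carrier_free_star_algebra:
  "a \<in> carrier (free_star_algebra X) \<longleftrightarrow> (\<forall>u\<in>Poly_Mapping.keys a. fst ` set (letters u) \<subseteq> X)"
  by (simp add: free_star_algebra_def)

lemma lookup_free_star:
  "Poly_Mapping.lookup (Poly_Mapping.map cnj (Poly_Mapping.map_key reverse_star a)) u =
     cnj (Poly_Mapping.lookup a (reverse_star u))"
  by (simp add: map.rep_eq map_key.rep_eq[OF inj_reverse_star] when_def)

abbreviation free_star :: "('x star_word \<Rightarrow>\<^sub>0 complex) \<Rightarrow> ('x star_word \<Rightarrow>\<^sub>0 complex)" where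
  "free_star a \<equiv> Poly_Mapping.map cnj (Poly_Mapping.map_key reverse_star a)"

lemma free_star_add: "free_star (a + b) = free_star a + free_star b"
  by (rule poly_mapping_eqI) (simp add: lookup_free_star lookup_add)

lemma free_star_zero: "free_star 0 = 0"
  by (rule poly_mapping_eqI) (simp add: lookup_free_star)

lemma free_star_single: "free_star (Poly_Mapping.single u c) = Poly_Mapping.single (reverse_star u) (cnj c)"
  by (rule poly_mapping_eqI) (auto simp: lookup_free_star lookup_single when_def)

lemma free_star_free_star: "free_star (free_star a) = a"
  by (rule poly_mapping_eqI) (simp add: lookup_free_star)

text \<open>Both sides are additive in each argument, so two inductions reduce the claim to single
  words, where reversal turns a concatenation around.\<close>

lemma free_star_mult: "free_star (a * b) = free_star b * free_star a"
proof (induction a rule: poly_mapping_single_induct)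
  case zero
  then show ?case
    by (simp add: free_star_zero)
next
  case (add u c a)
  have "free_star (Poly_Mapping.single u c * b) = free_star b * free_star (Poly_Mapping.single u c)"
  proof (induction b rule: poly_mapping_single_induct)
    case zero
    then show ?case
      by (simp add: free_star_zero)
  next
    case (add v d b)
    then show ?case
      by (simp add: distrib_left distrib_right free_star_add free_star_single mult_single reverse_star_plus mult.commute)
  qed
  with add show ?case
    by (simp add: distrib_left distrib_right free_star_add)
qed

text \<open>Scalars act in the free algebra as multiples of the empty word; their centrality is the
  compatibility of scalars with the right factor of a product.\<close>

lemma single_zero_central: "a * Poly_Mapping.single 0 c = Poly_Mapping.single (0 :: 'x star_word) (c :: complex) * a"
  by (induction a rule: poly_mapping_single_induct) (simp_all add: distrib_left distrib_right mult_single mult.commute)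

lemma keys_free_star: "Poly_Mapping.keys (free_star a) = reverse_star ` Poly_Mapping.keys a"
proof (intro equalityI subsetI)
  show "u \<in> reverse_star ` Poly_Mapping.keys a" if "u \<in> Poly_Mapping.keys (free_star a)" for u
    using that by (intro image_eqI[of _ _ "reverse_star u"]) (simp_all add: in_keys_iff lookup_free_star)
qed (auto simp: in_keys_iff lookup_free_star)

lemma star_algebra_free: "star_algebra (free_star_algebra X)"
proof (rule star_algebraI)
  show add: "a \<oplus>\<^bsub>free_star_algebra X\<^esub> b \<in> carrier (free_star_algebra X)"
    if "a \<in> carrier (free_star_algebra X)" "b \<in> carrier (free_star_algebra X)" for a b
    using that keys_add[of a b] by (auto simp: carrier_free_star_algebra)
  show mult: "a \<otimes>\<^bsub>free_star_algebra X\<^esub> b \<in> carrier (free_star_algebra X)"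
    if "a \<in> carrier (free_star_algebra X)" "b \<in> carrier (free_star_algebra X)" for a b
    unfolding carrier_free_star_algebra
  proof
    fix u assume "u \<in> Poly_Mapping.keys (a \<otimes>\<^bsub>free_star_algebra X\<^esub> b)"
    then obtain v w where "u = v + w" "v \<in> Poly_Mapping.keys a" "w \<in> Poly_Mapping.keys b"
      using keys_mult[of a b] by auto
    then show "fst ` set (letters u) \<subseteq> X"
      using that unfolding carrier_free_star_algebra by (simp add: image_Un)
  qed
  show "c \<odot>\<^bsub>free_star_algebra X\<^esub> a \<in> carrier (free_star_algebra X)"
    if "a \<in> carrier (free_star_algebra X)" for c a
  proof -
    have "Poly_Mapping.single 0 c \<in> carrier (free_star_algebra X)"
      by (simp add: carrier_free_star_algebra)
    from mult[OF this that] show ?thesis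
      by simp
  qed
  show "star (free_star_algebra X) a \<in> carrier (free_star_algebra X)"
    if "a \<in> carrier (free_star_algebra X)" for a
    using that by (auto simp: carrier_free_star_algebra keys_free_star fst_letters_reverse_star)
  show "(c * d) \<odot>\<^bsub>free_star_algebra X\<^esub> a = c \<odot>\<^bsub>free_star_algebra X\<^esub> (d \<odot>\<^bsub>free_star_algebra X\<^esub> a)" for c d a
    by (simp add: mult_single flip: mult.assoc)
  show "a \<otimes>\<^bsub>free_star_algebra X\<^esub> (c \<odot>\<^bsub>free_star_algebra X\<^esub> b) = c \<odot>\<^bsub>free_star_algebra X\<^esub> (a \<otimes>\<^bsub>free_star_algebra X\<^esub> b)" for c a b
    by (simp add: single_zero_central flip: mult.assoc)
  show "star (free_star_algebra X) (c \<odot>\<^bsub>free_star_algebra X\<^esub> a) = cnj c \<odot>\<^bsub>free_star_algebra X\<^esub> star (free_star_algebra X) a" for c a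
    by (simp add: free_star_mult free_star_single single_zero_central)
qed (simp_all add: carrier_free_star_algebra add.assoc add.commute mult.assoc distrib_left distrib_right
    single_add free_star_add free_star_mult free_star_free_star)

lemma free_star_algebra_induct [consumes 1, case_names zero add]:
  assumes "a \<in> carrier (free_star_algebra X)" and "P 0"
    and "\<And>u c a. \<lbrakk>fst ` set (letters u) \<subseteq> X; u \<notin> Poly_Mapping.keys a; a \<in> carrier (free_star_algebra X); P a\<rbrakk>
      \<Longrightarrow> P (Poly_Mapping.single u c + a)"
  shows "P a"
  using assms(1)
proof (induction a rule: poly_mapping_single_induct)
  case (add u c a)
  then show ?case
    using assms(3) by (simp add: carrier_free_star_algebra keys_single_plus)
qed (rule assms)

lemma single_in_free: "fst ` set (letters u) \<subseteq> X \<Longrightarrow> Poly_Mapping.single u c \<in> carrier (free_star_algebra X)"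
  by (auto simp: carrier_free_star_algebra)

lemma free_gen_in_free: "x \<in> X \<Longrightarrow> free_gen x \<in> carrier (free_star_algebra X)"
  by (simp add: free_gen_def single_in_free)

section \<open>Evaluation of the free star algebra\<close>

context star_algebra
begin

definition letter_value :: "('x \<Rightarrow> 'a) \<Rightarrow> 'x \<times> bool \<Rightarrow> 'a" where
  "letter_value w = (\<lambda>(x, b). if b then star A (w x) else w x)"

definition word_value :: "('x \<Rightarrow> 'a) \<Rightarrow> 'x star_word \<Rightarrow> 'a" where
  "word_value w u = list_product A (map (letter_value w) (letters u))"

definition free_eval :: "('x \<Rightarrow> 'a) \<Rightarrow> ('x star_word \<Rightarrow>\<^sub>0 complex) \<Rightarrow> 'a" where
  "free_eval w a = finsum A (\<lambda>u. Poly_Mapping.lookup a u \<odot> word_value w u) (Poly_Mapping.keys a)"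

lemma list_product_append:
  "\<lbrakk>set xs \<subseteq> carrier A; set ys \<subseteq> carrier A\<rbrakk> \<Longrightarrow>
    list_product A (xs @ ys) = list_product A xs \<otimes> list_product A ys"
  by (induction xs) (simp_all add: l_one m_assoc)

lemma star_list_product:
  "set xs \<subseteq> carrier A \<Longrightarrow> star A (list_product A xs) = list_product A (rev (map (star A) xs))"
proof (induction xs)
  case (Cons x xs)
  then have "set (rev (map (star A) xs)) \<subseteq> carrier A" "star A x \<in> carrier A"
    by (auto simp: subset_iff)
  then show ?case
    using Cons list_product_append[of "rev (map (star A) xs)" "[star A x]"]
    by (simp add: star_mult list_product_closed r_one)
qed simp

context
  fixes w :: "'x \<Rightarrow> 'a" and X :: "'x set"
  assumes w: "\<And>x. x \<in> X \<Longrightarrow> w x \<in> carrier A"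
begin

lemma letter_value_closed: "fst x \<in> X \<Longrightarrow> letter_value w x \<in> carrier A"
  using w by (cases x) (auto simp: letter_value_def)

lemma letter_values_closed:
  "fst ` set (letters u) \<subseteq> X \<Longrightarrow> set (map (letter_value w) (letters u)) \<subseteq> carrier A"
  using letter_value_closed by fastforce

lemma word_value_closed: "fst ` set (letters u) \<subseteq> X \<Longrightarrow> word_value w u \<in> carrier A"
  unfolding word_value_def by (intro list_product_closed letter_values_closed)

lemma word_value_plus:
  "\<lbrakk>fst ` set (letters u) \<subseteq> X; fst ` set (letters v) \<subseteq> X\<rbrakk> \<Longrightarrow>
    word_value w (u + v) = word_value w u \<otimes> word_value w v"
  using letter_values_closed[of u] letter_values_closed[of v] by (simp add: word_value_def list_product_append)

lemma word_value_reverse_star: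
  assumes u: "fst ` set (letters u) \<subseteq> X"
  shows "word_value w (reverse_star u) = star A (word_value w u)"
proof -
  have "letter_value w (case xb of (x, b) \<Rightarrow> (x, \<not> b)) = star A (letter_value w xb)"
    if "xb \<in> set (letters u)" for xb
  proof -
    have "fst xb \<in> X"
      using that u by auto
    then show ?thesis
      using w by (cases xb) (simp add: letter_value_def)
  qed
  then have "map (letter_value w) (map (\<lambda>(x, b). (x, \<not> b)) (letters u)) = map (star A) (map (letter_value w) (letters u))"
    by simp
  then show ?thesis
    unfolding word_value_def letters_reverse_star rev_map[symmetric] star_list_product[OF letter_values_closed[OF u]]
    by (simp only:)
qed

text \<open>Cancellation may shrink the support of a sum, so evaluations are compared over a common
  finite set of words.\<close>

lemma free_eval_superset:
  assumes a: "a \<in> carrier (free_star_algebra X)" and F: "finite F" "Poly_Mapping.keys a \<subseteq> F"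
    "\<And>u. u \<in> F \<Longrightarrow> fst ` set (letters u) \<subseteq> X"
  shows "free_eval w a = finsum A (\<lambda>u. Poly_Mapping.lookup a u \<odot> word_value w u) F"
  unfolding free_eval_def finsum_def
  by (rule comm_monoid.finprod_mono_neutral_cong_left[OF abelian_monoid.a_comm_monoid[OF abelian_monoid_A]])
    (use F word_value_closed in \<open>auto simp: in_keys_iff\<close>)

lemma free_eval_add:
  assumes a: "a \<in> carrier (free_star_algebra X)" and b: "b \<in> carrier (free_star_algebra X)"
  shows "free_eval w (a + b) = free_eval w a \<oplus> free_eval w b"
proof -
  let ?F = "Poly_Mapping.keys a \<union> Poly_Mapping.keys b"
  have F: "fst ` set (letters u) \<subseteq> X" if "u \<in> ?F" for u
    using a b that unfolding carrier_free_star_algebra by blast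
  have ab: "a + b \<in> carrier (free_star_algebra X)"
    using abelian_monoid.a_closed[OF star_algebra.abelian_monoid_A[OF star_algebra_free[of X]] a b] by simp
  have "free_eval w (a + b) = finsum A (\<lambda>u. Poly_Mapping.lookup (a + b) u \<odot> word_value w u) ?F"
    by (rule free_eval_superset[OF ab]) (use F keys_add[of a b] in auto)
  also have "\<dots> = finsum A (\<lambda>u. Poly_Mapping.lookup a u \<odot> word_value w u \<oplus> Poly_Mapping.lookup b u \<odot> word_value w u) ?F"
    using F word_value_closed
    by (intro abelian_monoid.finsum_cong'[OF abelian_monoid_A] refl) (auto simp: lookup_add csmult_l_distr)
  also have "\<dots> = finsum A (\<lambda>u. Poly_Mapping.lookup a u \<odot> word_value w u) ?F
      \<oplus> finsum A (\<lambda>u. Poly_Mapping.lookup b u \<odot> word_value w u) ?F"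
    using F word_value_closed by (intro abelian_monoid.finsum_addf[OF abelian_monoid_A]) auto
  also have "finsum A (\<lambda>u. Poly_Mapping.lookup a u \<odot> word_value w u) ?F = free_eval w a"
    by (rule free_eval_superset[OF a, symmetric]) (use F in auto)
  also have "finsum A (\<lambda>u. Poly_Mapping.lookup b u \<odot> word_value w u) ?F = free_eval w b"
    by (rule free_eval_superset[OF b, symmetric]) (use F in auto)
  finally show ?thesis .
qed

lemma free_eval_zero: "free_eval w 0 = \<zero>"
  unfolding free_eval_def by (simp add: abelian_monoid.finsum_empty[OF abelian_monoid_A])

lemma free_eval_single:
  assumes u: "fst ` set (letters u) \<subseteq> X"
  shows "free_eval w (Poly_Mapping.single u c) = c \<odot> word_value w u"
proof -
  have "free_eval w (Poly_Mapping.single u c) =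
      finsum A (\<lambda>v. Poly_Mapping.lookup (Poly_Mapping.single u c) v \<odot> word_value w v) {u}"
    by (rule free_eval_superset) (use u single_in_free in auto)
  also have "\<dots> = c \<odot> word_value w u"
    using abelian_monoid.finsum_insert[OF abelian_monoid_A, of "{}" u
        "\<lambda>v. Poly_Mapping.lookup (Poly_Mapping.single u c) v \<odot> word_value w v"]
      word_value_closed[OF u]
    by (simp add: abelian_monoid.finsum_empty[OF abelian_monoid_A] r_zero)
  finally show ?thesis .
qed

lemma free_eval_closed: "a \<in> carrier (free_star_algebra X) \<Longrightarrow> free_eval w a \<in> carrier A"
  by (induction a rule: free_star_algebra_induct)
    (auto simp: free_eval_zero free_eval_add free_eval_single single_in_free word_value_closed)

lemma free_eval_mult:
  assumes a: "a \<in> carrier (free_star_algebra X)" and b: "b \<in> carrier (free_star_algebra X)"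
  shows "free_eval w (a * b) = free_eval w a \<otimes> free_eval w b"
proof -
  interpret F: star_algebra "free_star_algebra X"
    by (rule star_algebra_free)
  have Fm: "a * b \<in> carrier (free_star_algebra X)"
    if "a \<in> carrier (free_star_algebra X)" "b \<in> carrier (free_star_algebra X)" for a b
    using F.m_closed[OF that] by simp
  have single: "free_eval w (Poly_Mapping.single u c * b) = free_eval w (Poly_Mapping.single u c) \<otimes> free_eval w b"
    if u: "fst ` set (letters u) \<subseteq> X" for u c
    using b
  proof (induction b rule: free_star_algebra_induct)
    case zero
    then show ?case
      using word_value_closed[OF u] by (simp add: free_eval_zero free_eval_single u r_null)
  next
    case (add v d b)
    have uv: "fst ` set (letters (u + v)) \<subseteq> X"
      using u add(1) by auto
    have "free_eval w (Poly_Mapping.single u c * (Poly_Mapping.single v d + b)) =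
        free_eval w (Poly_Mapping.single (u + v) (c * d)) \<oplus> free_eval w (Poly_Mapping.single u c * b)"
      using single_in_free[OF uv] Fm[OF single_in_free[OF u] add(3)]
      by (simp add: distrib_left mult_single free_eval_add)
    also have "free_eval w (Poly_Mapping.single (u + v) (c * d)) =
        free_eval w (Poly_Mapping.single u c) \<otimes> free_eval w (Poly_Mapping.single v d)"
      using u add(1) word_value_closed[OF u] word_value_closed[OF add(1)]
      by (simp only: free_eval_single uv)
        (simp add: word_value_plus smult_mult_left smult_mult_right csmult_assoc m_closed mult.commute)
    finally show ?case
      using u add free_eval_closed[OF add(3)] word_value_closed[OF u] word_value_closed[OF add(1)]
      by (simp add: free_eval_add single_in_free free_eval_single r_distr)
  qed
  show ?thesis
    using a
  proof (induction a rule: free_star_algebra_induct)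
    case zero
    then show ?case
      using free_eval_closed[OF b] by (simp add: free_eval_zero l_null)
  next
    case (add u c a)
    then show ?case
      using Fm[OF single_in_free[OF add(1)] b] Fm[OF add(3) b] free_eval_closed[OF b] free_eval_closed[OF add(3)]
        free_eval_closed[OF single_in_free[OF add(1)]] single[OF add(1)]
      by (simp add: distrib_right free_eval_add single_in_free l_distr)
  qed
qed

lemma free_eval_star:
  "a \<in> carrier (free_star_algebra X) \<Longrightarrow> free_eval w (free_star a) = star A (free_eval w a)"
proof (induction a rule: free_star_algebra_induct)
  case (add u c a)
  interpret F: star_algebra "free_star_algebra X"
    by (rule star_algebra_free)
  have "fst ` set (letters (reverse_star u)) \<subseteq> X" "free_star a \<in> carrier (free_star_algebra X)"
    using add(1) F.star_closed[OF add(3)] by (simp_all add: fst_letters_reverse_star)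
  then show ?case
    using add word_value_closed[OF add(1)] free_eval_closed[OF add(3)]
    by (simp add: free_star_add free_star_single free_eval_add single_in_free free_eval_single
        star_add star_smult word_value_reverse_star)
qed (simp add: free_star_zero free_eval_zero)

lemma free_eval_one: "free_eval w 1 = \<one>"
  using free_eval_single[of 0 1] by (simp add: word_value_def single_one)

lemma free_eval_hom: "unital_star_hom (free_star_algebra X) A (free_eval w)"
  unfolding unital_star_hom_def ring_hom_def
proof (intro conjI CollectI allI ballI)
  fix c a assume a: "a \<in> carrier (free_star_algebra X)"
  have "free_eval w (Poly_Mapping.single 0 c * a) = (c \<odot> \<one>) \<otimes> free_eval w a"
    using free_eval_mult[OF single_in_free a, of 0 c] free_eval_single[of 0 c] by (simp add: word_value_def)
  then show "free_eval w (c \<odot>\<^bsub>free_star_algebra X\<^esub> a) = c \<odot> free_eval w a"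
    using free_eval_closed[OF a] by (simp add: smult_mult_left l_one)
qed (simp_all add: free_eval_closed free_eval_mult free_eval_add free_eval_one free_eval_star)

lemma free_eval_gen: "x \<in> X \<Longrightarrow> free_eval w (free_gen x) = w x"
  using free_eval_single[of "Star_Word [(x, False)]" 1] w
  by (simp add: free_gen_def word_value_def letter_value_def r_one)

end

end

text \<open>Agreement spreads from the generators to their stars, then to words by multiplicativity
  and to combinations by linearity.\<close>

lemma free_hom_unique:
  assumes B: "star_algebra B" and f: "unital_star_hom (free_star_algebra X) B f"
    and g: "unital_star_hom (free_star_algebra X) B g"
    and gen: "\<And>x. x \<in> X \<Longrightarrow> f (free_gen x) = g (free_gen x)"
    and a: "a \<in> carrier (free_star_algebra X)"
  shows "f a = g a"
proof -
  interpret F: star_algebra "free_star_algebra X"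
    by (rule star_algebra_free)
  interpret B: star_algebra B by fact
  interpret f: star_hom "free_star_algebra X" B f
    using f by (intro star_homI F.star_algebra_axioms B)
  interpret g: star_hom "free_star_algebra X" B g
    using g by (intro star_homI F.star_algebra_axioms B)
  have word: "f (Poly_Mapping.single (Star_Word l) 1) = g (Poly_Mapping.single (Star_Word l) 1)"
    if "fst ` set l \<subseteq> X" for l
    using that
  proof (induction l)
    case Nil
    then show ?case
      using f.hom_one g.hom_one by (simp flip: zero_star_word_def)
  next
    case (Cons xb l)
    obtain x b where xb: "xb = (x, b)"
      by (cases xb)
    have x: "x \<in> X"
      using Cons.prems xb by simp
    have star: "Poly_Mapping.single (Star_Word [(x, True)]) 1 = star (free_star_algebra X) (free_gen x)"
      by (simp add: free_gen_def free_star_single reverse_star_def)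
    have letter: "f (Poly_Mapping.single (Star_Word [xb]) 1) = g (Poly_Mapping.single (Star_Word [xb]) 1)"
    proof (cases b)
      case True
      then show ?thesis
        unfolding xb using gen[OF x] f.hom_star[OF free_gen_in_free[OF x]] g.hom_star[OF free_gen_in_free[OF x]] star
        by simp
    next
      case False
      then show ?thesis
        using gen[OF x] by (simp add: xb free_gen_def)
    qed
    have split: "Poly_Mapping.single (Star_Word (xb # l)) 1 =
        Poly_Mapping.single (Star_Word [xb]) 1 \<otimes>\<^bsub>free_star_algebra X\<^esub> Poly_Mapping.single (Star_Word l) (1 :: complex)"
      by (simp add: mult_single plus_star_word_def)
    have c: "Poly_Mapping.single (Star_Word [xb]) 1 \<in> carrier (free_star_algebra X)"
      "Poly_Mapping.single (Star_Word l) 1 \<in> carrier (free_star_algebra X)"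
      using Cons.prems by (simp_all add: single_in_free)
    show ?case
      unfolding split using Cons.prems
      by (simp only: f.hom_mult[OF c] g.hom_mult[OF c] letter) (simp add: Cons.IH)
  qed
  have single: "f (Poly_Mapping.single u c) = g (Poly_Mapping.single u c)" if u: "fst ` set (letters u) \<subseteq> X" for u c
  proof -
    have eq: "Poly_Mapping.single u c = c \<odot>\<^bsub>free_star_algebra X\<^esub> Poly_Mapping.single u 1"
      by (simp add: mult_single)
    have "f (Poly_Mapping.single u 1) = g (Poly_Mapping.single u 1)"
      using word[of "letters u"] u by simp
    then show ?thesis
      unfolding eq using f.hom_smult[OF single_in_free[OF u]] g.hom_smult[OF single_in_free[OF u]] by simp
  qed
  show ?thesis
    using a
  proof (induction a rule: free_star_algebra_induct)
    case zero
    then show ?case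
      using f.hom_zero g.hom_zero by simp
  next
    case (add u c a)
    then show ?case
      using f.hom_add[OF single_in_free[OF add(1)] add(3)] g.hom_add[OF single_in_free[OF add(1)] add(3)] single[OF add(1)]
      by simp
  qed
qed

section \<open>The universal seminorm\<close>

text \<open>The bound on the generators makes the universal seminorm finite: every word then has
  seminorm at most 1, and the sum of the moduli of the coefficients of an element bounds all
  admissible seminorms at once.\<close>

locale universal_relations =
  fixes X :: "'x set" and R :: "('x star_word \<Rightarrow>\<^sub>0 complex) set"
  assumes gen_le_one: "\<lbrakk>cstar_seminorm (free_star_algebra X) p; \<forall>r\<in>R. p r = 0; x \<in> X\<rbrakk> \<Longrightarrow> p (free_gen x) \<le> 1"
    and relations_closed: "R \<subseteq> carrier (free_star_algebra X)"
begin

abbreviation "\<F> \<equiv> free_star_algebra X"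
abbreviation "\<U> \<equiv> universal_seminorm X R"
abbreviation "seminorms \<equiv> {p. cstar_seminorm \<F> p \<and> (\<forall>r\<in>R. p r = 0)}"

lemma seminormed: "p \<in> seminorms \<Longrightarrow> seminormed_star_algebra \<F> p"
  by (simp add: seminormed_star_algebra_def seminormed_star_algebra_axioms_def star_algebra_free)

text \<open>The zero seminorm keeps the supremum away from the empty family and accounts for its
  nonnegativity.\<close>

lemma seminorms_nonempty: "(\<lambda>a. 0) \<in> seminorms"
  by (simp add: cstar_seminorm_def)

lemma seminorm_single_le:
  assumes p: "p \<in> seminorms" and u: "fst ` set (letters u) \<subseteq> X"
  shows "p (Poly_Mapping.single u c) \<le> cmod c"
proof -
  interpret seminormed_star_algebra \<F> p
    using p by (rule seminormed)
  have "p (Poly_Mapping.single (Star_Word l) 1) \<le> 1" if "fst ` set l \<subseteq> X" for l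
    using that
  proof (induction l)
    case Nil
    then show ?case
      using p_one_le by (simp flip: zero_star_word_def)
  next
    case (Cons xb l)
    obtain x b where xb: "xb = (x, b)"
      by (cases xb)
    have x: "x \<in> X"
      using Cons.prems xb by simp
    have star: "Poly_Mapping.single (Star_Word [(x, True)]) 1 = star (free_star_algebra X) (free_gen x)"
      by (simp add: free_gen_def free_star_single reverse_star_def)
    have le: "p (free_gen x) \<le> 1"
      using p x by (intro gen_le_one) auto
    have letter: "p (Poly_Mapping.single (Star_Word [xb]) 1) \<le> 1"
    proof (cases b)
      case True
      then show ?thesis
        using le p_star[OF free_gen_in_free[OF x]] star xb by simp
    next
      case False
      then show ?thesis
        using le by (simp add: xb free_gen_def)
    qed
    have split: "Poly_Mapping.single (Star_Word (xb # l)) 1 =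
        Poly_Mapping.single (Star_Word [xb]) 1 \<otimes>\<^bsub>\<F>\<^esub> Poly_Mapping.single (Star_Word l) (1 :: complex)"
      by (simp add: mult_single plus_star_word_def)
    have c: "Poly_Mapping.single (Star_Word [xb]) 1 \<in> carrier \<F>"
      "Poly_Mapping.single (Star_Word l) 1 \<in> carrier \<F>"
      using Cons.prems by (simp_all add: single_in_free)
    have "p (Poly_Mapping.single (Star_Word (xb # l)) 1) \<le> 1 * 1"
      unfolding split
    proof (rule order_trans[OF p_mult[OF c] mult_mono])
      show "p (Poly_Mapping.single (Star_Word l) 1) \<le> 1"
        using Cons by simp
    qed (use letter p_nonneg[OF c(2)] in simp_all)
    then show ?case
      by simp
  qed
  then have le: "p (Poly_Mapping.single u 1) \<le> 1"
    using u by (metis star_word.collapse)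
  have "Poly_Mapping.single u c = c \<odot>\<^bsub>\<F>\<^esub> Poly_Mapping.single u 1"
    by (simp add: mult_single)
  then have "p (Poly_Mapping.single u c) = cmod c * p (Poly_Mapping.single u 1)"
    using p_smult[OF single_in_free[OF u]] by metis
  then show ?thesis
    using le mult_left_le[of "p (Poly_Mapping.single u 1)" "cmod c"] by simp
qed

lemma bdd_above_seminorms:
  assumes a: "a \<in> carrier \<F>"
  shows "bdd_above ((\<lambda>p. p a) ` seminorms)"
proof -
  have "\<exists>C. \<forall>p\<in>seminorms. p a \<le> C"
    using a
  proof (induction a rule: free_star_algebra_induct)
    case zero
    have "p 0 \<le> 0" if p: "p \<in> seminorms" for p
      using seminormed_star_algebra.p_zero[OF seminormed[OF p]] by simp
    then show ?case
      by blast
  next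
    case (add u c a)
    then obtain C where C: "\<forall>p\<in>seminorms. p a \<le> C"
      by blast
    have "p (Poly_Mapping.single u c + a) \<le> cmod c + C" if p: "p \<in> seminorms" for p
      using seminormed_star_algebra.p_triangle[OF seminormed[OF p] single_in_free[OF add(1), of c] add(3)]
        seminorm_single_le[OF p add(1), of c] bspec[OF C p]
      by simp
    then show ?case
      by blast
  qed
  then obtain C where "\<forall>p\<in>seminorms. p a \<le> C"
    by blast
  then show ?thesis
    by (intro bdd_aboveI2[where M = C]) blast
qed

lemma seminorm_le_universal: "\<lbrakk>p \<in> seminorms; a \<in> carrier \<F>\<rbrakk> \<Longrightarrow> p a \<le> \<U> a"
  unfolding universal_seminorm_def by (rule cSUP_upper[OF _ bdd_above_seminorms])

lemma universal_le: "(\<And>p. p \<in> seminorms \<Longrightarrow> p a \<le> C) \<Longrightarrow> \<U> a \<le> C"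
  unfolding universal_seminorm_def using seminorms_nonempty by (intro cSUP_least) auto

lemma universal_relation: "r \<in> R \<Longrightarrow> \<U> r = 0"
  using relations_closed seminorm_le_universal[OF seminorms_nonempty, of r] universal_le[of r 0]
  by (auto intro: antisym)

lemma cstar_seminorm_universal: "cstar_seminorm \<F> \<U>"
proof -
  interpret F: star_algebra \<F>
    by (rule star_algebra_free)
  have nonneg: "0 \<le> \<U> a" if "a \<in> carrier \<F>" for a
    using seminorm_le_universal[OF seminorms_nonempty that] .
  have tri: "\<U> (a \<oplus>\<^bsub>\<F>\<^esub> b) \<le> \<U> a + \<U> b" if a: "a \<in> carrier \<F>" and b: "b \<in> carrier \<F>" for a b
  proof (rule universal_le)
    fix p assume p: "p \<in> seminorms"
    show "p (a \<oplus>\<^bsub>\<F>\<^esub> b) \<le> \<U> a + \<U> b"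
      using seminormed_star_algebra.p_triangle[OF seminormed[OF p] a b]
        seminorm_le_universal[OF p a] seminorm_le_universal[OF p b] by linarith
  qed
  have smult_le: "\<U> (c \<odot>\<^bsub>\<F>\<^esub> a) \<le> cmod c * \<U> a" if a: "a \<in> carrier \<F>" for c a
  proof (rule universal_le)
    fix p assume p: "p \<in> seminorms"
    show "p (c \<odot>\<^bsub>\<F>\<^esub> a) \<le> cmod c * \<U> a"
      using seminormed_star_algebra.p_smult[OF seminormed[OF p] a, of c]
        mult_left_mono[OF seminorm_le_universal[OF p a], of "cmod c"] by simp
  qed
  have smult: "\<U> (c \<odot>\<^bsub>\<F>\<^esub> a) = cmod c * \<U> a" if a: "a \<in> carrier \<F>" for c a
  proof (cases "c = 0")
    case True
    then show ?thesis
      using smult_le[OF a, of c] nonneg[OF F.csmult_closed[OF a], of c] by simp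
  next
    case False
    have "inverse c \<odot>\<^bsub>\<F>\<^esub> (c \<odot>\<^bsub>\<F>\<^esub> a) = a"
      using F.csmult_assoc[OF a, of "inverse c" c] F.csmult_one[OF a] False by simp
    then have "\<U> a \<le> inverse (cmod c) * \<U> (c \<odot>\<^bsub>\<F>\<^esub> a)"
      using smult_le[OF F.csmult_closed[OF a], of "inverse c" c] by (simp add: norm_inverse)
    then have "cmod c * \<U> a \<le> \<U> (c \<odot>\<^bsub>\<F>\<^esub> a)"
      using False by (simp add: field_simps)
    then show ?thesis
      using smult_le[OF a, of c] by simp
  qed
  have mult: "\<U> (a \<otimes>\<^bsub>\<F>\<^esub> b) \<le> \<U> a * \<U> b" if a: "a \<in> carrier \<F>" and b: "b \<in> carrier \<F>" for a b
  proof (rule universal_le)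
    fix p assume p: "p \<in> seminorms"
    have "p (a \<otimes>\<^bsub>\<F>\<^esub> b) \<le> p a * p b"
      using seminormed_star_algebra.p_mult[OF seminormed[OF p] a b] .
    also have "\<dots> \<le> \<U> a * \<U> b"
      using seminorm_le_universal[OF p a] seminorm_le_universal[OF p b] nonneg[OF a]
        seminormed_star_algebra.p_nonneg[OF seminormed[OF p] b] by (intro mult_mono)
    finally show "p (a \<otimes>\<^bsub>\<F>\<^esub> b) \<le> \<U> a * \<U> b" .
  qed
  have cst: "\<U> (star \<F> a \<otimes>\<^bsub>\<F>\<^esub> a) = (\<U> a)\<^sup>2" if a: "a \<in> carrier \<F>" for a
  proof (rule antisym)
    have sa: "star \<F> a \<otimes>\<^bsub>\<F>\<^esub> a \<in> carrier \<F>"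
      using a by (intro F.m_closed F.star_closed)
    have ps: "p (star \<F> a \<otimes>\<^bsub>\<F>\<^esub> a) = (p a)\<^sup>2" "0 \<le> p a" if "p \<in> seminorms" for p
      using seminormed_star_algebra.p_cstar[OF seminormed[OF that] a]
        seminormed_star_algebra.p_nonneg[OF seminormed[OF that] a] by simp_all
    show "\<U> (star \<F> a \<otimes>\<^bsub>\<F>\<^esub> a) \<le> (\<U> a)\<^sup>2"
    proof (rule universal_le)
      fix p assume p: "p \<in> seminorms"
      show "p (star \<F> a \<otimes>\<^bsub>\<F>\<^esub> a) \<le> (\<U> a)\<^sup>2"
        unfolding ps(1)[OF p] using seminorm_le_universal[OF p a] ps(2)[OF p] by (rule power_mono)
    qed
    \<comment> \<open>Each p(a) is the square root of p((star a) a), hence at most the square root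
      of the supremum of these values.\<close>
    have "\<U> a \<le> sqrt (\<U> (star \<F> a \<otimes>\<^bsub>\<F>\<^esub> a))"
    proof (rule universal_le)
      fix p assume p: "p \<in> seminorms"
      show "p a \<le> sqrt (\<U> (star \<F> a \<otimes>\<^bsub>\<F>\<^esub> a))"
        using seminorm_le_universal[OF p sa] unfolding ps(1)[OF p] by (rule real_le_rsqrt)
    qed
    then have "(\<U> a)\<^sup>2 \<le> (sqrt (\<U> (star \<F> a \<otimes>\<^bsub>\<F>\<^esub> a)))\<^sup>2"
      using nonneg[OF a] by (rule power_mono)
    then show "(\<U> a)\<^sup>2 \<le> \<U> (star \<F> a \<otimes>\<^bsub>\<F>\<^esub> a)"
      using nonneg[OF sa] by (simp only: real_sqrt_pow2)
  qed
  show ?thesis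
    unfolding cstar_seminorm_def
    by (intro conjI ballI allI) (rule nonneg tri smult mult cst, assumption+)+
qed

sublocale F: seminormed_star_algebra \<F> \<U>
  by (intro seminormed_star_algebra.intro seminormed_star_algebra_axioms.intro
      star_algebra_free cstar_seminorm_universal)

lemma cstar_algebra_universal: "cstar_algebra (universal_cstar X R)"
  unfolding universal_cstar_def by (rule F.cstar_algebra_completion)

definition universal_class :: "('x star_word \<Rightarrow>\<^sub>0 complex) \<Rightarrow> (nat \<Rightarrow> ('x star_word \<Rightarrow>\<^sub>0 complex)) set" where
  "universal_class a = cauchy_class \<F> \<U> (\<lambda>n. a)"

lemma universal_class_hom: "unital_star_hom \<F> (universal_cstar X R) universal_class"
  unfolding universal_cstar_def universal_class_def by (rule F.unital_star_hom_cls_const)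

lemma universal_class_gen: "universal_class (free_gen x) = universal_gen X R x"
  by (simp add: universal_class_def universal_gen_def cauchy_class_def)

lemma universal_class_relation: "r \<in> R \<Longrightarrow> universal_class r = \<zero>\<^bsub>universal_cstar X R\<^esub>"
proof -
  assume r: "r \<in> R"
  then have rc: "r \<in> carrier \<F>"
    using relations_closed by blast
  then have "\<U> (r \<ominus>\<^bsub>\<F>\<^esub> \<zero>\<^bsub>\<F>\<^esub>) = 0"
    using universal_relation[OF r] F.minus_zero_right[OF rc] by simp
  then show ?thesis
    unfolding universal_cstar_def universal_class_def F.cls_zero
    using rc F.cls_eq_iff[OF F.cauchy_seqs_const[OF rc] F.cauchy_seqs_const[of "\<zero>\<^bsub>\<F>\<^esub>"]]
    by (simp add: carrier_free_star_algebra)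
qed

lemma universal_class_dense:
  assumes "Y \<in> carrier (universal_cstar X R)" "e > 0"
  shows "\<exists>a\<in>carrier \<F>. nrm (universal_cstar X R) (Y \<ominus>\<^bsub>universal_cstar X R\<^esub> universal_class a) < e"
  using F.completion_dense[OF assms(1)[unfolded universal_cstar_def] assms(2)]
  unfolding universal_cstar_def universal_class_def .

text \<open>The norm of the evaluation in B is one of the seminorms under the supremum. The
  evaluation is therefore contractive for the universal seminorm and extends to the
  completion.\<close>

lemma universal_property:
  assumes B: "cstar_algebra B" and w: "\<And>x. x \<in> X \<Longrightarrow> w x \<in> carrier B"
    and rel: "\<And>r. r \<in> R \<Longrightarrow> star_algebra.free_eval B w r = \<zero>\<^bsub>B\<^esub>"
  shows "\<exists>f. unital_star_hom (universal_cstar X R) B f \<and> (\<forall>x\<in>X. f (universal_gen X R x) = w x)"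
proof -
  interpret B: cstar_algebra B by fact
  let ?h = "B.free_eval w"
  have h: "unital_star_hom \<F> B ?h"
    using w by (rule B.free_eval_hom)
  interpret h: star_hom \<F> B ?h
    using h by (intro star_homI star_algebra_free B.star_algebra_axioms)
  have "cstar_seminorm \<F> (\<lambda>a. nrm B (?h a))"
    unfolding cstar_seminorm_def
    by (intro conjI ballI allI)
      (simp_all only: h.hom_add h.hom_mult h.hom_smult h.hom_star h.hom_closed B.p_nonneg B.p_triangle
        B.p_smult B.p_mult B.p_cstar F.star_closed)
  moreover have "\<forall>r\<in>R. nrm B (?h r) = 0"
    using rel by simp
  ultimately have "(\<lambda>a. nrm B (?h a)) \<in> seminorms"
    by simp
  then have "nrm B (?h a) \<le> \<U> a" if "a \<in> carrier \<F>" for a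
    using seminorm_le_universal[OF _ that] by blast
  from F.completion_hom_extension[OF B h this]
  obtain f where "unital_star_hom (universal_cstar X R) B f"
    "\<forall>a\<in>carrier \<F>. f (universal_class a) = ?h a"
    unfolding universal_cstar_def universal_class_def by blast
  then show ?thesis
    using w free_gen_in_free[of _ X] B.free_eval_gen[of X w]
    by (intro exI[of _ f]) (simp flip: universal_class_gen)
qed

end

section \<open>Constructible right ideals\<close>

text \<open>The word of the adjoint: taking the star reverses the order of the pairs and exchanges
  the entries of each pair.\<close>

definition rev_word :: "('g \<times> 'g) list \<Rightarrow> ('g \<times> 'g) list" where
  "rev_word \<alpha> = rev (map prod.swap \<alpha>)"

lemma rev_word_simps [simp]: "rev_word [] = []" "rev_word ((p, q) # \<alpha>) = rev_word \<alpha> @ [(q, p)]"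
  by (simp_all add: rev_word_def)

lemma rev_word_in_lists: "\<alpha> \<in> lists (P \<times> P) \<Longrightarrow> rev_word \<alpha> \<in> lists (P \<times> P)"
  by (induction rule: lists.induct) auto

lemma (in star_algebra) star_word_op:
  assumes w: "\<And>x. x \<in> X \<Longrightarrow> w x \<in> carrier A" and \<alpha>: "\<alpha> \<in> lists (X \<times> X)"
  shows "star A (word_op A w \<alpha>) = word_op A w (rev_word \<alpha>)"
  using \<alpha>
proof (induction rule: lists.induct)
  case (Cons pq \<alpha>)
  obtain p q where pq: "pq = (p, q)"
    by (cases pq)
  have pqX: "p \<in> X" "q \<in> X"
    using Cons pq by auto
  have "star A (word_op A w (pq # \<alpha>)) = star A (word_op A w \<alpha>) \<otimes> (star A (w q) \<otimes> w p)"
    using w pqX word_op_closed[OF w Cons(2)] by (simp add: pq star_mult m_closed)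
  also have "\<dots> = word_op A w (rev_word \<alpha>) \<otimes> word_op A w [(q, p)]"
    using w pqX by (simp add: Cons.IH m_closed r_one)
  also have "\<dots> = word_op A w (rev_word (pq # \<alpha>))"
    using word_op_append[OF w rev_word_in_lists[OF Cons(2)], where \<beta> = "[(q, p)]"] pqX by (simp add: pq)
  finally show ?case .
qed simp

lemma word_op_cong:
  "\<lbrakk>\<alpha> \<in> lists (X \<times> X); \<And>x. x \<in> X \<Longrightarrow> w x = v x\<rbrakk> \<Longrightarrow> word_op A w \<alpha> = word_op A v \<alpha>"
  by (induction rule: lists.induct) auto

locale group_submonoid = group G for G :: "('g, 'm) monoid_scheme" (structure) +
  fixes P :: "'g set"
  assumes submonoid_P: "submonoid P G"
begin

lemma P_carrier [simp, intro]: "p \<in> P \<Longrightarrow> p \<in> carrier G"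
  using submonoid.subset[OF submonoid_P] by blast

lemma P_mult [simp, intro]: "\<lbrakk>p \<in> P; q \<in> P\<rbrakk> \<Longrightarrow> p \<otimes> q \<in> P"
  by (rule submonoid.m_closed[OF submonoid_P])

lemma P_one [simp, intro]: "\<one> \<in> P"
  by (rule submonoid.one_closed[OF submonoid_P])

abbreviation "K \<equiv> word_ideal G P"
abbreviation "dot \<equiv> word_dot G"
abbreviation "NW \<equiv> neutral_words G P"

lemma NW_lists: "\<alpha> \<in> NW \<Longrightarrow> \<alpha> \<in> lists (P \<times> P)" and NW_dot: "\<alpha> \<in> NW \<Longrightarrow> dot \<alpha> = \<one>"
  by (simp_all add: neutral_words_def)

lemma dot_closed [simp]: "\<alpha> \<in> lists (P \<times> P) \<Longrightarrow> dot \<alpha> \<in> carrier G"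
  by (induction rule: lists.induct) auto

lemma word_back_eq: "\<alpha> \<in> lists (P \<times> P) \<Longrightarrow> word_back G \<alpha> = inv (dot \<alpha>)"
proof (induction rule: lists.induct)
  case (Cons pq \<alpha>)
  then show ?case
    using dot_closed[OF Cons(2)] by (cases pq) (simp add: inv_mult_group)
qed simp

lemma coset_iff:
  assumes "x \<in> carrier G" "h \<in> carrier G"
  shows "h \<in> inv x <# P \<longleftrightarrow> x \<otimes> h \<in> P"
proof
  assume "h \<in> inv x <# P"
  then obtain p where "p \<in> P" "h = inv x \<otimes> p"
    by (auto simp: l_coset_def)
  then show "x \<otimes> h \<in> P"
    using assms by (simp add: m_assoc[symmetric])
next
  assume *: "x \<otimes> h \<in> P"
  have "h = inv x \<otimes> (x \<otimes> h)"
    using assms by (simp add: m_assoc[symmetric])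
  with * show "h \<in> inv x <# P"
    unfolding l_coset_def by blast
qed

lemma word_ideal_subset: "K \<alpha> \<subseteq> P"
  by (induction \<alpha>) auto

text \<open>A word acts on h pair by pair from its right end, and h belongs to the ideal when the
  result stays in P after every pair. The later lemmas on ideals treat a word as the partial
  translation h \<mapsto> dot(\<alpha>) h with domain K(\<alpha>).\<close>

lemma word_ideal_Cons_iff:
  assumes "pq # \<alpha> \<in> lists (P \<times> P)"
  shows "h \<in> K (pq # \<alpha>) \<longleftrightarrow> h \<in> K \<alpha> \<and> dot (pq # \<alpha>) \<otimes> h \<in> P"
proof -
  have "h \<in> inv (dot (pq # \<alpha>)) <# P \<longleftrightarrow> dot (pq # \<alpha>) \<otimes> h \<in> P" if "h \<in> K \<alpha>"
    using that word_ideal_subset[of \<alpha>] dot_closed[OF assms] by (intro coset_iff) auto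
  then show ?thesis
    using word_back_eq[OF assms] by auto
qed

declare word_ideal.simps(2) [simp del]

lemma word_ideal_dot:
  assumes "\<alpha> \<in> lists (P \<times> P)" "h \<in> K \<alpha>"
  shows "dot \<alpha> \<otimes> h \<in> P"
proof (cases \<alpha>)
  case (Cons pq \<beta>)
  then show ?thesis
    using assms word_ideal_Cons_iff by blast
qed (use assms in auto)

lemma word_ideal_right:
  assumes "\<alpha> \<in> lists (P \<times> P)" "h \<in> K \<alpha>" "p \<in> P"
  shows "h \<otimes> p \<in> K \<alpha>"
  using assms(1,2)
proof (induction rule: lists.induct)
  case (Cons pq \<alpha>)
  have l: "pq # \<alpha> \<in> lists (P \<times> P)"
    using Cons by simp
  have h: "h \<in> K \<alpha>" "dot (pq # \<alpha>) \<otimes> h \<in> P"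
    using Cons.prems word_ideal_Cons_iff[OF l] by auto
  have "h \<in> carrier G"
    using h word_ideal_subset by blast
  then have "dot (pq # \<alpha>) \<otimes> (h \<otimes> p) = (dot (pq # \<alpha>) \<otimes> h) \<otimes> p"
    using dot_closed[OF l] assms(3) by (intro m_assoc[symmetric]) auto
  then show ?case
    using Cons.IH[OF h(1)] h(2) assms(3) word_ideal_Cons_iff[OF l] by (simp del: word_dot.simps)
qed (use assms(3) in auto)

lemma dot_append:
  "\<lbrakk>\<alpha> \<in> lists (P \<times> P); \<beta> \<in> lists (P \<times> P)\<rbrakk> \<Longrightarrow> dot (\<alpha> @ \<beta>) = dot \<alpha> \<otimes> dot \<beta>"
proof (induction rule: lists.induct)
  case (Cons pq \<alpha>)
  then show ?case
    using dot_closed[OF Cons(2)] dot_closed[OF Cons(4)] by (cases pq) (simp add: m_assoc)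
qed (use dot_closed in simp)

text \<open>Concatenation composes partial translations: \<beta> acts first, and \<alpha> is applied
  to the translated point.\<close>

lemma word_ideal_append_iff:
  assumes "\<alpha> \<in> lists (P \<times> P)" and \<beta>: "\<beta> \<in> lists (P \<times> P)"
  shows "h \<in> K (\<alpha> @ \<beta>) \<longleftrightarrow> h \<in> K \<beta> \<and> dot \<beta> \<otimes> h \<in> K \<alpha>"
  using assms(1)
proof (induction rule: lists.induct)
  case Nil
  then show ?case
    using word_ideal_dot[OF \<beta>] by auto
next
  case (Cons pq \<alpha>)
  have l: "pq # \<alpha> \<in> lists (P \<times> P)" and l': "pq # (\<alpha> @ \<beta>) \<in> lists (P \<times> P)"
    using Cons \<beta> by auto
  have "dot (pq # (\<alpha> @ \<beta>)) \<otimes> h = dot (pq # \<alpha>) \<otimes> (dot \<beta> \<otimes> h)" if "h \<in> K \<beta>"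
  proof -
    have "h \<in> carrier G"
      using that word_ideal_subset by blast
    then show ?thesis
      using dot_append[OF l \<beta>] dot_closed[OF l] dot_closed[OF \<beta>] by (simp add: m_assoc del: word_dot.simps)
  qed
  then show ?case
    using word_ideal_Cons_iff[OF l'] word_ideal_Cons_iff[OF l] Cons.IH
    by (auto simp del: word_dot.simps)
qed

lemma dot_rev_word: "\<alpha> \<in> lists (P \<times> P) \<Longrightarrow> dot (rev_word \<alpha>) = inv (dot \<alpha>)"
proof (induction rule: lists.induct)
  case (Cons pq \<alpha>)
  then show ?case
    using dot_append[OF rev_word_in_lists[OF Cons(2)], of "[prod.swap pq]"]
    by (cases pq) (auto simp: inv_mult_group)
qed simp

text \<open>The reversed word is the inverse partial translation, so its domain is the range of the
  original one. For neutral words domain and range coincide, which makes the projections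
  self-adjoint.\<close>

lemma word_ideal_rev_word_iff:
  assumes "\<alpha> \<in> lists (P \<times> P)" "h \<in> carrier G"
  shows "h \<in> K (rev_word \<alpha>) \<longleftrightarrow> inv (dot \<alpha>) \<otimes> h \<in> K \<alpha>"
  using assms
proof (induction arbitrary: h rule: lists.induct)
  case (Cons pq \<alpha>)
  obtain p q where pq: "pq = (p, q)"
    by (cases pq)
  have pqP: "p \<in> P" "q \<in> P"
    using Cons pq by auto
  have l: "pq # \<alpha> \<in> lists (P \<times> P)" "[(q, p)] \<in> lists (P \<times> P)"
    using Cons pqP by auto
  let ?k = "(inv q \<otimes> p) \<otimes> h"
  have k: "?k \<in> carrier G"
    using pqP Cons.prems by auto
  have "h \<in> K (rev_word (pq # \<alpha>)) \<longleftrightarrow> h \<in> K [(q, p)] \<and> ?k \<in> K (rev_word \<alpha>)"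
    using word_ideal_append_iff[OF rev_word_in_lists[OF Cons(2)] l(2)] pqP by (simp add: pq)
  also have "\<dots> \<longleftrightarrow> h \<in> P \<and> ?k \<in> P \<and> inv (dot \<alpha>) \<otimes> ?k \<in> K \<alpha>"
    using Cons.IH[OF k] word_ideal_Cons_iff[OF l(2)] pqP by auto
  also have "inv (dot \<alpha>) \<otimes> ?k = inv (dot (pq # \<alpha>)) \<otimes> h"
    using pqP dot_closed[OF Cons(2)] Cons.prems by (simp add: pq inv_mult_group m_assoc)
  also have "(h \<in> P \<and> ?k \<in> P \<and> inv (dot (pq # \<alpha>)) \<otimes> h \<in> K \<alpha>) \<longleftrightarrow> inv (dot (pq # \<alpha>)) \<otimes> h \<in> K (pq # \<alpha>)"
  proof -
    have "dot (pq # \<alpha>) \<otimes> (inv (dot (pq # \<alpha>)) \<otimes> h) = h"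
      using dot_closed[OF l(1)] Cons.prems by (simp add: m_assoc[symmetric] del: word_dot.simps)
    moreover have "?k \<in> P" if "inv (dot (pq # \<alpha>)) \<otimes> h \<in> K \<alpha>"
    proof -
      have "dot \<alpha> \<otimes> (inv (dot (pq # \<alpha>)) \<otimes> h) = ?k"
        using pqP dot_closed[OF Cons(2)] Cons.prems by (simp add: pq inv_mult_group m_assoc[symmetric])
      then show ?thesis
        using word_ideal_dot[OF Cons(2) that] by simp
    qed
    ultimately show ?thesis
      using word_ideal_Cons_iff[OF l(1)] by (auto simp del: word_dot.simps)
  qed
  finally show ?case .
qed simp

lemma neutral_append: "\<lbrakk>\<alpha> \<in> NW; \<beta> \<in> NW\<rbrakk> \<Longrightarrow> \<alpha> @ \<beta> \<in> NW"
  by (simp add: neutral_words_def dot_append)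

lemma word_ideal_neutral_append:
  assumes "\<alpha> \<in> NW" "\<beta> \<in> NW"
  shows "K (\<alpha> @ \<beta>) = K \<alpha> \<inter> K \<beta>"
proof -
  have "h \<in> K \<beta> \<Longrightarrow> \<one> \<otimes> h = h" for h
    using word_ideal_subset[of \<beta>] by (intro l_one) auto
  then show ?thesis
    using word_ideal_append_iff[OF NW_lists NW_lists, OF assms] NW_dot[OF assms(2)] by auto
qed

lemma neutral_rev_word: "\<alpha> \<in> NW \<Longrightarrow> rev_word \<alpha> \<in> NW"
  by (simp add: neutral_words_def rev_word_in_lists dot_rev_word)

lemma word_ideal_neutral_rev_word: "\<alpha> \<in> NW \<Longrightarrow> K (rev_word \<alpha>) = K \<alpha>"
proof -
  assume \<alpha>: "\<alpha> \<in> NW"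
  have "h \<in> K (rev_word \<alpha>) \<longleftrightarrow> h \<in> K \<alpha>" if "h \<in> carrier G" for h
    using word_ideal_rev_word_iff[OF NW_lists[OF \<alpha>] that] NW_dot[OF \<alpha>] that by simp
  then show ?thesis
    using word_ideal_subset[of \<alpha>] word_ideal_subset[of "rev_word \<alpha>"] by blast
qed

text \<open>The word of (star w_g) w_\<alpha> w_g: move by g, test \<alpha>, move back. The entries
  \<open>\<one>\<close> only complete the pairs.\<close>

definition translate_word :: "'g \<Rightarrow> ('g \<times> 'g) list \<Rightarrow> ('g \<times> 'g) list" where
  "translate_word g \<alpha> = (g, \<one>) # \<alpha> @ [(\<one>, g)]"

lemma neutral_translate_word: "\<lbrakk>g \<in> P; \<alpha> \<in> NW\<rbrakk> \<Longrightarrow> translate_word g \<alpha> \<in> NW"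
  using dot_append[OF NW_lists, of \<alpha> "[(\<one>, g)]"] NW_dot[of \<alpha>]
  by (auto simp: translate_word_def neutral_words_def)

lemma word_ideal_translate_word:
  assumes g: "g \<in> P" and \<alpha>: "\<alpha> \<in> NW"
  shows "K (translate_word g \<alpha>) = {h \<in> P. g \<otimes> h \<in> K \<alpha>}"
proof -
  have l: "(g, \<one>) # (\<alpha> @ [(\<one>, g)]) \<in> lists (P \<times> P)" "[(\<one>, g)] \<in> lists (P \<times> P)"
    using g NW_lists[OF \<alpha>] by auto
  have "dot ((g, \<one>) # (\<alpha> @ [(\<one>, g)])) = \<one>"
    using NW_dot[OF neutral_translate_word[OF g \<alpha>]] unfolding translate_word_def .
  then have 1: "h \<in> K (translate_word g \<alpha>) \<longleftrightarrow> h \<in> K (\<alpha> @ [(\<one>, g)]) \<and> \<one> \<otimes> h \<in> P" for h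
    unfolding translate_word_def using word_ideal_Cons_iff[OF l(1)] by simp
  have 2: "h \<in> K (\<alpha> @ [(\<one>, g)]) \<longleftrightarrow> h \<in> P \<and> g \<otimes> h \<in> P \<and> g \<otimes> h \<in> K \<alpha>" for h
    using word_ideal_append_iff[OF NW_lists[OF \<alpha>] l(2)] word_ideal_Cons_iff[OF l(2)] g by auto
  show ?thesis
    using 1 2 word_ideal_subset[of \<alpha>] g by auto
qed

section \<open>The universal Toeplitz algebra\<close>

abbreviation "TU \<equiv> toeplitz_universal G P"
abbreviation "gen \<equiv> toeplitz_gen G P"
abbreviation "R \<equiv> toeplitz_relations G P"

lemma toeplitz_relations_cases:
  assumes "r \<in> R"
  obtains "r = free_gen \<one> \<ominus>\<^bsub>free_star_algebra P\<^esub> \<one>\<^bsub>free_star_algebra P\<^esub>"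
  | \<alpha> where "\<alpha> \<in> NW" "K \<alpha> = {}" "r = word_op (free_star_algebra P) free_gen \<alpha>"
  | \<alpha> \<beta> where "\<alpha> \<in> NW" "\<beta> \<in> NW" "K \<alpha> = K \<beta>"
    "r = word_op (free_star_algebra P) free_gen \<alpha> \<ominus>\<^bsub>free_star_algebra P\<^esub> word_op (free_star_algebra P) free_gen \<beta>"
  | \<alpha> \<beta>s where "\<alpha> \<in> NW" "\<beta>s \<in> lists NW" "distinct \<beta>s" "\<beta>s \<noteq> []" "K \<alpha> = (\<Union>\<beta>\<in>set \<beta>s. K \<beta>)"
    "r = list_product (free_star_algebra P) (map (\<lambda>\<beta>. word_op (free_star_algebra P) free_gen \<alpha>
      \<ominus>\<^bsub>free_star_algebra P\<^esub> word_op (free_star_algebra P) free_gen \<beta>) \<beta>s)"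
  using assms unfolding toeplitz_relations_def Let_def
  by (elim UnE CollectE exE conjE singletonE)
    (rule that(1), assumption | rule that(2), assumption+ | rule that(3), assumption+ | rule that(4), assumption+)+

lemma toeplitz_relationsI:
  "free_gen \<one> \<ominus>\<^bsub>free_star_algebra P\<^esub> \<one>\<^bsub>free_star_algebra P\<^esub> \<in> R"
  "\<lbrakk>\<alpha> \<in> NW; K \<alpha> = {}\<rbrakk> \<Longrightarrow> word_op (free_star_algebra P) free_gen \<alpha> \<in> R"
  "\<lbrakk>\<alpha> \<in> NW; \<beta> \<in> NW; K \<alpha> = K \<beta>\<rbrakk> \<Longrightarrow>
    word_op (free_star_algebra P) free_gen \<alpha> \<ominus>\<^bsub>free_star_algebra P\<^esub> word_op (free_star_algebra P) free_gen \<beta> \<in> R"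
  "\<lbrakk>\<alpha> \<in> NW; \<beta>s \<in> lists NW; distinct \<beta>s; \<beta>s \<noteq> []; K \<alpha> = (\<Union>\<beta>\<in>set \<beta>s. K \<beta>)\<rbrakk> \<Longrightarrow>
    list_product (free_star_algebra P) (map (\<lambda>\<beta>. word_op (free_star_algebra P) free_gen \<alpha>
      \<ominus>\<^bsub>free_star_algebra P\<^esub> word_op (free_star_algebra P) free_gen \<beta>) \<beta>s) \<in> R"
  unfolding toeplitz_relations_def Let_def
  subgoal by (intro UnI1 singletonI)
  subgoal by (rule UnI1, rule UnI1, rule UnI2, intro CollectI exI conjI) (rule refl | assumption)+
  subgoal by (rule UnI1, rule UnI2, intro CollectI exI conjI) (rule refl | assumption)+
  subgoal by (rule UnI2, intro CollectI exI conjI) (rule refl | assumption)+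
  done

lemma free_word_closed:
  "\<alpha> \<in> NW \<Longrightarrow> word_op (free_star_algebra P) free_gen \<alpha> \<in> carrier (free_star_algebra P)"
  using star_algebra.word_op_closed[OF star_algebra_free free_gen_in_free NW_lists] .

lemma free_word_minus_closed:
  "\<lbrakk>a \<in> carrier (free_star_algebra P); b \<in> carrier (free_star_algebra P)\<rbrakk> \<Longrightarrow>
    a \<ominus>\<^bsub>free_star_algebra P\<^esub> b \<in> carrier (free_star_algebra P)"
  using abelian_group.minus_closed[OF star_algebra.abelian_group_A[OF star_algebra_free]] .

lemma toeplitz_universal_relations: "universal_relations P R"
proof
  show "R \<subseteq> carrier (free_star_algebra P)"
  proof
    fix r assume "r \<in> R"
    then show "r \<in> carrier (free_star_algebra P)"
    proof (cases rule: toeplitz_relations_cases)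
      case 1
      then show ?thesis
        using free_word_minus_closed[OF free_gen_in_free, of \<one> "\<one>\<^bsub>free_star_algebra P\<^esub>"]
        by (simp add: carrier_free_star_algebra)
    next
      case (4 \<alpha> \<beta>s)
      have "set (map (\<lambda>\<beta>. word_op (free_star_algebra P) free_gen \<alpha>
          \<ominus>\<^bsub>free_star_algebra P\<^esub> word_op (free_star_algebra P) free_gen \<beta>) \<beta>s) \<subseteq> carrier (free_star_algebra P)"
        using 4 by (auto intro!: free_word_minus_closed free_word_closed)
      then show ?thesis
        unfolding 4 by (rule star_algebra.list_product_closed[OF star_algebra_free])
    qed (auto intro!: free_word_minus_closed free_word_closed)
  qed
  fix p :: "('g star_word \<Rightarrow>\<^sub>0 complex) \<Rightarrow> real" and x
  assume p: "cstar_seminorm (free_star_algebra P) p" and rel: "\<forall>r\<in>R. p r = 0" and x: "x \<in> P"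
  interpret seminormed_star_algebra "free_star_algebra P" p
    by (intro seminormed_star_algebra.intro seminormed_star_algebra_axioms.intro star_algebra_free p)
  let ?F = "free_star_algebra P"
  \<comment> \<open>The words \<open>[(x, x)]\<close> and \<open>[]\<close> both have the ideal P,
    so (T3) turns (star x) x into the unit and the C*-identity bounds the generator by 1.\<close>
  have nw: "[(x, x)] \<in> NW" "[] \<in> NW"
    using x by (auto simp: neutral_words_def)
  have "K [(x, x)] = K []"
    using word_ideal_Cons_iff[of "(x, x)" "[]"] x by auto
  from toeplitz_relationsI(3)[OF nw this]
  have zero: "p ((star ?F (free_gen x) \<otimes>\<^bsub>?F\<^esub> free_gen x) \<ominus>\<^bsub>?F\<^esub> \<one>\<^bsub>?F\<^esub>) = 0"
    using rel by simp
  have xc: "free_gen x \<in> carrier ?F"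
    using x by (rule free_gen_in_free)
  have one: "\<one>\<^bsub>?F\<^esub> \<in> carrier ?F"
    by (simp add: carrier_free_star_algebra)
  have "(p (free_gen x))\<^sup>2 = p (star ?F (free_gen x) \<otimes>\<^bsub>?F\<^esub> free_gen x)"
    by (rule p_cstar[OF xc, symmetric])
  also have "\<dots> \<le> p \<one>\<^bsub>?F\<^esub>"
    using p_diff_le[OF m_closed[OF star_closed[OF xc] xc] one] zero by linarith
  also have "\<dots> \<le> 1"
    by (rule p_one_le)
  finally have "(p (free_gen x))\<^sup>2 \<le> 1\<^sup>2"
    by (simp only: power_one)
  then show "p (free_gen x) \<le> 1"
    by (rule power2_le_imp_le) simp
qed

text \<open>Stated for any homomorphism killing the relations, because it is used for the class map
  into the universal algebra and for the evaluation in the reduced one. Self-adjointness holds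
  because a neutral word and its reversal have the same ideal, whence (T3) applies.\<close>

lemma projection_system_of_hom:
  assumes B: "cstar_algebra B" and h: "unital_star_hom (free_star_algebra P) B h"
    and kill: "\<And>r. r \<in> R \<Longrightarrow> h r = \<zero>\<^bsub>B\<^esub>"
  shows "projection_system B NW K (@) [] (word_op B (h \<circ> free_gen))"
proof -
  interpret B: cstar_algebra B by fact
  let ?F = "free_star_algebra P"
  interpret star_hom ?F B h
    using h by (intro star_homI star_algebra_free B.star_algebra_axioms)
  let ?e = "word_op B (h \<circ> free_gen)" and ?t = "word_op ?F free_gen"
  have he: "h (?t \<alpha>) = ?e \<alpha>" if "\<alpha> \<in> NW" for \<alpha>
    by (rule hom_word_op[OF free_gen_in_free NW_lists[OF that], THEN conjunct1])
  have hc: "(h \<circ> free_gen) x \<in> carrier B" if "x \<in> P" for x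
    using free_gen_in_free[OF that] by (simp add: hom_closed)
  have closed: "?e \<alpha> \<in> carrier B" if "\<alpha> \<in> NW" for \<alpha>
    using B.word_op_closed[where w = "h \<circ> free_gen", OF hc NW_lists[OF that]] .
  have cong: "?e \<alpha> = ?e \<beta>" if "\<alpha> \<in> NW" "\<beta> \<in> NW" "K \<alpha> = K \<beta>" for \<alpha> \<beta>
  proof -
    have "?e \<alpha> \<ominus>\<^bsub>B\<^esub> ?e \<beta> = \<zero>\<^bsub>B\<^esub>"
      using kill[OF toeplitz_relationsI(3)[OF that]] hom_minus[OF free_word_closed[OF that(1)] free_word_closed[OF that(2)]]
        he[OF that(1)] he[OF that(2)] by simp
    then show ?thesis
      using B.minus_eq_zero_iff[OF closed[OF that(1)] closed[OF that(2)]] by blast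
  qed
  show ?thesis
  proof (intro projection_system.intro projection_system_axioms.intro B)
    show "?e \<alpha> \<in> carrier B" if "\<alpha> \<in> NW" for \<alpha>
      using that by (rule closed)
    show "star B (?e \<alpha>) = ?e \<alpha>" if "\<alpha> \<in> NW" for \<alpha>
      using B.star_word_op[where w = "h \<circ> free_gen", OF hc NW_lists[OF that]] cong[OF neutral_rev_word[OF that] that]
        word_ideal_neutral_rev_word[OF that] by simp
    show "?e (\<alpha> @ \<beta>) = ?e \<alpha> \<otimes>\<^bsub>B\<^esub> ?e \<beta>" if "\<alpha> \<in> NW" "\<beta> \<in> NW" for \<alpha> \<beta>
      using B.word_op_append[where w = "h \<circ> free_gen", OF hc NW_lists[OF that(1)] NW_lists[OF that(2)]] .
    show "?e \<alpha> = ?e \<beta>" if "\<alpha> \<in> NW" "\<beta> \<in> NW" "K \<alpha> = K \<beta>" for \<alpha> \<beta>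
      using that by (rule cong)
    show "?e \<alpha> = \<zero>\<^bsub>B\<^esub>" if "\<alpha> \<in> NW" "K \<alpha> = {}" for \<alpha>
      using kill[OF toeplitz_relationsI(2)[OF that]] he[OF that(1)] by simp
    show "list_product B (map (\<lambda>\<beta>. ?e \<alpha> \<ominus>\<^bsub>B\<^esub> ?e \<beta>) \<beta>s) = \<zero>\<^bsub>B\<^esub>"
      if "\<alpha> \<in> NW" "\<beta>s \<in> lists NW" "distinct \<beta>s" "\<beta>s \<noteq> []" "K \<alpha> = (\<Union>\<beta>\<in>set \<beta>s. K \<beta>)" for \<alpha> \<beta>s
    proof -
      have c: "set (map (\<lambda>\<beta>. ?t \<alpha> \<ominus>\<^bsub>?F\<^esub> ?t \<beta>) \<beta>s) \<subseteq> carrier ?F"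
        using that by (auto intro!: free_word_minus_closed free_word_closed)
      have "map h (map (\<lambda>\<beta>. ?t \<alpha> \<ominus>\<^bsub>?F\<^esub> ?t \<beta>) \<beta>s) = map (\<lambda>\<beta>. ?e \<alpha> \<ominus>\<^bsub>B\<^esub> ?e \<beta>) \<beta>s"
        using that hom_minus[OF free_word_closed free_word_closed] he by (auto simp: subset_iff)
      then show ?thesis
        using hom_list_product[OF c] kill[OF toeplitz_relationsI(4)[OF that]] by (simp only:)
    qed
    show "[] \<in> NW"
      by (simp add: neutral_words_def)
  qed (simp_all add: neutral_append word_ideal_neutral_append)
qed

lemma toeplitz_universal_eq: "TU = universal_cstar P R"
  by (simp add: toeplitz_universal_def)

lemmas universal_class_hom = universal_relations.universal_class_hom[OF toeplitz_universal_relations]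
  and universal_class_relation = universal_relations.universal_class_relation[OF toeplitz_universal_relations]
  and universal_class_gen = universal_relations.universal_class_gen[OF toeplitz_universal_relations]
  and universal_class_dense = universal_relations.universal_class_dense[OF toeplitz_universal_relations]
  and universal_property = universal_relations.universal_property[OF toeplitz_universal_relations]

abbreviation "uclass \<equiv> universal_relations.universal_class P R"

lemma class_comp_gen: "uclass \<circ> free_gen = gen"
  by (simp add: fun_eq_iff universal_class_gen toeplitz_gen_def)

lemma cstar_algebra_TU: "cstar_algebra TU"
  unfolding toeplitz_universal_eq by (rule universal_relations.cstar_algebra_universal[OF toeplitz_universal_relations])

abbreviation "eU \<equiv> word_op TU gen"

lemma projection_system_TU: "projection_system TU NW K (@) [] eU"
  using projection_system_of_hom[OF cstar_algebra_TU, of uclass]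
    universal_class_hom universal_class_relation
  by (simp add: class_comp_gen toeplitz_universal_eq)

section \<open>The reduced Toeplitz algebra\<close>

abbreviation "TR \<equiv> toeplitz_reduced G P"
abbreviation "L \<equiv> left_shift G P"
abbreviation "E \<equiv> ell2_ops P"

lemma shift_coset_iff: "\<lbrakk>p \<in> P; g \<in> carrier G\<rbrakk> \<Longrightarrow> g \<in> p <# P \<longleftrightarrow> inv p \<otimes> g \<in> P"
  using coset_iff[of "inv p" g] by simp

lemma left_shift_apply:
  assumes "p \<in> P" "x \<in> ell2 P"
  shows "L p x g = (if g \<in> P \<and> inv p \<otimes> g \<in> P then x (inv p \<otimes> g) else 0)"
proof -
  have "g \<in> p <# P \<longleftrightarrow> g \<in> P \<and> inv p \<otimes> g \<in> P"
  proof (cases "g \<in> carrier G")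
    case True
    have "g = p \<otimes> (inv p \<otimes> g)"
      using True assms(1) by (simp add: m_assoc[symmetric])
    then have "g \<in> P" if "inv p \<otimes> g \<in> P"
      using that assms(1) P_mult by metis
    then show ?thesis
      using shift_coset_iff[OF assms(1) True] by blast
  qed (use assms(1) in \<open>auto simp: l_coset_def\<close>)
  then show ?thesis
    using assms by (simp add: left_shift_def)
qed

lemma left_shift_bounded:
  assumes p: "p \<in> P"
  shows "L p \<in> bounded_ops P"
proof -
  have *: "L p x \<in> ell2 P \<and> ell2_norm P (L p x) \<le> 1 * ell2_norm P x" if x: "x \<in> ell2 P" for x
  proof -
    have "L2_set (\<lambda>g. cmod (L p x g)) F \<le> 1 * ell2_norm P x" if F: "finite F" "F \<subseteq> P" for F
    proof -
      let ?H = "{g \<in> F. inv p \<otimes> g \<in> P}"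
      \<comment> \<open>Left translation is injective on the points at which the shifted vector can
        be nonzero, so its finite sums are finite sums of x, reindexed.\<close>
      have inj: "inj_on ((\<otimes>) (inv p)) ?H"
      proof (rule inj_on_inverseI)
        show "p \<otimes> (inv p \<otimes> g) = g" if "g \<in> ?H" for g
          using that F p by (auto simp: m_assoc[symmetric] subset_iff)
      qed
      have "(\<Sum>g\<in>F. (cmod (L p x g))\<^sup>2) = (\<Sum>g\<in>?H. (cmod (L p x g))\<^sup>2)"
        using F p x by (intro sum.mono_neutral_right) (auto simp: left_shift_apply)
      also have "\<dots> = (\<Sum>g\<in>?H. (cmod (x (inv p \<otimes> g)))\<^sup>2)"
        using F p x by (intro sum.cong) (auto simp: left_shift_apply)
      also have "\<dots> = (\<Sum>h\<in>(\<otimes>) (inv p) ` ?H. (cmod (x h))\<^sup>2)"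
        using inj by (simp add: sum.reindex)
      finally have "L2_set (\<lambda>g. cmod (L p x g)) F = L2_set (\<lambda>h. cmod (x h)) ((\<otimes>) (inv p) ` ?H)"
        by (simp add: L2_set_def)
      also have "\<dots> \<le> ell2_norm P x"
        using x F by (intro L2_set_le_ell2_norm) auto
      finally show ?thesis
        by simp
    qed
    then show ?thesis
      using ell2_boundI[of P "L p x"] left_shift_apply[OF p x] by auto
  qed
  show ?thesis
  proof (rule bounded_opsI[where C = 1])
    show "L p \<in> extensional (ell2 P)"
      by (simp add: left_shift_def)
  qed (use * p in \<open>auto simp: left_shift_apply ell2_add ell2_smult fun_eq_iff\<close>)
qed

text \<open>As \<open>L p\<close> sends the basis vector at g to the one at p g, the coordinate
  formula of \<open>adjoint_op\<close> becomes evaluation at p g.\<close>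

lemma star_left_shift_apply:
  assumes p: "p \<in> P" and x: "x \<in> ell2 P"
  shows "star E (L p) x g = (if g \<in> P then x (p \<otimes> g) else 0)"
  using left_shift_delta[OF is_group submonoid_P p] p x
  by (simp add: star_ell2_ops[OF left_shift_bounded[OF p]] adjoint_op_def ell2_inner_delta_left)

lemma left_shift_one: "L \<one> = \<one>\<^bsub>E\<^esub>"
proof (rule bounded_ops_eqI[OF left_shift_bounded[OF P_one] bounded_ops_one])
  fix x assume x: "x \<in> ell2 P"
  show "L \<one> x = \<one>\<^bsub>E\<^esub> x"
    using x ell2_outside[OF x] by (auto simp: left_shift_apply ell2_ops_apply fun_eq_iff)
qed

lemma star_E_closed: "T \<in> bounded_ops P \<Longrightarrow> star E T \<in> bounded_ops P"
  using star_algebra.star_closed[OF star_algebra_ell2_ops[of P]] by (simp add: ell2_ops_simps(1))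

lemma word_op_E_closed: "\<alpha> \<in> lists (P \<times> P) \<Longrightarrow> word_op E L \<alpha> \<in> bounded_ops P"
  using star_algebra.word_op_closed[OF star_algebra_ell2_ops[of P], of P L \<alpha>] left_shift_bounded
  by (simp add: ell2_ops_simps(1))

text \<open>The operator of a word carries functions along the partial translation h \<mapsto>
  dot(\<alpha>) h on K(\<alpha>), hence the inverse in the formula. For a neutral word only the
  restriction to the domain remains.\<close>

lemma word_op_E_apply:
  assumes "\<alpha> \<in> lists (P \<times> P)" "x \<in> ell2 P" "g \<in> carrier G"
  shows "word_op E L \<alpha> x g = (if g \<in> P \<and> inv (dot \<alpha>) \<otimes> g \<in> K \<alpha> then x (inv (dot \<alpha>) \<otimes> g) else 0)"
  using assms
proof (induction arbitrary: g rule: lists.induct)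
  case Nil
  then show ?case
    using ell2_outside[OF assms(2)] by (simp add: ell2_ops_apply)
next
  case (Cons pq \<alpha>)
  obtain p q where pq: "pq = (p, q)"
    by (cases pq)
  have pqP: "p \<in> P" "q \<in> P"
    using Cons pq by auto
  have l: "pq # \<alpha> \<in> lists (P \<times> P)"
    using Cons by simp
  note x = assms(2)
  let ?y = "word_op E L \<alpha> x" and ?k = "inv q \<otimes> (p \<otimes> g)"
  have y: "?y \<in> ell2 P"
    using bounded_opsD(2)[OF word_op_E_closed[OF Cons(2)] x] .
  have Ly: "L q ?y \<in> ell2 P"
    using bounded_opsD(2)[OF left_shift_bounded[OF pqP(2)] y] .
  have "word_op E L (pq # \<alpha>) x g = star E (L p) (L q ?y) g"
    using x y by (simp add: pq ell2_ops_apply)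
  also have "\<dots> = (if g \<in> P \<and> ?k \<in> P then ?y ?k else 0)"
    using star_left_shift_apply[OF pqP(1) Ly] left_shift_apply[OF pqP(2) y] pqP by auto
  also have "?y ?k = (if ?k \<in> P \<and> inv (dot \<alpha>) \<otimes> ?k \<in> K \<alpha> then x (inv (dot \<alpha>) \<otimes> ?k) else 0)"
    using Cons.IH[OF x] pqP Cons.prems by auto
  also have "inv (dot \<alpha>) \<otimes> ?k = inv (dot (pq # \<alpha>)) \<otimes> g"
    using pqP dot_closed[OF Cons(2)] Cons.prems by (simp add: pq inv_mult_group m_assoc)
  finally have eq: "word_op E L (pq # \<alpha>) x g =
      (if g \<in> P \<and> ?k \<in> P \<and> inv (dot (pq # \<alpha>)) \<otimes> g \<in> K \<alpha> then x (inv (dot (pq # \<alpha>)) \<otimes> g) else 0)"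
    by (simp del: word_dot.simps word_op.simps)
  have "?k \<in> P" if "inv (dot (pq # \<alpha>)) \<otimes> g \<in> K \<alpha>"
  proof -
    have "dot \<alpha> \<otimes> (inv (dot (pq # \<alpha>)) \<otimes> g) = ?k"
      using pqP dot_closed[OF Cons(2)] Cons.prems by (simp add: pq inv_mult_group m_assoc[symmetric])
    then show ?thesis
      using word_ideal_dot[OF Cons(2) that] by simp
  qed
  moreover have "dot (pq # \<alpha>) \<otimes> (inv (dot (pq # \<alpha>)) \<otimes> g) = g"
    using dot_closed[OF l] Cons.prems by (simp add: m_assoc[symmetric] del: word_dot.simps)
  ultimately show ?case
    unfolding eq using word_ideal_Cons_iff[OF l] by (auto simp del: word_dot.simps)
qed

lemma word_op_E_neutral:
  assumes "\<alpha> \<in> NW"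
  shows "word_op E L \<alpha> = indicator_op P (K \<alpha>)"
proof (rule bounded_ops_eqI[OF word_op_E_closed[OF NW_lists[OF assms]] indicator_op_bounded])
  fix x assume x: "x \<in> ell2 P"
  have y: "word_op E L \<alpha> x \<in> ell2 P"
    using bounded_opsD(2)[OF word_op_E_closed[OF NW_lists[OF assms]] x] .
  show "word_op E L \<alpha> x = indicator_op P (K \<alpha>) x"
  proof
    fix g
    show "word_op E L \<alpha> x g = indicator_op P (K \<alpha>) x g"
    proof (cases "g \<in> P")
      case True
      then show ?thesis
        using word_op_E_apply[OF NW_lists[OF assms] x, of g] NW_dot[OF assms] x by (simp add: indicator_op_def)
    next
      case False
      then show ?thesis
        using ell2_outside[OF y] ell2_outside[OF x] x by (simp add: indicator_op_def)
    qed
  qed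
qed

lemma TR_simps [simp]:
  "mult TR = mult E" "one TR = one E" "zero TR = zero E" "add TR = add E" "smult TR = smult E"
  "star TR = star E" "nrm TR = nrm E"
  by (simp_all add: toeplitz_reduced_def cstar_generated_def)

lemma carrier_TR: "carrier TR = cstar_subset E hull (L ` P)"
  by (simp add: toeplitz_reduced_def cstar_generated_def)

lemma TR_eq: "TR = E\<lparr>carrier := carrier TR\<rparr>"
  by (simp add: toeplitz_reduced_def cstar_generated_def)

lemma shifts_subset: "L ` P \<subseteq> carrier E"
  using left_shift_bounded by (auto simp: ell2_ops_simps(1))

lemma cstar_algebra_TR: "cstar_algebra TR"
  unfolding toeplitz_reduced_def
  by (rule cstar_algebra.cstar_algebra_generated[OF cstar_algebra_ell2_ops shifts_subset])
    (use left_shift_one in \<open>metis imageI P_one\<close>)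

lemma carrier_TR_subset: "carrier TR \<subseteq> bounded_ops P"
  using cstar_algebra.cstar_subset_generated[OF cstar_algebra_ell2_ops shifts_subset]
  by (simp add: carrier_TR cstar_subset_def subspace_of_def ell2_ops_simps(1))

lemma L_in_TR: "p \<in> P \<Longrightarrow> L p \<in> carrier TR"
  using hull_subset[of "L ` P" "cstar_subset E"] by (auto simp: carrier_TR)

lemma minus_TR: "\<lbrakk>S \<in> carrier TR; T \<in> carrier TR\<rbrakk> \<Longrightarrow> S \<ominus>\<^bsub>TR\<^esub> T = S \<ominus>\<^bsub>E\<^esub> T"
  using star_algebra.minus_subset[OF star_algebra_ell2_ops[of P], of "carrier TR" S T]
    cstar_algebra.axioms(1)[OF cstar_algebra_TR] carrier_TR_subset TR_eq
  by (simp add: ell2_ops_simps(1))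

text \<open>Contractivity is available for homomorphisms into all bounded operators; enlarging the
  target makes it applicable to the reduced algebra, which has the same norm.\<close>

lemma unital_star_hom_TR_into_E: "unital_star_hom A TR f \<Longrightarrow> unital_star_hom A E f"
  using carrier_TR_subset by (auto simp: unital_star_hom_def ring_hom_def ell2_ops_simps(1))

lemma word_op_TR: "word_op TR L \<alpha> = word_op E L \<alpha>"
  by (induction \<alpha>) simp_all

lemma word_op_TR_neutral: "\<alpha> \<in> NW \<Longrightarrow> word_op TR L \<alpha> = indicator_op P (K \<alpha>)"
  by (simp add: word_op_TR word_op_E_neutral)

lemma indicator_op_apply: "x \<in> ell2 P \<Longrightarrow> indicator_op P A x = (\<lambda>g. if g \<in> A then x g else 0)"
  by (simp add: indicator_op_def)

lemma ell2_if: "x \<in> ell2 P \<Longrightarrow> (\<lambda>g. if g \<in> A then x g else 0) \<in> ell2 P"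
  using bounded_opsD(2)[OF indicator_op_bounded, of x P A] by (simp add: indicator_op_apply)

lemma indicator_op_mult: "indicator_op P A \<otimes>\<^bsub>E\<^esub> indicator_op P B = indicator_op P (A \<inter> B)"
  by (rule bounded_ops_eqI[OF bounded_ops_mult[OF indicator_op_bounded indicator_op_bounded] indicator_op_bounded])
    (auto simp: ell2_ops_apply indicator_op_apply ell2_if)

lemma indicator_op_cong: "A \<inter> P = B \<inter> P \<Longrightarrow> indicator_op P A = indicator_op P B"
  unfolding indicator_op_def
proof (rule restrict_ext)
  fix x assume "A \<inter> P = B \<inter> P" "x \<in> ell2 P"
  then show "(\<lambda>g. if g \<in> A then x g else 0) = (\<lambda>g. if g \<in> B then x g else 0)"
    using ell2_outside[of x P] by (auto simp: fun_eq_iff)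
qed

lemma indicator_op_top: "indicator_op P P = \<one>\<^bsub>E\<^esub>"
  by (rule bounded_ops_eqI[OF indicator_op_bounded bounded_ops_one])
    (auto simp: ell2_ops_apply indicator_op_apply ell2_outside)

lemma indicator_op_minus: "indicator_op P A \<ominus>\<^bsub>E\<^esub> indicator_op P B = diag_op P (\<lambda>g. (if g \<in> A then 1 else 0) - (if g \<in> B then 1 else 0))"
proof (rule bounded_ops_eqI)
  show "indicator_op P A \<ominus>\<^bsub>E\<^esub> indicator_op P B \<in> bounded_ops P"
    by (rule abelian_group.minus_closed[OF star_algebra.abelian_group_A[OF star_algebra_ell2_ops[of P]],
          unfolded ell2_ops_simps(1)]) (rule indicator_op_bounded)+
  show "diag_op P (\<lambda>g. (if g \<in> A then 1 else 0) - (if g \<in> B then 1 else 0)) \<in> bounded_ops P"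
    by (rule diag_op_bounded[where C = 1]) auto
qed (auto simp: ell2_ops_minus_apply indicator_op_bounded indicator_op_apply diag_op_def)

lemma indicator_op_diff: "B \<subseteq> A \<Longrightarrow> indicator_op P A \<ominus>\<^bsub>E\<^esub> indicator_op P B = indicator_op P (A - B)"
  unfolding indicator_op_minus unfolding indicator_op_eq_diag_op
  by (rule arg_cong[where f = "diag_op P"]) (auto simp: fun_eq_iff)

lemma list_product_indicator:
  "list_product E (map (\<lambda>i. indicator_op P (A i)) is) = indicator_op P {g \<in> P. \<forall>i\<in>set is. g \<in> A i}"
proof (induction "is")
  case Nil
  then show ?case
    using indicator_op_top by simp
next
  case (Cons i "is")
  then show ?case
    by (simp add: indicator_op_mult) (auto intro!: indicator_op_cong)
qed

lemma indicator_op_empty: "indicator_op P {} = \<zero>\<^bsub>E\<^esub>"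
  by (simp add: indicator_op_def ell2_ops_simps)

section \<open>Evaluation of the free star algebra in the reduced algebra\<close>

abbreviation "ev \<equiv> star_algebra.free_eval TR L"

lemma ev_hom: "unital_star_hom (free_star_algebra P) TR ev"
  using star_algebra.free_eval_hom[OF cstar_algebra.axioms(1)[OF cstar_algebra_TR] L_in_TR] .

lemma ev_gen: "p \<in> P \<Longrightarrow> ev (free_gen p) = L p"
  using star_algebra.free_eval_gen[OF cstar_algebra.axioms(1)[OF cstar_algebra_TR] L_in_TR] .

lemma ev_comp_gen: "\<alpha> \<in> lists (P \<times> P) \<Longrightarrow> word_op TR (ev \<circ> free_gen) \<alpha> = word_op TR L \<alpha>"
  by (rule word_op_cong) (auto simp: ev_gen)

text \<open>Neutral words evaluate to indicator operators, so each relation becomes a statement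
  about sets. For (T4) it says that no point of K(\<alpha>) lies outside all the sets
  K(\<beta>).\<close>

lemma ev_relation:
  assumes "r \<in> R"
  shows "ev r = \<zero>\<^bsub>TR\<^esub>"
proof -
  let ?F = "free_star_algebra P"
  interpret star_hom ?F TR ev
    by (intro star_homI star_algebra_free cstar_algebra.axioms(1)[OF cstar_algebra_TR] ev_hom)
  have word: "ev (word_op ?F free_gen \<alpha>) = indicator_op P (K \<alpha>)" if "\<alpha> \<in> NW" for \<alpha>
    by (rule trans[OF hom_word_op[OF free_gen_in_free NW_lists[OF that], THEN conjunct1]
          trans[OF ev_comp_gen[OF NW_lists[OF that]] word_op_TR_neutral[OF that]]])
  have ind: "indicator_op P (K \<alpha>) \<in> carrier TR" if "\<alpha> \<in> NW" for \<alpha>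
    using word[OF that] hom_closed[OF free_word_closed[OF that]] by simp
  have minus: "ev (word_op ?F free_gen \<alpha> \<ominus>\<^bsub>?F\<^esub> word_op ?F free_gen \<beta>) = indicator_op P (K \<alpha>) \<ominus>\<^bsub>E\<^esub> indicator_op P (K \<beta>)"
    if "\<alpha> \<in> NW" "\<beta> \<in> NW" for \<alpha> \<beta>
    using hom_minus[OF free_word_closed[OF that(1)] free_word_closed[OF that(2)]] word[OF that(1)] word[OF that(2)]
      minus_TR[OF ind[OF that(1)] ind[OF that(2)]] by simp
  from assms show ?thesis
  proof (cases rule: toeplitz_relations_cases)
    case 1
    have "\<one>\<^bsub>?F\<^esub> \<in> carrier ?F"
      by (simp add: carrier_free_star_algebra)
    from hom_minus[OF free_gen_in_free[OF P_one] this] have "ev r = L \<one> \<ominus>\<^bsub>TR\<^esub> L \<one>"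
      unfolding 1 by (simp add: ev_gen hom_one left_shift_one del: free_star_algebra_simps)
    then show ?thesis
      using B.minus_self[OF L_in_TR[OF P_one]] by simp
  next
    case (2 \<alpha>)
    then show ?thesis
      using word[OF 2(1)] indicator_op_empty by simp
  next
    case (3 \<alpha> \<beta>)
    then show ?thesis
      using minus[OF 3(1,2)] indicator_op_diff[of "K \<alpha>" "K \<alpha>"] indicator_op_empty by simp
  next
    case (4 \<alpha> \<beta>s)
    have sub: "\<beta> \<in> NW \<and> K \<beta> \<subseteq> K \<alpha>" if "\<beta> \<in> set \<beta>s" for \<beta>
      using that 4 by auto
    let ?d = "\<lambda>\<beta>. word_op ?F free_gen \<alpha> \<ominus>\<^bsub>?F\<^esub> word_op ?F free_gen \<beta>"
    have c: "set (map ?d \<beta>s) \<subseteq> carrier ?F"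
      using 4(1) sub by (auto intro!: free_word_minus_closed free_word_closed)
    have "map ev (map ?d \<beta>s) = map (\<lambda>\<beta>. indicator_op P (K \<alpha> - K \<beta>)) \<beta>s"
      using minus[OF 4(1)] sub indicator_op_diff by auto
    then have "ev r = list_product TR (map (\<lambda>\<beta>. indicator_op P (K \<alpha> - K \<beta>)) \<beta>s)"
      unfolding 4(6) hom_list_product[OF c] by (simp only:)
    also have "\<dots> = list_product E (map (\<lambda>\<beta>. indicator_op P (K \<alpha> - K \<beta>)) \<beta>s)"
      by (simp add: list_product_def)
    also have "\<dots> = indicator_op P {}"
    proof -
      have "False" if g: "\<forall>\<beta>\<in>set \<beta>s. g \<in> K \<alpha> - K \<beta>" for g
      proof -
        \<comment> \<open>The list is nonempty, so some \<beta> is available to conclude that g lies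
          in K(\<alpha>).\<close>
        have "g \<in> K \<alpha>"
          using g 4(4) by (cases \<beta>s) auto
        then show False
          using g 4(5) by blast
      qed
      then have "{g \<in> P. \<forall>\<beta>\<in>set \<beta>s. g \<in> K \<alpha> - K \<beta>} = {}"
        by blast
      then show ?thesis
        unfolding list_product_indicator by (simp only:)
    qed
    finally show ?thesis
      using indicator_op_empty by simp
  qed
qed

abbreviation "eR \<alpha> \<equiv> indicator_op P (K \<alpha>)"

lemma projection_system_TR: "projection_system TR NW K (@) [] (word_op TR (ev \<circ> free_gen))"
  using cstar_algebra_TR ev_hom ev_relation by (rule projection_system_of_hom)

lemma word_op_TR_ev: "\<alpha> \<in> NW \<Longrightarrow> word_op TR (ev \<circ> free_gen) \<alpha> = eR \<alpha>"
  using ev_comp_gen[OF NW_lists] word_op_TR_neutral by simp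

section \<open>The canonical map\<close>

lemma canonical_map_contractive:
  assumes f: "unital_star_hom TU TR f" and X: "X \<in> carrier TU"
  shows "nrm TR (f X) \<le> nrm TU X"
  using star_hom_ell2_contractive[OF cstar_algebra_TU unital_star_hom_TR_into_E[OF f] X] by simp

lemma uclass_closed: "a \<in> carrier (free_star_algebra P) \<Longrightarrow> uclass a \<in> carrier TU"
  using universal_class_hom by (auto simp: unital_star_hom_def ring_hom_def toeplitz_universal_eq)

text \<open>Two canonical maps agree on the images of the free *-algebra, which are dense; a *-homomorphism
  into \<open>TR\<close> is contractive, hence determined by its values there.\<close>

lemma canonical_map_unique:
  assumes f: "is_canonical_map G P f" and g: "is_canonical_map G P g" and X: "X \<in> carrier TU"
  shows "f X = g X"
proof -
  interpret TU: cstar_algebra TU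
    by (rule cstar_algebra_TU)
  interpret TR: cstar_algebra TR
    by (rule cstar_algebra_TR)
  have fh: "unital_star_hom TU TR f" and gh: "unital_star_hom TU TR g"
    using f g by (simp_all add: is_canonical_map_def)
  interpret f: star_hom TU TR f
    using fh by (intro star_homI TU.star_algebra_axioms TR.star_algebra_axioms)
  interpret g: star_hom TU TR g
    using gh by (intro star_homI TU.star_algebra_axioms TR.star_algebra_axioms)
  have class_hom: "unital_star_hom (free_star_algebra P) TU uclass"
    using universal_class_hom by (simp add: toeplitz_universal_eq)
  have eq: "f (uclass a) = g (uclass a)" if a: "a \<in> carrier (free_star_algebra P)" for a
  proof (rule free_hom_unique[OF TR.star_algebra_axioms _ _ _ a])
    show "unital_star_hom (free_star_algebra P) TR (\<lambda>a. f (uclass a))"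
      using class_hom fh by (rule unital_star_hom_comp)
    show "unital_star_hom (free_star_algebra P) TR (\<lambda>a. g (uclass a))"
      using class_hom gh by (rule unital_star_hom_comp)
    show "f (uclass (free_gen p)) = g (uclass (free_gen p))" if "p \<in> P" for p
      using f g that by (simp add: universal_class_gen is_canonical_map_def toeplitz_gen_def)
  qed
  have small: "nrm TR (f X \<ominus>\<^bsub>TR\<^esub> g X) \<le> 0 + e" if e: "e > 0" for e
  proof -
    have "e / 2 > 0"
      using e by simp
    from universal_class_dense[OF X[unfolded toeplitz_universal_eq] this]
    obtain a where a: "a \<in> carrier (free_star_algebra P)" "nrm TU (X \<ominus>\<^bsub>TU\<^esub> uclass a) < e / 2"
      unfolding toeplitz_universal_eq by blast
    note ac = uclass_closed[OF a(1)]
    have d: "X \<ominus>\<^bsub>TU\<^esub> uclass a \<in> carrier TU"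
      using X ac by (simp add: TU.minus_eq_csmult)
    have "nrm TR (f X \<ominus>\<^bsub>TR\<^esub> g X) \<le> nrm TR (f X \<ominus>\<^bsub>TR\<^esub> f (uclass a)) + nrm TR (g (uclass a) \<ominus>\<^bsub>TR\<^esub> g X)"
      using TR.p_triangle_minus[of "f X" "f (uclass a)" "g X"] X ac eq[OF a(1)] by (simp only: f.hom_closed g.hom_closed)
    also have "nrm TR (g (uclass a) \<ominus>\<^bsub>TR\<^esub> g X) = nrm TR (g X \<ominus>\<^bsub>TR\<^esub> g (uclass a))"
      using X ac by (intro TR.p_minus_commute) auto
    also have "nrm TR (f X \<ominus>\<^bsub>TR\<^esub> f (uclass a)) \<le> e / 2"
      using canonical_map_contractive[OF fh d] a(2) X ac by (simp only: f.hom_minus)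
    also have "nrm TR (g X \<ominus>\<^bsub>TR\<^esub> g (uclass a)) \<le> e / 2"
      using canonical_map_contractive[OF gh d] a(2) X ac by (simp only: g.hom_minus)
    finally show ?thesis
      by simp
  qed
  have c: "f X \<in> carrier TR" "g X \<in> carrier TR"
    using X by auto
  then have dc: "f X \<ominus>\<^bsub>TR\<^esub> g X \<in> carrier TR"
    by (rule TR.minus_in_carrier)
  have "nrm TR (f X \<ominus>\<^bsub>TR\<^esub> g X) \<le> 0"
    using small by (rule field_le_epsilon)
  then have "nrm TR (f X \<ominus>\<^bsub>TR\<^esub> g X) = 0"
    using TR.p_nonneg[OF dc] by linarith
  then show ?thesis
    using TR.nrm_eq_zero[OF dc] TR.minus_eq_zero_iff[OF c] by blast
qed

lemma canonical_map_exists: "\<exists>f. is_canonical_map G P f"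
  using universal_property[OF cstar_algebra_TR L_in_TR ev_relation]
  by (auto simp: is_canonical_map_def toeplitz_universal_eq toeplitz_gen_def)

text \<open>\<open>lambda_plus\<close> is singled out among maps that are extensional on the
  carrier; restriction turns any canonical map into such a one.\<close>

lemma is_canonical_map_restrict: "is_canonical_map G P f \<Longrightarrow> is_canonical_map G P (restrict f (carrier TU))"
proof -
  assume f: "is_canonical_map G P f"
  interpret TU: cstar_algebra TU
    by (rule cstar_algebra_TU)
  have "gen p \<in> carrier TU" if "p \<in> P" for p
    using uclass_closed[OF free_gen_in_free[OF that]] by (simp add: universal_class_gen toeplitz_gen_def)
  moreover have "\<one>\<^bsub>TU\<^esub> \<in> carrier TU"
    using monoid.one_closed[OF TU.monoid_A] .
  moreover have "X \<oplus>\<^bsub>TU\<^esub> Y \<in> carrier TU" if "X \<in> carrier TU" "Y \<in> carrier TU" for X Y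
    using abelian_monoid.a_closed[OF TU.abelian_monoid_A that] .
  ultimately show ?thesis
    using f by (simp add: is_canonical_map_def unital_star_hom_def ring_hom_def TU.m_closed Pi_iff)
qed

lemma lambda_plus_canonical: "is_canonical_map G P (lambda_plus G P)"
proof -
  obtain f where f: "is_canonical_map G P f"
    using canonical_map_exists by blast
  let ?f = "restrict f (carrier TU)"
  have "lambda_plus G P = ?f"
    unfolding lambda_plus_def
  proof (rule the_equality)
    fix g assume g: "g \<in> extensional (carrier TU) \<and> is_canonical_map G P g"
    show "g = ?f"
      using g f by (intro extensionalityI[where A = "carrier TU"]) (auto intro: canonical_map_unique)
  qed (use is_canonical_map_restrict[OF f] in simp)
  then show ?thesis
    using is_canonical_map_restrict[OF f] by simp
qed

abbreviation "\<Lambda> \<equiv> lambda_plus G P"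

lemma lambda_plus_hom: "unital_star_hom TU TR \<Lambda>"
  using lambda_plus_canonical by (simp add: is_canonical_map_def)

section \<open>The diagonals\<close>

abbreviation "DU \<equiv> diagonal_universal G P"
abbreviation "DR \<equiv> diagonal_reduced G P"

lemma DU_def: "DU = closed_span TU (eU ` NW)"
  by (simp add: diagonal_universal_def)

lemma DR_def: "DR = closed_span TR (eR ` NW)"
  by (simp add: diagonal_reduced_def)

lemma eU_closed: "\<alpha> \<in> NW \<Longrightarrow> eU \<alpha> \<in> carrier TU"
  by (rule projection_system.e_closed[OF projection_system_TU])

lemma eR_closed: "\<alpha> \<in> NW \<Longrightarrow> eR \<alpha> \<in> carrier TR"
  using projection_system.e_closed[OF projection_system_TR] by (simp add: word_op_TR_ev)

lemma eU_subset: "eU ` NW \<subseteq> carrier TU" and eR_subset: "eR ` NW \<subseteq> carrier TR"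
  using eU_closed eR_closed by auto

lemma Nil_neutral: "[] \<in> NW"
  by (simp add: neutral_words_def)

text \<open>Neutral words are closed under concatenation and their projections are self-adjoint, so
  the closed span is already an algebra.\<close>

lemma cstar_subset_DU: "cstar_subset TU DU"
  unfolding DU_def
proof (rule cstar_algebra.cstar_subset_closed_span[OF cstar_algebra_TU eU_subset])
  show "x \<otimes>\<^bsub>TU\<^esub> y \<in> eU ` NW" if "x \<in> eU ` NW" "y \<in> eU ` NW" for x y
    using that by (auto simp flip: projection_system.e_meet[OF projection_system_TU] intro: neutral_append)
  show "star TU x \<in> eU ` NW" if "x \<in> eU ` NW" for x
    using that by (auto simp: projection_system.e_star[OF projection_system_TU])
qed

lemma one_in_DU: "\<one>\<^bsub>TU\<^esub> \<in> DU"
proof -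
  have "\<one>\<^bsub>TU\<^esub> \<in> eU ` NW"
    using Nil_neutral by (intro image_eqI[of _ _ "[]"]) simp_all
  then show ?thesis
    using cstar_algebra.subset_closed_span[OF cstar_algebra_TU eU_subset] by (auto simp: DU_def)
qed

lemma eR_in_DR: "\<alpha> \<in> NW \<Longrightarrow> eR \<alpha> \<in> DR"
  using cstar_algebra.subset_closed_span[OF cstar_algebra_TR eR_subset] by (auto simp: DR_def)

lemma cstar_subset_DR: "cstar_subset TR DR"
  unfolding DR_def
proof (rule cstar_algebra.cstar_subset_closed_span[OF cstar_algebra_TR eR_subset])
  show "x \<otimes>\<^bsub>TR\<^esub> y \<in> eR ` NW" if xy: "x \<in> eR ` NW" "y \<in> eR ` NW" for x y
  proof -
    obtain \<alpha> \<beta> where "\<alpha> \<in> NW" "\<beta> \<in> NW" "x = eR \<alpha>" "y = eR \<beta>"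
      using xy by blast
    then show ?thesis
      by (intro image_eqI[of _ _ "\<alpha> @ \<beta>"]) (simp_all add: indicator_op_mult word_ideal_neutral_append neutral_append)
  qed
  show "star TR x \<in> eR ` NW" if x: "x \<in> eR ` NW" for x
  proof -
    obtain \<alpha> where \<alpha>: "\<alpha> \<in> NW" "x = eR \<alpha>"
      using x by blast
    then have "star TR x = x"
      using projection_system.e_star[OF projection_system_TR \<alpha>(1)] by (simp only: word_op_TR_ev)
    then show ?thesis
      using x by simp
  qed
qed

lemma one_in_DR: "\<one>\<^bsub>TR\<^esub> \<in> DR"
  using eR_in_DR[OF Nil_neutral] indicator_op_top by simp

lemma DU_subset: "DU \<subseteq> carrier TU" and DR_subset: "DR \<subseteq> carrier TR"
  using cstar_subset_DU cstar_subset_DR by (simp_all add: cstar_subset_def subspace_of_def)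

lemma lambda_plus_eU: "\<alpha> \<in> NW \<Longrightarrow> \<Lambda> (eU \<alpha>) = eR \<alpha>"
proof -
  assume \<alpha>: "\<alpha> \<in> NW"
  interpret star_hom TU TR \<Lambda>
    by (intro star_homI cstar_algebra.axioms(1) cstar_algebra_TU cstar_algebra_TR lambda_plus_hom)
  have gen: "gen p \<in> carrier TU" if "p \<in> P" for p
    using uclass_closed[OF free_gen_in_free[OF that]] by (simp add: universal_class_gen toeplitz_gen_def)
  have "\<Lambda> (eU \<alpha>) = word_op TR (\<Lambda> \<circ> gen) \<alpha>"
    by (rule hom_word_op[OF gen NW_lists[OF \<alpha>], THEN conjunct1])
  also have "\<dots> = word_op TR L \<alpha>"
    using lambda_plus_canonical by (intro word_op_cong[OF NW_lists[OF \<alpha>]]) (simp add: is_canonical_map_def)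
  also have "\<dots> = eR \<alpha>"
    using \<alpha> by (rule word_op_TR_neutral)
  finally show ?thesis .
qed

lemma lambda_plus_lincomb:
  "snd ` set cs \<subseteq> NW \<Longrightarrow> \<Lambda> (lincomb TU eU cs) = lincomb TR eR cs"
proof (induction cs)
  case Nil
  interpret star_hom TU TR \<Lambda>
    by (intro star_homI cstar_algebra.axioms(1) cstar_algebra_TU cstar_algebra_TR lambda_plus_hom)
  show ?case
    using hom_zero by simp
next
  case (Cons ci cs)
  interpret star_hom TU TR \<Lambda>
    by (intro star_homI cstar_algebra.axioms(1) cstar_algebra_TU cstar_algebra_TR lambda_plus_hom)
  obtain c \<alpha> where ci: "ci = (c, \<alpha>)"
    by (cases ci)
  have \<alpha>: "\<alpha> \<in> NW" and cs: "snd ` set cs \<subseteq> NW"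
    using Cons.prems ci by auto
  have "lincomb TU eU cs \<in> carrier TU"
    using eU_closed cs by (rule A.lincomb_closed)
  then show ?case
    using Cons.IH[OF cs] eU_closed[OF \<alpha>]
    by (simp only: ci lincomb_simps hom_add hom_smult A.csmult_closed lambda_plus_eU[OF \<alpha>])
qed

section \<open>Combinations as multiplication operators, and the isometry of the canonical
  map\<close>

abbreviation "symb \<equiv> projection_system.symbol K"

lemma symb_simps: "symb [] g = 0" "symb ((c, \<alpha>) # cs) g = (if g \<in> K \<alpha> then c else 0) + symb cs g"
  by (simp_all add: projection_system.symbol_def[OF projection_system_TU])

lemma lincomb_eR_apply:
  assumes "snd ` set cs \<subseteq> NW" and x: "x \<in> ell2 P"
  shows "lincomb TR eR cs x = (\<lambda>g. symb cs g * x g)"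
  using assms(1)
proof (induction cs)
  case Nil
  then show ?case
    using x by (simp add: ell2_ops_apply symb_simps)
next
  case (Cons ci cs)
  then show ?case
    using x by (cases ci) (auto simp: ell2_ops_apply symb_simps indicator_op_apply fun_eq_iff algebra_simps)
qed

lemma lincomb_eR_closed: "snd ` set cs \<subseteq> NW \<Longrightarrow> lincomb TR eR cs \<in> carrier TR"
  using star_algebra.lincomb_closed[OF cstar_algebra.axioms(1)[OF cstar_algebra_TR] eR_closed] .

lemma lincomb_eU_closed: "snd ` set cs \<subseteq> NW \<Longrightarrow> lincomb TU eU cs \<in> carrier TU"
  using star_algebra.lincomb_closed[OF cstar_algebra.axioms(1)[OF cstar_algebra_TU] eU_closed] .

text \<open>The combination multiplies the unit vector at g by the value of its symbol there, which
  gives the lower bound for the reduced norm.\<close>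

lemma symb_le_nrm:
  assumes cs: "snd ` set cs \<subseteq> NW" and g: "g \<in> P"
  shows "cmod (symb cs g) \<le> nrm TR (lincomb TR eR cs)"
proof -
  let ?T = "lincomb TR eR cs"
  have T: "?T \<in> bounded_ops P"
    using lincomb_eR_closed[OF cs] carrier_TR_subset by blast
  have y: "?T (delta g) \<in> ell2 P"
    using bounded_opsD(2)[OF T delta_in_ell2[OF g]] .
  have "cmod (symb cs g) = cmod (?T (delta g) g)"
    using lincomb_eR_apply[OF cs delta_in_ell2[OF g]] by (simp add: delta_def)
  also have "\<dots> \<le> ell2_norm P (?T (delta g))"
    using y by (rule cmod_le_ell2_norm)
  also have "\<dots> \<le> nrm E ?T * ell2_norm P (delta g)"
    using T delta_in_ell2[OF g] by (rule nrm_ell2_ops_bound)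
  finally show ?thesis
    using g by simp
qed

text \<open>The upper estimate in the reduced algebra. Its contrapositive later finds a point at
  which a combination of large norm has a large symbol.\<close>

lemma nrm_lincomb_eR_le:
  assumes cs: "snd ` set cs \<subseteq> NW" and M: "0 \<le> M" "\<And>g. g \<in> P \<Longrightarrow> cmod (symb cs g) \<le> M"
  shows "nrm TR (lincomb TR eR cs) \<le> M"
proof -
  have "lincomb TR (word_op TR (ev \<circ> free_gen)) cs = lincomb TR eR cs"
    using cs by (intro lincomb_cong word_op_TR_ev) blast
  then show ?thesis
    using projection_system.nrm_lincomb_le[OF projection_system_TR cs M(1)] M(2)
    by (simp add: projection_system.symbol_def[OF projection_system_TU] projection_system.symbol_def[OF projection_system_TR])
qed

lemma lambda_plus_isometric_lincomb:
  assumes cs: "snd ` set cs \<subseteq> NW"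
  shows "nrm TR (\<Lambda> (lincomb TU eU cs)) = nrm TU (lincomb TU eU cs)"
proof (rule antisym)
  show "nrm TR (\<Lambda> (lincomb TU eU cs)) \<le> nrm TU (lincomb TU eU cs)"
    using canonical_map_contractive[OF lambda_plus_hom lincomb_eU_closed[OF cs]] .
  \<comment> \<open>The reduced norm itself serves as the bound M, since it dominates the symbol at
    every point.\<close>
  show "nrm TU (lincomb TU eU cs) \<le> nrm TR (\<Lambda> (lincomb TU eU cs))"
    unfolding lambda_plus_lincomb[OF cs]
  proof (rule projection_system.nrm_lincomb_le[OF projection_system_TU cs])
    show "0 \<le> nrm TR (lincomb TR eR cs)"
      using lincomb_eR_closed[OF cs] carrier_TR_subset nrm_ell2_ops_nonneg by auto
  qed (use symb_le_nrm[OF cs] in simp)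
qed

lemma lambda_plus_isometric_span:
  assumes "X \<in> subspace_of TU hull (eU ` NW)"
  shows "nrm TR (\<Lambda> X) = nrm TU X"
proof -
  obtain cs where "snd ` set cs \<subseteq> NW" "X = lincomb TU eU cs"
    using star_algebra.span_lincomb[OF cstar_algebra.axioms(1)[OF cstar_algebra_TU] eU_closed assms] by blast
  then show ?thesis
    using lambda_plus_isometric_lincomb by simp
qed

lemma lambda_plus_isometric:
  assumes X: "X \<in> DU"
  shows "nrm TR (\<Lambda> X) = nrm TU X"
proof -
  interpret TU: cstar_algebra TU
    by (rule cstar_algebra_TU)
  interpret TR: cstar_algebra TR
    by (rule cstar_algebra_TR)
  interpret star_hom TU TR \<Lambda>
    by (intro star_homI TU.star_algebra_axioms TR.star_algebra_axioms lambda_plus_hom)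
  obtain Y where Y: "\<And>n. Y n \<in> subspace_of TU hull (eU ` NW)" "(\<lambda>n. nrm TU (Y n \<ominus>\<^bsub>TU\<^esub> X)) \<longlonglongrightarrow> 0"
    and Xc: "X \<in> carrier TU"
    using X by (auto simp: DU_def closed_span_def norm_closure_def)
  have Yc: "Y n \<in> carrier TU" for n
    using Y(1) TU.span_subset_carrier[OF eU_subset] by blast
  have 1: "(\<lambda>n. nrm TU (Y n)) \<longlonglongrightarrow> nrm TU X"
    using TU.nrm_tendsto[OF Y(2) Yc Xc] .
  have "(\<lambda>n. nrm TR (\<Lambda> (Y n) \<ominus>\<^bsub>TR\<^esub> \<Lambda> X)) \<longlonglongrightarrow> 0"
  proof (rule Lim_null_comparison[OF _ Y(2)], intro eventuallyI)
    fix n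
    have c: "Y n \<ominus>\<^bsub>TU\<^esub> X \<in> carrier TU"
      using Yc Xc by (simp add: TU.minus_eq_csmult)
    show "norm (nrm TR (\<Lambda> (Y n) \<ominus>\<^bsub>TR\<^esub> \<Lambda> X)) \<le> nrm TU (Y n \<ominus>\<^bsub>TU\<^esub> X)"
      using canonical_map_contractive[OF lambda_plus_hom c] TR.p_nonneg[OF hom_closed[OF c]]
      by (simp only: hom_minus[OF Yc Xc] real_norm_def abs_of_nonneg)
  qed
  then have "(\<lambda>n. nrm TR (\<Lambda> (Y n))) \<longlonglongrightarrow> nrm TR (\<Lambda> X)"
    by (rule TR.nrm_tendsto) (use Yc Xc in auto)
  then have "(\<lambda>n. nrm TU (Y n)) \<longlonglongrightarrow> nrm TR (\<Lambda> X)"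
    by (simp only: lambda_plus_isometric_span[OF Y(1)])
  then show ?thesis
    using 1 LIMSEQ_unique by blast
qed

lemma minus_in_DU: "\<lbrakk>X \<in> DU; Y \<in> DU\<rbrakk> \<Longrightarrow> X \<ominus>\<^bsub>TU\<^esub> Y \<in> DU"
  using cstar_subset_DU DU_subset star_algebra.minus_eq_csmult[OF cstar_algebra.axioms(1)[OF cstar_algebra_TU], of X Y]
  by (auto simp: cstar_subset_def subspace_of_def subset_iff)

lemma minus_in_DR: "\<lbrakk>X \<in> DR; Y \<in> DR\<rbrakk> \<Longrightarrow> X \<ominus>\<^bsub>TR\<^esub> Y \<in> DR"
  using cstar_subset_DR DR_subset star_algebra.minus_eq_csmult[OF cstar_algebra.axioms(1)[OF cstar_algebra_TR], of X Y]
  by (auto simp: cstar_subset_def subspace_of_def subset_iff)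

lemma lambda_plus_maps_DU: "X \<in> DU \<Longrightarrow> \<Lambda> X \<in> DR"
proof -
  assume X: "X \<in> DU"
  have "\<Lambda> ` eU ` NW = eR ` NW"
    using lambda_plus_eU by (force simp: image_iff)
  then show ?thesis
    using closed_span_hom[OF cstar_algebra_TU cstar_algebra_TR lambda_plus_hom canonical_map_contractive[OF lambda_plus_hom]
        eU_subset X[unfolded DU_def]]
    by (simp add: DR_def)
qed

lemma lambda_plus_inj_on: "inj_on \<Lambda> DU"
proof (rule inj_onI)
  fix X Y assume X: "X \<in> DU" and Y: "Y \<in> DU" and eq: "\<Lambda> X = \<Lambda> Y"
  interpret TU: cstar_algebra TU
    by (rule cstar_algebra_TU)
  interpret TR: cstar_algebra TR
    by (rule cstar_algebra_TR)
  interpret star_hom TU TR \<Lambda>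
    by (intro star_homI TU.star_algebra_axioms TR.star_algebra_axioms lambda_plus_hom)
  have c: "X \<in> carrier TU" "Y \<in> carrier TU"
    using X Y DU_subset by auto
  have "nrm TU (X \<ominus>\<^bsub>TU\<^esub> Y) = nrm TR (\<Lambda> X \<ominus>\<^bsub>TR\<^esub> \<Lambda> Y)"
    using lambda_plus_isometric[OF minus_in_DU[OF X Y]] hom_minus[OF c] by simp
  also have "\<dots> = 0"
    unfolding eq TR.minus_self[OF hom_closed[OF c(2)]] by (rule TR.p_zero)
  finally have "X \<ominus>\<^bsub>TU\<^esub> Y = \<zero>\<^bsub>TU\<^esub>"
    using minus_in_DU[OF X Y] DU_subset by (intro TU.nrm_eq_zero) auto
  then show "X = Y"
    using TU.minus_eq_zero_iff[OF c] by blast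
qed

text \<open>Combinations approximating Z are lifted with the same coefficients. The isometry makes
  the lifts a Cauchy sequence, and their limit is a preimage.\<close>

lemma lambda_plus_surj: "DR \<subseteq> \<Lambda> ` DU"
proof
  fix Z assume "Z \<in> DR"
  interpret TU: cstar_algebra TU
    by (rule cstar_algebra_TU)
  interpret TR: cstar_algebra TR
    by (rule cstar_algebra_TR)
  interpret star_hom TU TR \<Lambda>
    by (intro star_homI TU.star_algebra_axioms TR.star_algebra_axioms lambda_plus_hom)
  obtain Y where Y: "\<And>n. Y n \<in> subspace_of TR hull (eR ` NW)" "(\<lambda>n. nrm TR (Y n \<ominus>\<^bsub>TR\<^esub> Z)) \<longlonglongrightarrow> 0"
    and Zc: "Z \<in> carrier TR"
    using \<open>Z \<in> DR\<close> by (auto simp: DR_def closed_span_def norm_closure_def)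
  have "\<exists>cs. snd ` set cs \<subseteq> NW \<and> Y n = lincomb TR eR cs" for n
    using TR.span_lincomb[OF eR_closed Y(1)] .
  then obtain cs where cs: "\<And>n. snd ` set (cs n) \<subseteq> NW" "\<And>n. Y n = lincomb TR eR (cs n)"
    by metis
  define X where "X n = lincomb TU eU (cs n)" for n
  have Xc: "X n \<in> carrier TU" for n
    unfolding X_def by (rule lincomb_eU_closed[OF cs(1)])
  have lX: "\<Lambda> (X n) = Y n" for n
    unfolding X_def cs(2) by (rule lambda_plus_lincomb[OF cs(1)])
  have span: "X n \<in> subspace_of TU hull (eU ` NW)" for n
  proof -
    define V where "V = subspace_of TU hull (eU ` NW)"
    have sub: "subspace_of TU V"
      unfolding V_def by (rule TU.subspace_span[OF eU_subset])
    have e: "eU \<alpha> \<in> V" if "\<alpha> \<in> NW" for \<alpha>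
      unfolding V_def using that hull_subset[of "eU ` NW" "subspace_of TU"] by blast
    have "lincomb TU eU ds \<in> V" if "snd ` set ds \<subseteq> NW" for ds
      using that
    proof (induction ds)
      case Nil
      then show ?case
        using sub by (simp add: subspace_of_def)
    next
      case (Cons d ds)
      then show ?case
        using sub e by (cases d) (auto simp: subspace_of_def)
    qed
    then show ?thesis
      unfolding X_def V_def[symmetric] using cs(1) by blast
  qed
  have inDU: "X n \<in> DU" for n
    using TU.subset_norm_closure[OF TU.span_subset_carrier[OF eU_subset]] span by (auto simp: DU_def closed_span_def)
  have iso: "nrm TU (X m \<ominus>\<^bsub>TU\<^esub> X n) = nrm TR (Y m \<ominus>\<^bsub>TR\<^esub> Y n)" for m n
    using lambda_plus_isometric[OF minus_in_DU[OF inDU inDU]] hom_minus[OF Xc Xc] by (simp only: lX)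
  have Yc: "Y n \<in> carrier TR" for n
    unfolding cs(2) by (rule lincomb_eR_closed[OF cs(1)])
  have "Y \<in> cauchy_seqs TR (nrm TR)"
    using Yc Zc Y(2) by (rule TR.convergent_imp_cauchy_seqs)
  then have "X \<in> cauchy_seqs TU (nrm TU)"
    using Xc by (simp add: cauchy_seqs_def iso del: TR_simps)
  then obtain l where l: "l \<in> carrier TU" "(\<lambda>n. nrm TU (X n \<ominus>\<^bsub>TU\<^esub> l)) \<longlonglongrightarrow> 0"
    using TU.complete by blast
  have lDU: "l \<in> DU"
    unfolding DU_def closed_span_def norm_closure_def using l span by blast
  have "(\<lambda>n. nrm TR (Y n \<ominus>\<^bsub>TR\<^esub> \<Lambda> l)) \<longlonglongrightarrow> 0"
    using l(2) lambda_plus_isometric[OF minus_in_DU[OF inDU lDU]]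
    by (simp only: hom_minus[OF Xc l(1)] lX)
  then have "\<Lambda> l = Z"
    by (rule TR.limit_unique[OF _ Y(2)]) (use Yc Zc l(1) in auto)
  then show "Z \<in> \<Lambda> ` DU"
    using lDU by blast
qed

lemma lambda_plus_diagonal_iso:
  "cstar_iso (TU\<lparr>carrier := DU\<rparr>) (TR\<lparr>carrier := DR\<rparr>) (restrict \<Lambda> DU)"
  unfolding cstar_iso_def
proof (intro conjI)
  show "cstar_algebra (TU\<lparr>carrier := DU\<rparr>)"
    by (rule cstar_algebra.cstar_algebra_subset[OF cstar_algebra_TU cstar_subset_DU one_in_DU])
  show "cstar_algebra (TR\<lparr>carrier := DR\<rparr>)"
    by (rule cstar_algebra.cstar_algebra_subset[OF cstar_algebra_TR cstar_subset_DR one_in_DR])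
  show "unital_star_hom (TU\<lparr>carrier := DU\<rparr>) (TR\<lparr>carrier := DR\<rparr>) (restrict \<Lambda> DU)"
  proof -
    interpret star_hom TU TR \<Lambda>
      by (intro star_homI cstar_algebra.axioms(1) cstar_algebra_TU cstar_algebra_TR lambda_plus_hom)
    have c: "X \<in> carrier TU" if "X \<in> DU" for X
      using that DU_subset by blast
    show ?thesis
      using cstar_subset_DU one_in_DU
      by (auto simp: unital_star_hom_def ring_hom_def cstar_subset_def subspace_of_def lambda_plus_maps_DU
        hom_mult[OF c c] hom_add[OF c c] hom_smult[OF c] hom_star[OF c] hom_one simp del: TR_simps)
  qed
  show "bij_betw (restrict \<Lambda> DU) (carrier (TU\<lparr>carrier := DU\<rparr>)) (carrier (TR\<lparr>carrier := DR\<rparr>))"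
    using lambda_plus_inj_on lambda_plus_surj lambda_plus_maps_DU
    by (auto simp: bij_betw_def inj_on_restrict_eq)
qed

section \<open>Jointly proper representations\<close>

lemma list_product_TR: "list_product TR xs = list_product E xs"
  by (simp add: list_product_def)

lemma eR_complement:
  assumes "\<alpha> \<in> NW"
  shows "\<one>\<^bsub>TR\<^esub> \<ominus>\<^bsub>TR\<^esub> eR \<alpha> = indicator_op P (P - K \<alpha>)"
proof -
  have "\<one>\<^bsub>TR\<^esub> \<ominus>\<^bsub>TR\<^esub> eR \<alpha> = \<one>\<^bsub>TR\<^esub> \<ominus>\<^bsub>E\<^esub> eR \<alpha>"
    using monoid.one_closed[OF star_algebra.monoid_A[OF cstar_algebra.axioms(1)[OF cstar_algebra_TR]]] eR_closed[OF assms]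
    by (rule minus_TR)
  also have "\<dots> = indicator_op P P \<ominus>\<^bsub>E\<^esub> eR \<alpha>"
    by (simp add: indicator_op_top)
  also have "\<dots> = indicator_op P (P - K \<alpha>)"
    by (rule indicator_op_diff[OF word_ideal_subset])
  finally show ?thesis .
qed

lemma product_complements:
  assumes "\<alpha>s \<in> lists NW"
  shows "list_product TR (map (\<lambda>\<alpha>. \<one>\<^bsub>TR\<^esub> \<ominus>\<^bsub>TR\<^esub> word_op TR L \<alpha>) \<alpha>s) =
    indicator_op P {g \<in> P. \<forall>\<alpha>\<in>set \<alpha>s. g \<notin> K \<alpha>}"
proof -
  have "map (\<lambda>\<alpha>. \<one>\<^bsub>TR\<^esub> \<ominus>\<^bsub>TR\<^esub> word_op TR L \<alpha>) \<alpha>s = map (\<lambda>\<alpha>. indicator_op P (P - K \<alpha>)) \<alpha>s"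
    using assms by (auto simp only: map_eq_conv word_op_TR_neutral eR_complement in_lists_conv_set)
  then have "list_product TR (map (\<lambda>\<alpha>. \<one>\<^bsub>TR\<^esub> \<ominus>\<^bsub>TR\<^esub> word_op TR L \<alpha>) \<alpha>s) =
      indicator_op P {g \<in> P. \<forall>\<alpha>\<in>set \<alpha>s. g \<in> P - K \<alpha>}"
    by (simp only: list_product_TR list_product_indicator)
  also have "\<dots> = indicator_op P {g \<in> P. \<forall>\<alpha>\<in>set \<alpha>s. g \<notin> K \<alpha>}"
    by (rule indicator_op_cong) auto
  finally show ?thesis .
qed

text \<open>A right ideal containing the unit is all of P. Thus the condition in joint properness
  says that the unit lies outside the ideal.\<close>

lemma one_in_word_ideal_iff: "\<alpha> \<in> NW \<Longrightarrow> \<one> \<in> K \<alpha> \<longleftrightarrow> K \<alpha> = P"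
proof
  assume \<alpha>: "\<alpha> \<in> NW" and "\<one> \<in> K \<alpha>"
  then have "p \<in> K \<alpha>" if "p \<in> P" for p
    using word_ideal_right[OF NW_lists[OF \<alpha>], of \<one> p] that by simp
  then show "K \<alpha> = P"
    using word_ideal_subset by blast
qed simp

lemma indicator_op_nonzero: "\<lbrakk>g \<in> A; g \<in> P\<rbrakk> \<Longrightarrow> indicator_op P A \<noteq> \<zero>\<^bsub>TR\<^esub>"
proof
  assume g: "g \<in> A" "g \<in> P" and eq: "indicator_op P A = \<zero>\<^bsub>TR\<^esub>"
  have "indicator_op P A (delta g) g = \<zero>\<^bsub>TR\<^esub> (delta g) g"
    by (simp only: eq)
  then show False
    using g delta_in_ell2[OF g(2)] by (simp add: indicator_op_apply ell2_ops_apply) (simp add: delta_def)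
qed

text \<open>The points that the listed words do not tell apart from g. The symbol of any combination
  of these words is constant on it.\<close>

definition atom_at :: "'g \<Rightarrow> ('g \<times> 'g) list list \<Rightarrow> 'g set" where
  "atom_at g \<alpha>s = {h \<in> P. \<forall>\<alpha>\<in>set \<alpha>s. h \<in> K \<alpha> \<longleftrightarrow> g \<in> K \<alpha>}"

lemma atom_at_closed:
  assumes "\<alpha>s \<in> lists NW"
  shows "indicator_op P (atom_at g \<alpha>s) \<in> carrier TR"
proof -
  interpret A: star_algebra TR
    by (rule cstar_algebra.axioms(1)[OF cstar_algebra_TR])
  \<comment> \<open>For each word the side containing g is taken; the intersection of these sides is
    the atom.\<close>
  let ?A = "\<lambda>\<alpha>. if g \<in> K \<alpha> then K \<alpha> else P - K \<alpha>"
  have "indicator_op P (?A \<alpha>) \<in> carrier TR" if "\<alpha> \<in> set \<alpha>s" for \<alpha>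
  proof -
    have \<alpha>: "\<alpha> \<in> NW"
      using that assms by auto
    show ?thesis
      using eR_closed[OF \<alpha>] eR_complement[OF \<alpha>] A.minus_in_carrier[OF monoid.one_closed[OF A.monoid_A] eR_closed[OF \<alpha>]]
      by (simp split: if_split)
  qed
  then have "list_product TR (map (\<lambda>\<alpha>. indicator_op P (?A \<alpha>)) \<alpha>s) \<in> carrier TR"
    by (intro A.list_product_closed) auto
  also have "list_product TR (map (\<lambda>\<alpha>. indicator_op P (?A \<alpha>)) \<alpha>s) = indicator_op P (atom_at g \<alpha>s)"
    unfolding list_product_TR list_product_indicator atom_at_def
    by (rule indicator_op_cong) auto
  finally show ?thesis .
qed

context
  fixes B :: "('b, 'n) cstar_alg_scheme" and \<pi> :: "(('g \<Rightarrow> complex) \<Rightarrow> 'g \<Rightarrow> complex) \<Rightarrow> 'b"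
  assumes B: "cstar_algebra B" and \<pi>: "unital_star_hom TR B \<pi>"
begin

lemma hom_product_complements:
  assumes "\<alpha>s \<in> lists NW"
  shows "\<pi> (list_product TR (map (\<lambda>\<alpha>. \<one>\<^bsub>TR\<^esub> \<ominus>\<^bsub>TR\<^esub> word_op TR L \<alpha>) \<alpha>s)) =
    list_product B (map (\<lambda>\<alpha>. \<one>\<^bsub>B\<^esub> \<ominus>\<^bsub>B\<^esub> \<pi> (word_op TR L \<alpha>)) \<alpha>s)"
proof -
  interpret star_hom TR B \<pi>
    by (intro star_homI cstar_algebra.axioms(1) cstar_algebra_TR B \<pi>)
  have one: "\<one>\<^bsub>TR\<^esub> \<in> carrier TR"
    by (rule monoid.one_closed[OF A.monoid_A])
  have w: "word_op TR L \<alpha> \<in> carrier TR" if "\<alpha> \<in> set \<alpha>s" for \<alpha>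
    using that assms eR_closed by (auto simp: word_op_TR_neutral)
  have "set (map (\<lambda>\<alpha>. \<one>\<^bsub>TR\<^esub> \<ominus>\<^bsub>TR\<^esub> word_op TR L \<alpha>) \<alpha>s) \<subseteq> carrier TR"
    using A.minus_in_carrier[OF one w] by (simp only: set_map image_subset_iff) blast
  from hom_list_product[OF this] show ?thesis
    using hom_minus[OF one w] by (simp only: map_map comp_def hom_one cong: map_cong)
qed

text \<open>The product of the complements is the indicator of a set containing the unit, so it is a
  nonzero element of the diagonal, and an injective \<open>\<pi>\<close> cannot send it to
  zero.\<close>

lemma jointly_proper_if_injective:
  assumes inj: "inj_on \<pi> DR"
  shows "jointly_proper G P B \<pi>"
  unfolding jointly_proper_def
proof (intro ballI impI)
  interpret star_hom TR B \<pi>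
    by (intro star_homI cstar_algebra.axioms(1) cstar_algebra_TR B \<pi>)
  fix \<alpha>s assume \<alpha>s: "\<alpha>s \<in> lists NW" and proper: "distinct \<alpha>s \<and> (\<forall>\<alpha>\<in>set \<alpha>s. K \<alpha> \<noteq> P)"
  let ?Q = "list_product TR (map (\<lambda>\<alpha>. \<one>\<^bsub>TR\<^esub> \<ominus>\<^bsub>TR\<^esub> word_op TR L \<alpha>) \<alpha>s)"
  have "?Q \<in> DR"
    using \<alpha>s
  proof (induction rule: lists.induct)
    case Nil
    then show ?case
      using one_in_DR by simp
  next
    case (Cons \<alpha> \<alpha>s)
    have "\<one>\<^bsub>TR\<^esub> \<ominus>\<^bsub>TR\<^esub> word_op TR L \<alpha> \<in> DR"
      using minus_in_DR[OF one_in_DR eR_in_DR[OF Cons(1)]] by (simp only: word_op_TR_neutral[OF Cons(1)])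
    then show ?case
      using cstar_subset_DR Cons.IH unfolding cstar_subset_def list.map list_product_simps by blast
  qed
  moreover have "\<zero>\<^bsub>TR\<^esub> \<in> DR"
    using cstar_subset_DR by (simp only: cstar_subset_def subspace_of_def)
  moreover have "?Q \<noteq> \<zero>\<^bsub>TR\<^esub>"
    unfolding product_complements[OF \<alpha>s]
  proof (rule indicator_op_nonzero[OF _ P_one])
    show "\<one> \<in> {g \<in> P. \<forall>\<alpha>\<in>set \<alpha>s. g \<notin> K \<alpha>}"
      using proper \<alpha>s one_in_word_ideal_iff by auto
  qed
  ultimately have "\<pi> ?Q \<noteq> \<pi> \<zero>\<^bsub>TR\<^esub>"
    using inj unfolding inj_on_def by blast
  then show "list_product B (map (\<lambda>\<alpha>. \<one>\<^bsub>B\<^esub> \<ominus>\<^bsub>B\<^esub> \<pi> (word_op TR L \<alpha>)) \<alpha>s) \<noteq> \<zero>\<^bsub>B\<^esub>"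
    unfolding hom_product_complements[OF \<alpha>s] hom_zero .
qed

text \<open>Conjugating by the isometry \<open>L g\<close> moves the point \<open>g\<close> to the unit, so the atom becomes a
  product of the kind that joint properness controls.\<close>

lemma atom_not_in_kernel:
  assumes proper: "jointly_proper G P B \<pi>" and \<alpha>s: "\<alpha>s \<in> lists NW" and g: "g \<in> P"
  shows "\<pi> (indicator_op P (atom_at g \<alpha>s)) \<noteq> \<zero>\<^bsub>B\<^esub>"
proof
  interpret star_hom TR B \<pi>
    by (intro star_homI cstar_algebra.axioms(1) cstar_algebra_TR B \<pi>)
  let ?q = "indicator_op P (atom_at g \<alpha>s)"
  assume zero: "\<pi> ?q = \<zero>\<^bsub>B\<^esub>"
  \<comment> \<open>Only the words whose ideal misses g give a condition: if g lies in K(\<alpha>),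
    so does g h for every h in P, because K(\<alpha>) is a right ideal. Duplicates are removed to
    meet the distinctness in \<open>jointly_proper\<close>.\<close>
  let ?\<beta>s = "remdups (map (translate_word g) (filter (\<lambda>\<alpha>. g \<notin> K \<alpha>) \<alpha>s))"
  have \<alpha>: "\<alpha> \<in> NW" if "\<alpha> \<in> set \<alpha>s" for \<alpha>
    using that \<alpha>s by auto
  have \<beta>s: "?\<beta>s \<in> lists NW"
    using neutral_translate_word[OF g \<alpha>] by auto
  have Lg: "L g \<in> carrier TR" "star TR (L g) \<in> carrier TR"
    by (rule L_in_TR[OF g], rule A.star_closed[OF L_in_TR[OF g]])
  note q = atom_at_closed[OF \<alpha>s, of g]
  have Lgb: "L g \<in> bounded_ops P" and qb: "?q \<in> bounded_ops P"
    using Lg q carrier_TR_subset by auto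
  have "star E (L g) \<otimes>\<^bsub>E\<^esub> (?q \<otimes>\<^bsub>E\<^esub> L g) = indicator_op P {h \<in> P. \<forall>\<beta>\<in>set ?\<beta>s. h \<notin> K \<beta>}"
  proof (rule bounded_ops_eqI[OF _ indicator_op_bounded])
    show "star E (L g) \<otimes>\<^bsub>E\<^esub> (?q \<otimes>\<^bsub>E\<^esub> L g) \<in> bounded_ops P"
      by (intro bounded_ops_mult star_E_closed Lgb qb)
    fix x assume x: "x \<in> ell2 P"
    have y: "L g x \<in> ell2 P" "?q (L g x) \<in> ell2 P"
      using x Lgb qb by (auto simp: bounded_opsD(2))
    show "(star E (L g) \<otimes>\<^bsub>E\<^esub> (?q \<otimes>\<^bsub>E\<^esub> L g)) x = indicator_op P {h \<in> P. \<forall>\<beta>\<in>set ?\<beta>s. h \<notin> K \<beta>} x"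
    proof
      fix h
      show "(star E (L g) \<otimes>\<^bsub>E\<^esub> (?q \<otimes>\<^bsub>E\<^esub> L g)) x h = indicator_op P {h \<in> P. \<forall>\<beta>\<in>set ?\<beta>s. h \<notin> K \<beta>} x h"
      proof (cases "h \<in> P")
        case h: True
        have "inv g \<otimes> (g \<otimes> h) = h"
          using g h by (simp add: m_assoc[symmetric])
        then have "L g x (g \<otimes> h) = x h"
          using left_shift_apply[OF g x, of "g \<otimes> h"] g h by simp
        moreover have "g \<otimes> h \<in> atom_at g \<alpha>s \<longleftrightarrow> (\<forall>\<beta>\<in>set ?\<beta>s. h \<notin> K \<beta>)"
          using word_ideal_translate_word[OF g \<alpha>] word_ideal_right[OF NW_lists[OF \<alpha>] _ h] g h
          by (auto simp: atom_at_def)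
        ultimately show ?thesis
          using h x y star_left_shift_apply[OF g y(2), of h]
          by (auto simp: ell2_ops_apply indicator_op_apply)
      next
        case False
        then show ?thesis
          using x y star_left_shift_apply[OF g y(2), of h] by (simp add: ell2_ops_apply indicator_op_apply)
      qed
    qed
  qed
  then have "star TR (L g) \<otimes>\<^bsub>TR\<^esub> (?q \<otimes>\<^bsub>TR\<^esub> L g) =
      list_product TR (map (\<lambda>\<alpha>. \<one>\<^bsub>TR\<^esub> \<ominus>\<^bsub>TR\<^esub> word_op TR L \<alpha>) ?\<beta>s)"
    unfolding product_complements[OF \<beta>s] by (simp only: TR_simps)
  then have "\<pi> (star TR (L g) \<otimes>\<^bsub>TR\<^esub> (?q \<otimes>\<^bsub>TR\<^esub> L g)) =
      list_product B (map (\<lambda>\<alpha>. \<one>\<^bsub>B\<^esub> \<ominus>\<^bsub>B\<^esub> \<pi> (word_op TR L \<alpha>)) ?\<beta>s)"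
    by (simp only: hom_product_complements[OF \<beta>s])
  moreover have "\<pi> (star TR (L g) \<otimes>\<^bsub>TR\<^esub> (?q \<otimes>\<^bsub>TR\<^esub> L g)) = \<zero>\<^bsub>B\<^esub>"
    using Lg q zero by (simp only: hom_mult A.m_closed) (simp add: B.l_null B.r_null hom_closed del: TR_simps)
  \<comment> \<open>The unit in the ideal of a translated word would put g into the original ideal,
    which the filter excludes.\<close>
  moreover have "K \<beta> \<noteq> P" if \<beta>: "\<beta> \<in> set ?\<beta>s" for \<beta>
  proof -
    obtain \<alpha> where "\<alpha> \<in> set \<alpha>s" "g \<notin> K \<alpha>" "\<beta> = translate_word g \<alpha>"
      using \<beta> by auto
    then have "\<one> \<notin> K \<beta>"
      using word_ideal_translate_word[OF g \<alpha>] g by auto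
    then show ?thesis
      using P_one by blast
  qed
  ultimately show False
    using proper \<beta>s unfolding jointly_proper_def by (metis distinct_remdups)
qed

lemma injective_if_jointly_proper:
  assumes proper: "jointly_proper G P B \<pi>"
  shows "inj_on \<pi> DR"
proof (rule inj_onI, rule ccontr)
  interpret TR: cstar_algebra TR
    by (rule cstar_algebra_TR)
  interpret B: cstar_algebra B
    by (rule B)
  interpret star_hom TR B \<pi>
    by (intro star_homI TR.star_algebra_axioms B.star_algebra_axioms \<pi>)
  fix x y assume x: "x \<in> DR" and y: "y \<in> DR" and eq: "\<pi> x = \<pi> y" and "x \<noteq> y"
  have c: "x \<in> carrier TR" "y \<in> carrier TR"
    using x y DR_subset by auto
  define a where "a = x \<ominus>\<^bsub>TR\<^esub> y"
  have aD: "a \<in> DR"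
    unfolding a_def using x y by (rule minus_in_DR)
  then have ac: "a \<in> carrier TR"
    using DR_subset by blast
  have a0: "\<pi> a = \<zero>\<^bsub>B\<^esub>"
    unfolding a_def hom_minus[OF c] eq using c by (intro B.minus_self hom_closed)
  have "nrm TR a \<noteq> 0"
    using TR.nrm_eq_zero[OF ac] TR.minus_eq_zero_iff[OF c] \<open>x \<noteq> y\<close> by (auto simp only: a_def)
  then have pos: "nrm TR a > 0"
    using TR.p_nonneg[OF ac] by linarith
  \<comment> \<open>With error e the norm of b exceeds 3 e, so its symbol exceeds 2 e somewhere.
    That value still dominates the error of b - a, which is below e.\<close>
  define e where "e = nrm TR a / 4"
  have e: "e > 0"
    using pos by (simp add: e_def)
  have "a \<in> norm_closure TR (subspace_of TR hull (eR ` NW))"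
    using aD by (simp only: DR_def closed_span_def)
  then obtain b where b: "b \<in> subspace_of TR hull (eR ` NW)" "nrm TR (b \<ominus>\<^bsub>TR\<^esub> a) < e"
    using TR.norm_closure_iff[OF TR.span_subset_carrier[OF eR_subset]] e by blast
  obtain cs where cs: "snd ` set cs \<subseteq> NW" "b = lincomb TR eR cs"
    using TR.span_lincomb[OF eR_closed b(1)] by blast
  have bc: "b \<in> carrier TR"
    unfolding cs(2) by (rule lincomb_eR_closed[OF cs(1)])
  have "\<exists>g\<in>P. cmod (symb cs g) > 2 * e"
  proof (rule ccontr)
    assume "\<not> ?thesis"
    then have "nrm TR b \<le> 2 * e"
      unfolding cs(2) using e by (intro nrm_lincomb_eR_le[OF cs(1)]) (auto simp: not_less)
    moreover have "nrm TR a - nrm TR b \<le> nrm TR (b \<ominus>\<^bsub>TR\<^esub> a)"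
      using TR.p_diff_le[OF bc ac] by linarith
    ultimately show False
      using b(2) e e_def by linarith
  qed
  then obtain g where g: "g \<in> P" "cmod (symb cs g) > 2 * e"
    by blast
  define s where "s = symb cs g"
  have s: "cmod s > 2 * e" "s \<noteq> 0"
    using g(2) e by (auto simp: s_def)
  \<comment> \<open>The relative error on the atom: there b is the scalar s, so q a = s q (\<one> -
    d) for the atom projection q.\<close>
  define d where "d = inverse s \<odot>\<^bsub>TR\<^esub> (b \<ominus>\<^bsub>TR\<^esub> a)"
  have bac: "b \<ominus>\<^bsub>TR\<^esub> a \<in> carrier TR"
    using bc ac by (rule TR.minus_in_carrier)
  then have dc: "d \<in> carrier TR"
    unfolding d_def by (rule TR.csmult_closed)
  have "nrm TR d = inverse (cmod s) * nrm TR (b \<ominus>\<^bsub>TR\<^esub> a)"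
    unfolding d_def TR.p_smult[OF bac] norm_inverse ..
  also have "\<dots> < inverse (cmod s) * cmod s"
    using b(2) s e by (intro mult_strict_left_mono) auto
  also have "\<dots> = 1"
    using s(2) by simp
  finally obtain u where u: "u \<in> carrier TR" "(\<one>\<^bsub>TR\<^esub> \<ominus>\<^bsub>TR\<^esub> d) \<otimes>\<^bsub>TR\<^esub> u = \<one>\<^bsub>TR\<^esub>"
    using TR.neumann_inverse[OF dc] by blast
  let ?\<alpha>s = "map snd cs"
  have \<alpha>s: "?\<alpha>s \<in> lists NW"
    using cs(1) by auto
  let ?q = "indicator_op P (atom_at g ?\<alpha>s)"
  note q = atom_at_closed[OF \<alpha>s, of g]
  have one: "\<one>\<^bsub>TR\<^esub> \<in> carrier TR"
    by (rule monoid.one_closed[OF TR.monoid_A])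
  have qb: "?q \<otimes>\<^bsub>TR\<^esub> b = s \<odot>\<^bsub>TR\<^esub> ?q"
  proof (rule bounded_ops_eqI)
    show "?q \<otimes>\<^bsub>TR\<^esub> b \<in> bounded_ops P" "s \<odot>\<^bsub>TR\<^esub> ?q \<in> bounded_ops P"
      using TR.m_closed[OF q bc] TR.csmult_closed[OF q] carrier_TR_subset by blast+
    fix x assume x: "x \<in> ell2 P"
    have "b \<in> bounded_ops P"
      using bc carrier_TR_subset by blast
    then have bx: "b x \<in> ell2 P"
      using x by (rule bounded_opsD(2))
    \<comment> \<open>Points of the atom lie in the same ideals as g, so each term of the symbol has
      the value it has at g.\<close>
    have const: "symb cs h = s" if "h \<in> atom_at g ?\<alpha>s" for h
    proof -
      have "symb ds h = symb ds g" if "\<forall>\<alpha>\<in>set (map snd ds). h \<in> K \<alpha> \<longleftrightarrow> g \<in> K \<alpha>" for ds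
        using that by (induction ds) (auto simp: symb_simps)
      then show ?thesis
        using that unfolding s_def atom_at_def by blast
    qed
    have "(?q \<otimes>\<^bsub>TR\<^esub> b) x = ?q (b x)"
      using x by (simp add: ell2_ops_apply)
    also have "\<dots> = (\<lambda>h. if h \<in> atom_at g ?\<alpha>s then b x h else 0)"
      using bx by (rule indicator_op_apply)
    also have "\<dots> = (\<lambda>h. if h \<in> atom_at g ?\<alpha>s then s * x h else 0)"
      unfolding lincomb_eR_apply[OF cs(1) x, folded cs(2)] using const by (auto simp: fun_eq_iff)
    also have "\<dots> = (s \<odot>\<^bsub>TR\<^esub> ?q) x"
      using x by (auto simp: ell2_ops_apply indicator_op_apply)
    finally show "(?q \<otimes>\<^bsub>TR\<^esub> b) x = (s \<odot>\<^bsub>TR\<^esub> ?q) x" .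
  qed
  have "?q \<otimes>\<^bsub>TR\<^esub> (\<one>\<^bsub>TR\<^esub> \<ominus>\<^bsub>TR\<^esub> d) = inverse s \<odot>\<^bsub>TR\<^esub> (?q \<otimes>\<^bsub>TR\<^esub> a)"
  proof -
    have "?q \<otimes>\<^bsub>TR\<^esub> d = inverse s \<odot>\<^bsub>TR\<^esub> (s \<odot>\<^bsub>TR\<^esub> ?q \<ominus>\<^bsub>TR\<^esub> ?q \<otimes>\<^bsub>TR\<^esub> a)"
      unfolding d_def using q bc ac
      by (simp add: TR.smult_mult_right TR.minus_eq_csmult TR.r_distr flip: qb del: TR_simps)
    also have "\<dots> = ?q \<ominus>\<^bsub>TR\<^esub> inverse s \<odot>\<^bsub>TR\<^esub> (?q \<otimes>\<^bsub>TR\<^esub> a)"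
      using q ac s(2) by (simp add: TR.csmult_minus TR.csmult_assoc TR.m_closed del: TR_simps)
    finally have qd: "?q \<otimes>\<^bsub>TR\<^esub> d = ?q \<ominus>\<^bsub>TR\<^esub> inverse s \<odot>\<^bsub>TR\<^esub> (?q \<otimes>\<^bsub>TR\<^esub> a)" .
    let ?z = "inverse s \<odot>\<^bsub>TR\<^esub> (?q \<otimes>\<^bsub>TR\<^esub> a)"
    have z: "?z \<in> carrier TR"
      using q ac by (intro TR.csmult_closed TR.m_closed)
    have "?q \<otimes>\<^bsub>TR\<^esub> (\<one>\<^bsub>TR\<^esub> \<ominus>\<^bsub>TR\<^esub> d) = ?q \<ominus>\<^bsub>TR\<^esub> ?q \<otimes>\<^bsub>TR\<^esub> d"
      using q dc one TR.m_closed[OF q dc] by (simp add: TR.minus_eq_csmult TR.r_distr TR.r_one TR.smult_mult_right del: TR_simps)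
    also have "\<dots> = ?q \<ominus>\<^bsub>TR\<^esub> (?q \<ominus>\<^bsub>TR\<^esub> ?z)"
      by (simp only: qd)
    also have "\<dots> = ?z"
      using q z by (rule TR.minus_minus_cancel)
    finally show ?thesis .
  qed
  moreover have "\<pi> (inverse s \<odot>\<^bsub>TR\<^esub> (?q \<otimes>\<^bsub>TR\<^esub> a)) = \<zero>\<^bsub>B\<^esub>"
    using q ac by (simp only: hom_smult hom_mult TR.m_closed a0) (simp add: B.r_null hom_closed)
  ultimately have zero: "\<pi> (?q \<otimes>\<^bsub>TR\<^esub> (\<one>\<^bsub>TR\<^esub> \<ominus>\<^bsub>TR\<^esub> d)) = \<zero>\<^bsub>B\<^esub>"
    by (simp only:)
  have od: "\<one>\<^bsub>TR\<^esub> \<ominus>\<^bsub>TR\<^esub> d \<in> carrier TR"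
    using one dc by (rule TR.minus_in_carrier)
  \<comment> \<open>The kernel contains q (\<one> - d); multiplying by the right inverse u puts q
    itself into it.\<close>
  have "?q = (?q \<otimes>\<^bsub>TR\<^esub> (\<one>\<^bsub>TR\<^esub> \<ominus>\<^bsub>TR\<^esub> d)) \<otimes>\<^bsub>TR\<^esub> u"
    unfolding TR.m_assoc[OF q od u(1)] u(2) using q by (rule TR.r_one[symmetric])
  then have "\<pi> ?q = \<pi> (?q \<otimes>\<^bsub>TR\<^esub> (\<one>\<^bsub>TR\<^esub> \<ominus>\<^bsub>TR\<^esub> d)) \<otimes>\<^bsub>B\<^esub> \<pi> u"
    using hom_mult[OF TR.m_closed[OF q od] u(1)] by (simp only:)
  then have "\<pi> ?q = \<zero>\<^bsub>B\<^esub>"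
    unfolding zero using B.l_null[OF hom_closed[OF u(1)]] by (simp only:)
  then show False
    using atom_not_in_kernel[OF proper \<alpha>s g(1)] by blast
qed

end

end

theorem corollary3p19:
  fixes G :: "('g, 'm) monoid_scheme" and P :: "'g set"
  assumes "group G" and "submonoid P G"
  shows "is_canonical_map G P (lambda_plus G P) \<and>
    cstar_iso
      ((toeplitz_universal G P)\<lparr>carrier := diagonal_universal G P\<rparr>)
      ((toeplitz_reduced G P)\<lparr>carrier := diagonal_reduced G P\<rparr>)
      (restrict (lambda_plus G P) (diagonal_universal G P)) \<and>
    (\<forall>(B :: 'b cstar_alg) \<pi>.
       cstar_algebra B \<and> unital_star_hom (toeplitz_reduced G P) B \<pi> \<longrightarrow>
       (inj_on \<pi> (diagonal_reduced G P) \<longleftrightarrow> jointly_proper G P B \<pi>))"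
proof -
  interpret group_submonoid G P
    using assms by (simp add: group_submonoid_def group_submonoid_axioms_def)
  show ?thesis
    using lambda_plus_canonical lambda_plus_diagonal_iso jointly_proper_if_injective injective_if_jointly_proper
    by blast
qed

end
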